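(* Let $K\ge2$ be even and let $Q(x)=\sum_{k=0}^Kq_kx^k$ be a polynomial with real coefficients and $q_K>0$. Let $v\in C^K(\mathbb{R})\cap L^\infty(\mathbb{R})$ satisfy $v(\xi)>0$ and $|v'(\xi)|\le Cv(\xi)$ for all $\xi\in\mathbb{R}$ and some constant $C$. Suppose that $$v^{(k)}v^{-1}\in L^\infty(\mathbb{R}),\quad k=1,\ldots,K-1,$$ that, for some $\delta>0$, $$\Big(\int_{-n(1+\delta)}^{n(1+\delta)}v(\xi)^{-2+4/K}\,d\xi\Big)\Big(\int_{-n}^{n}v(\xi)^{-2}\,d\xi\Big)^{-1}\to0$$ as $n\to\infty$, and that $v(\xi)\to0$ as $|\xi|\to\infty$. Let $A$ be the self-adjoint operator $A=vQ(D)v$ in $L^2(\mathbb{R})$, $D=i\,d/d\xi$. Then $$\operatorname{spec}_{\rm ess}(A)=[0,\infty).$$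
   Context: The symmetric operator $A_0$ in $L^2(\mathbb{R})$ is defined on the domain $C_0^K(\mathbb{R})$ ($K$ times continuously differentiable functions with compact support) by $A_0g=vQ(D)(vg)$. Under the stated conditions on $v$ it is essentially self-adjoint, and $A$ denotes its closure; $\mathcal{D}(A)$ consists of all $g\in L^2(\mathbb{R})$ such that $vQ(D)(vg)$, understood in the sense of distributions, belongs to $L^2(\mathbb{R})$, and $Ag=vQ(D)(vg)$. *)

theory Defs
  imports "HOL-Analysis.Analysis" "HOL-Computational_Algebra.Polynomial"
begin

definition nderiv :: "nat \<Rightarrow> (real \<Rightarrow> 'a::real_normed_vector) \<Rightarrow> real \<Rightarrow> 'a" where
  "nderiv k f = ((\<lambda>h t. vector_derivative h (at t)) ^^ k) f"

definition Ck :: "nat \<Rightarrow> (real \<Rightarrow> 'a::real_normed_vector) set" where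
  "Ck K = {f. (\<forall>k<K. \<forall>t. nderiv k f differentiable (at t)) \<and> continuous_on UNIV (nderiv K f)}"

definition Ck0 :: "nat \<Rightarrow> (real \<Rightarrow> 'a::real_normed_vector) set" where
  "Ck0 K = {f \<in> Ck K. compact (closure {t. f t \<noteq> 0})}"

definition Linf :: "(real \<Rightarrow> real) set" where
  "Linf = {f \<in> borel_measurable lborel. \<exists>B. AE t in lborel. \<bar>f t\<bar> \<le> B}"

text \<open>Elements of L2 are represented by functions; two functions represent the same element
  iff they agree almost everywhere, equivalently iff their difference has norm 0.\<close>

definition L2 :: "(real \<Rightarrow> complex) set" where
  "L2 = {f \<in> borel_measurable lborel. integrable lborel (\<lambda>t. (norm (f t))\<^sup>2)}"

definition l2norm :: "(real \<Rightarrow> complex) \<Rightarrow> real" where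
  "l2norm f = sqrt (LINT t|lborel. (norm (f t))\<^sup>2)"

text \<open>An unbounded operator in L2 is given by its graph, a set of pairs of representatives.\<close>

type_synonym l2graph = "((real \<Rightarrow> complex) \<times> (real \<Rightarrow> complex)) set"

text \<open>Closure of a graph in the product of L2 with itself. The result is saturated: it contains
  all almost-everywhere representatives of its elements.\<close>

definition graph_closure :: "l2graph \<Rightarrow> l2graph" where
  "graph_closure T = {(g, h). g \<in> L2 \<and> h \<in> L2 \<and>
     (\<exists>u w. (\<forall>n. (u n, w n) \<in> T) \<and>
        (\<lambda>n::nat. l2norm (\<lambda>t. u n t - g t)) \<longlonglongrightarrow> 0 \<and>
        (\<lambda>n. l2norm (\<lambda>t. w n t - h t)) \<longlonglongrightarrow> 0)}"

text \<open>The first condition says that the operator minus the scalar maps its domain onto L2; the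
  second that it is injective up to almost-everywhere equality, with bounded inverse.\<close>

definition resolvent_set :: "l2graph \<Rightarrow> complex set" where
  "resolvent_set T = {z.
     (\<forall>f\<in>L2. \<exists>g h. (g, h) \<in> T \<and> (AE t in lborel. h t - z * g t = f t)) \<and>
     (\<exists>c. \<forall>g h. (g, h) \<in> T \<longrightarrow> l2norm g \<le> c * l2norm (\<lambda>t. h t - z * g t))}"

definition spec :: "l2graph \<Rightarrow> complex set" where
  "spec T = - resolvent_set T"

definition eigenspace :: "l2graph \<Rightarrow> complex \<Rightarrow> (real \<Rightarrow> complex) set" where
  "eigenspace T z = {g. \<exists>h. (g, h) \<in> T \<and> (AE t in lborel. h t = z * g t)}"

definition eigenvalue :: "l2graph \<Rightarrow> complex \<Rightarrow> bool" where
  "eigenvalue T z \<longleftrightarrow> (\<exists>g\<in>eigenspace T z. \<not> (AE t in lborel. g t = 0))"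

definition finite_dim :: "(real \<Rightarrow> complex) set \<Rightarrow> bool" where
  "finite_dim E \<longleftrightarrow> (\<exists>B. finite B \<and> B \<subseteq> L2 \<and>
     (\<forall>g\<in>E. \<exists>c. AE t in lborel. g t = (\<Sum>b\<in>B. c b * b t)))"

definition spec_disc :: "l2graph \<Rightarrow> complex set" where
  "spec_disc T = {z. z isolated_in spec T \<and> eigenvalue T z \<and> finite_dim (eigenspace T z)}"

definition spec_ess :: "l2graph \<Rightarrow> complex set" where
  "spec_ess T = spec T - spec_disc T"

text \<open>Here \<open>D\<close> is \<open>\<i>\<close> times the derivative.\<close>

definition polyD :: "real poly \<Rightarrow> (real \<Rightarrow> complex) \<Rightarrow> real \<Rightarrow> complex" where
  "polyD Q f t = (\<Sum>k\<le>degree Q. of_real (coeff Q k) * \<i> ^ k * nderiv k f t)"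

definition op_A0 :: "(real \<Rightarrow> real) \<Rightarrow> real poly \<Rightarrow> l2graph" where
  "op_A0 v Q = {(g, \<lambda>t. of_real (v t) * polyD Q (\<lambda>s. of_real (v s) * g s) t) | g.
     g \<in> Ck0 (degree Q)}"

text \<open>The operator \<open>v Q(D) v\<close> itself; when \<open>op_A0 v Q\<close> is essentially self-adjoint, this closure
  is its unique self-adjoint extension.\<close>

definition op_A :: "(real \<Rightarrow> real) \<Rightarrow> real poly \<Rightarrow> l2graph" where
  "op_A v Q = graph_closure (op_A0 v Q)"

end

theory Submission
  imports Defs "HOL-Complex_Analysis.Great_Picard"
begin

text \<open>
  Write \<open>f = v g\<close>. The equation \<open>A g = z g\<close> becomes the differential equation
  \<open>Q(D) f = z v\<^sup>-\<^sup>2 f\<close>, and the whole proof moves between the two.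

  \<^emph>\<open>The half-line belongs to the spectrum.\<close> For \<open>\<mu> > 0\<close> and \<open>q = coeff Q K\<close> let \<open>a\<close> be the positive
  function with \<open>q a\<^sup>K = \<mu> v\<^sup>-\<^sup>2\<close>, so that \<open>a\<close> is a multiple of \<open>v\<^sup>-\<^sup>2\<^sup>/\<^sup>K\<close>, and let \<open>\<Psi>\<close> be a primitive of \<open>a\<close>.
  Then \<open>f = \<eta> exp (-i \<Psi>)\<close>, with a cutoff \<open>\<eta>\<close> between \<open>n\<close> and \<open>n (1 + \<delta>)\<close>, solves the equation up to
  terms with at most \<open>K - 1\<close> factors \<open>a\<close> (\<open>approximate_solution\<close>), because \<open>v\<close>, and hence \<open>a\<close>, dominates
  its own derivatives. For \<open>g = f / v\<close> this makes the square of the quotient of the norms of \<open>A g - \<mu> g\<close> and \<open>g\<close> at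
  most a constant times the quotient of the two integrals in the hypothesis, so \<open>A - \<mu>\<close> has no
  bounded inverse; a perturbation argument adds \<open>\<mu> = 0\<close>. No point of a half-line contained in the
  spectrum is isolated, so none belongs to the discrete spectrum.

  \<^emph>\<open>Nothing else belongs to the essential spectrum.\<close> A point \<open>z\<close> is in the resolvent set as soon as \<open>A - z\<close>
  and \<open>A - cnj z\<close> are bounded below on compactly supported functions (\<open>resolvent_setI\<close>): the range of \<open>A - z\<close>
  is closed, and what is orthogonal to it vanishes (\<open>orthogonal_to_range\<close>). The latter is essential
  self-adjointness. A function orthogonal to the range solves an ordinary differential equation weakly,
  so it is smooth enough to be a classical solution by a lemma of du Bois-Reymond type; weighted energy estimates, which rest on
  \<open>|v'| \<le> C v\<close>, show that its cutoffs approximate it in the graph norm. By symmetry \<open>A - z\<close> is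
  bounded below for nonreal \<open>z\<close>.

  For \<open>\<mu> < 0\<close> the form bound \<open>Q(D) \<ge> c\<^sub>1 D\<^sup>2 - c\<^sub>2\<close>, valid since \<open>K\<close> is even and \<open>q > 0\<close>, shows that for
  approximate eigenfunctions \<open>g\<^sub>n\<close> the functions \<open>v g\<^sub>n\<close> are bounded in \<open>H\<^sup>1\<close>. As \<open>v\<close> tends to \<open>0\<close> at
  infinity, they have a subsequence converging in the mean, and by the form bound so has \<open>g\<^sub>n\<close>
  (\<open>approximate_eigenfunctions_compact\<close>). Hence \<open>\<mu>\<close> is in the resolvent set or an eigenvalue, and
  orthonormal families of eigenfunctions can neither be infinite at one \<open>\<mu>\<close> nor belong to eigenvalues
  accumulating at \<open>\<mu>\<close>: the negative spectrum is discrete.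
\<close>

section \<open>Calculus of functions of class \<open>C\<^sup>K\<close>\<close>

lemma nderiv_0 [simp]: "nderiv 0 f = f"
  by (simp add: nderiv_def)

lemma nderiv_Suc: "nderiv (Suc k) f = (\<lambda>t. vector_derivative (nderiv k f) (at t))"
  by (simp add: nderiv_def)

lemma nderiv_1: "nderiv (Suc 0) f t = vector_derivative f (at t)"
  by (simp add: nderiv_def)

lemma nderiv_add_index: "nderiv j (nderiv k f) = nderiv (j + k) f"
  by (simp add: nderiv_def funpow_add)

lemma nderiv_Suc_shift: "nderiv (Suc k) f = nderiv k (nderiv 1 f)"
  using nderiv_add_index[of k 1 f] by simp

lemma nderiv_of_deriv: "nderiv k (nderiv (Suc 0) f) = nderiv (Suc k) f"
  by (simp add: nderiv_add_index)

lemma Ck_0: "f \<in> Ck 0 \<longleftrightarrow> continuous_on UNIV f"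
  by (simp add: Ck_def)

text \<open>The recursive description of the class: almost every closure property below is an induction on
  the order along this equivalence and \<open>Ck_SucI\<close>.\<close>

lemma Ck_Suc: "f \<in> Ck (Suc K) \<longleftrightarrow> (\<forall>t. f differentiable (at t)) \<and> nderiv 1 f \<in> Ck K"
proof -
  have *: "(\<forall>k<Suc K. P k) \<longleftrightarrow> P 0 \<and> (\<forall>k<K. P (Suc k))" for P :: "nat \<Rightarrow> bool"
    by (metis All_less_Suc2)
  show ?thesis
    unfolding Ck_def mem_Collect_eq * One_nat_def nderiv_of_deriv by simp
qed

lemma Ck_has_derivative_Suc:
  assumes "f \<in> Ck (Suc K)"
  shows "(f has_vector_derivative nderiv 1 f t) (at t)"
  using assms unfolding Ck_Suc by (simp add: nderiv_1 vector_derivative_works)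

lemma Ck_has_vector_derivative:
  assumes "f \<in> Ck K" "k < K"
  shows "(nderiv k f has_vector_derivative nderiv (Suc k) f t) (at t)"
  using assms unfolding Ck_def by (simp add: nderiv_Suc vector_derivative_works)

lemma Ck_SucI:
  assumes "\<And>t. (f has_vector_derivative f' t) (at t)" "f' \<in> Ck K"
  shows "f \<in> Ck (Suc K)"
proof -
  have "nderiv 1 f = f'" using assms(1) by (auto simp: nderiv_1 vector_derivative_at)
  then show ?thesis using assms unfolding Ck_Suc
    by (auto intro: differentiableI_vector)
qed

lemma nderiv_1_eq:
  assumes "\<And>t. (f has_vector_derivative f' t) (at t)"
  shows "nderiv (Suc 0) f = f'"
  using assms(1) by (auto simp: nderiv_1 vector_derivative_at)

lemma Ck_SucD: "f \<in> Ck (Suc K) \<Longrightarrow> f \<in> Ck K"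
proof (induction K arbitrary: f)
  case 0
  then show ?case unfolding Ck_Suc Ck_0
    by (meson continuous_at_imp_continuous_on differentiable_imp_continuous_within)
next
  case (Suc K)
  then show ?case by (metis Ck_Suc)
qed

lemma Ck_mono: "f \<in> Ck K \<Longrightarrow> J \<le> K \<Longrightarrow> f \<in> Ck J"
  by (rule inc_induct[of J K "\<lambda>i. f \<in> Ck i"]) (assumption+, erule Ck_SucD)

lemma nderiv_in_Ck: "f \<in> Ck (k + K) \<Longrightarrow> nderiv k f \<in> Ck K"
proof (induction k arbitrary: f)
  case (Suc k)
  then have "nderiv 1 f \<in> Ck (k + K)" by (simp add: Ck_Suc)
  then show ?case using Suc.IH by (metis nderiv_Suc_shift)
qed simp

lemma nderiv_in_Ck': "f \<in> Ck K \<Longrightarrow> k + j \<le> K \<Longrightarrow> nderiv k f \<in> Ck j"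
  by (meson Ck_mono nderiv_in_Ck)

lemma Ck_continuous_nderiv: "f \<in> Ck K \<Longrightarrow> k \<le> K \<Longrightarrow> continuous_on S (nderiv k f)"
  using nderiv_in_Ck'[of f K k 0] by (auto simp: Ck_0 intro: continuous_on_subset)

lemma Ck_continuous: "f \<in> Ck K \<Longrightarrow> continuous_on S f"
  using Ck_continuous_nderiv[of f K 0] by simp

lemma Ck_measurable: "f \<in> Ck K \<Longrightarrow> k \<le> K \<Longrightarrow> nderiv k f \<in> borel_measurable borel"
  by (intro borel_measurable_continuous_onI Ck_continuous_nderiv)

lemma nderiv_cong_open:
  assumes "open U" "\<And>s. s \<in> U \<Longrightarrow> f s = g s" "t \<in> U"
  shows "nderiv k f t = nderiv k g t"
  using assms(3)
proof (induction k arbitrary: t)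
  case (Suc k)
  have "vector_derivative (nderiv k f) (at t) = vector_derivative (nderiv k g) (at t)"
    by (rule vector_derivative_cong_eq)
       (use Suc assms(1) in \<open>auto simp: eventually_nhds intro!: exI[of _ U]\<close>)
  then show ?case by (simp add: nderiv_Suc)
qed (use assms in auto)

lemma nderiv_const: "nderiv (Suc k) (\<lambda>t. c) = (\<lambda>t. 0)"
  by (induction k) (simp_all add: nderiv_Suc)

lemma nderiv_zero_fun: "nderiv k (\<lambda>t. 0) = (\<lambda>t. 0)"
  by (cases k) (simp_all add: nderiv_const)

lemma Ck_const [simp]: "(\<lambda>t. c) \<in> Ck K"
proof (induction K arbitrary: c)
  case (Suc K)
  show ?case by (rule Ck_SucI[of _ "\<lambda>t. 0"]) (use Suc in auto)
qed (simp add: Ck_0)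

lemma Ck_ident [simp]: "(\<lambda>t. t) \<in> Ck K"
proof (cases K)
  case (Suc J)
  show ?thesis unfolding Suc by (rule Ck_SucI[of _ "\<lambda>t. 1"]) auto
qed (simp add: Ck_0)

lemma Ck_bounded_linear:
  assumes "bounded_linear L" "f \<in> Ck K"
  shows "(\<lambda>t. L (f t)) \<in> Ck K"
  using assms(2)
proof (induction K arbitrary: f)
  case (Suc K)
  show ?case
    by (rule Ck_SucI[of _ "\<lambda>t. L (nderiv 1 f t)"])
       (use Suc Ck_has_derivative_Suc[of f K] bounded_linear.has_vector_derivative[OF assms(1)] in
         \<open>auto simp: Ck_Suc\<close>)
qed (use bounded_linear.continuous_on[OF assms(1)] in \<open>auto simp: Ck_0\<close>)

lemma nderiv_bounded_linear:
  assumes "bounded_linear L" "f \<in> Ck K" "k \<le> K"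
  shows "nderiv k (\<lambda>t. L (f t)) t = L (nderiv k f t)"
  using assms(3)
proof (induction k arbitrary: t)
  case (Suc k)
  have "((\<lambda>t. L (nderiv k f t)) has_vector_derivative L (nderiv (Suc k) f t)) (at t)"
    using Suc.prems
    by (intro bounded_linear.has_vector_derivative[OF assms(1)] Ck_has_vector_derivative[OF assms(2)]) simp
  moreover have "nderiv k (\<lambda>t. L (f t)) = (\<lambda>t. L (nderiv k f t))"
    using Suc.prems by (intro ext Suc.IH) simp
  ultimately show ?case unfolding nderiv_Suc by (simp add: vector_derivative_at)
qed simp

lemma Ck_add: "f \<in> Ck K \<Longrightarrow> g \<in> Ck K \<Longrightarrow> (\<lambda>t. f t + g t) \<in> Ck K"
proof (induction K arbitrary: f g)
  case (Suc K)
  show ?case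
    by (rule Ck_SucI[of _ "\<lambda>t. nderiv 1 f t + nderiv 1 g t"])
       (use Suc Ck_has_derivative_Suc[of f K] Ck_has_derivative_Suc[of g K] in
         \<open>auto simp: Ck_Suc intro!: has_vector_derivative_add\<close>)
qed (auto simp: Ck_0 intro: continuous_on_add)

lemma nderiv_add:
  assumes "f \<in> Ck K" "g \<in> Ck K" "k \<le> K"
  shows "nderiv k (\<lambda>t. f t + g t) t = nderiv k f t + nderiv k g t"
  using assms(3)
proof (induction k arbitrary: t)
  case (Suc k)
  have "((\<lambda>t. nderiv k f t + nderiv k g t) has_vector_derivative
      nderiv (Suc k) f t + nderiv (Suc k) g t) (at t)"
    using Suc.prems
    by (intro has_vector_derivative_add Ck_has_vector_derivative[OF assms(1)] Ck_has_vector_derivative[OF assms(2)]) simp_all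
  moreover have "nderiv k (\<lambda>t. f t + g t) = (\<lambda>t. nderiv k f t + nderiv k g t)"
    using Suc.prems by (intro ext Suc.IH) simp
  ultimately show ?case unfolding nderiv_Suc by (simp add: vector_derivative_at)
qed simp

lemma Ck_mult:
  fixes f g :: "real \<Rightarrow> 'a::real_normed_algebra"
  shows "f \<in> Ck K \<Longrightarrow> g \<in> Ck K \<Longrightarrow> (\<lambda>t. f t * g t) \<in> Ck K"
proof (induction K arbitrary: f g)
  case (Suc K)
  show ?case
  proof (rule Ck_SucI[of _ "\<lambda>t. f t * nderiv 1 g t + nderiv 1 f t * g t"])
    show "((\<lambda>t. f t * g t) has_vector_derivative f t * nderiv 1 g t + nderiv 1 f t * g t) (at t)" for t
      using Suc.prems by (intro has_vector_derivative_mult Ck_has_derivative_Suc)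
    show "(\<lambda>t. f t * nderiv 1 g t + nderiv 1 f t * g t) \<in> Ck K"
      using Suc.prems Suc.prems[THEN Ck_SucD] by (intro Ck_add Suc.IH) (simp_all add: Ck_Suc)
  qed
qed (auto simp: Ck_0 intro: continuous_on_mult)

lemma nderiv_1_mult:
  fixes f g :: "real \<Rightarrow> 'a::real_normed_algebra"
  assumes "f \<in> Ck (Suc K)" "g \<in> Ck (Suc J)"
  shows "nderiv (Suc 0) (\<lambda>t. f t * g t) = (\<lambda>t. f t * nderiv 1 g t + nderiv 1 f t * g t)"
  by (rule nderiv_1_eq, rule has_vector_derivative_mult) (use Ck_has_derivative_Suc[OF assms(1)] Ck_has_derivative_Suc[OF assms(2)] in simp_all)

lemma Ck_cmult:
  fixes f :: "real \<Rightarrow> 'a::real_normed_algebra"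
  shows "f \<in> Ck K \<Longrightarrow> (\<lambda>t. c * f t) \<in> Ck K"
  by (intro Ck_mult) auto

lemma nderiv_cmult:
  fixes f :: "real \<Rightarrow> 'a::real_normed_algebra"
  assumes "f \<in> Ck K" "k \<le> K"
  shows "nderiv k (\<lambda>t. c * f t) t = c * nderiv k f t"
  using nderiv_bounded_linear[OF bounded_linear_mult_right assms] .

lemma Ck_diff:
  fixes f :: "real \<Rightarrow> 'a::real_normed_vector"
  assumes "f \<in> Ck K" "g \<in> Ck K" shows "(\<lambda>t. f t - g t) \<in> Ck K"
  using Ck_add[OF assms(1) Ck_bounded_linear[OF bounded_linear_minus[OF bounded_linear_ident] assms(2)]]
  by simp

lemma nderiv_diff:
  fixes f :: "real \<Rightarrow> 'a::real_normed_vector"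
  assumes "f \<in> Ck K" "g \<in> Ck K" "k \<le> K"
  shows "nderiv k (\<lambda>t. f t - g t) t = nderiv k f t - nderiv k g t"
  using nderiv_add[OF assms(1) Ck_bounded_linear[OF bounded_linear_minus[OF bounded_linear_ident] assms(2)] assms(3), of t]
    nderiv_bounded_linear[OF bounded_linear_minus[OF bounded_linear_ident] assms(2,3)]
  by simp

lemma Ck_of_real:
  "f \<in> Ck K \<Longrightarrow> (\<lambda>t. of_real (f t) :: complex) \<in> Ck K"
  by (rule Ck_bounded_linear[OF bounded_linear_of_real])

lemma nderiv_of_real:
  "f \<in> Ck K \<Longrightarrow> k \<le> K \<Longrightarrow> nderiv k (\<lambda>t. of_real (f t) :: complex) t = of_real (nderiv k f t)"
  by (rule nderiv_bounded_linear[OF bounded_linear_of_real])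

lemma Ck_cnj: "f \<in> Ck K \<Longrightarrow> (\<lambda>t. cnj (f t)) \<in> Ck K"
  by (rule Ck_bounded_linear[OF bounded_linear_cnj])

lemma nderiv_cnj: "f \<in> Ck K \<Longrightarrow> k \<le> K \<Longrightarrow> nderiv k (\<lambda>t. cnj (f t)) t = cnj (nderiv k f t)"
  by (rule nderiv_bounded_linear[OF bounded_linear_cnj])

lemma Ck_inverse:
  fixes f :: "real \<Rightarrow> real"
  assumes "\<And>t. f t \<noteq> 0"
  shows "f \<in> Ck K \<Longrightarrow> (\<lambda>t. inverse (f t)) \<in> Ck K"
proof (induction K)
  case (Suc K)
  have d: "((\<lambda>t. inverse (f t)) has_vector_derivative - (inverse (f t) * nderiv 1 f t * inverse (f t))) (at t)" for t
    using Ck_has_derivative_Suc[OF Suc.prems, of t] assms[of t]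
    unfolding has_real_derivative_iff_has_vector_derivative[symmetric]
    by (intro DERIV_inverse') 
  show ?case
  proof (rule Ck_SucI[OF d])
    have "(\<lambda>t. inverse (f t)) \<in> Ck K" by (rule Suc.IH[OF Ck_SucD[OF Suc.prems]])
    moreover have "nderiv 1 f \<in> Ck K" using Suc by (simp add: Ck_Suc)
    ultimately have "(\<lambda>t. (-1) * (inverse (f t) * nderiv 1 f t * inverse (f t))) \<in> Ck K"
      by (intro Ck_mult) auto
    then show "(\<lambda>t. - (inverse (f t) * nderiv 1 f t * inverse (f t))) \<in> Ck K" by simp
  qed
qed (use assms in \<open>auto simp: Ck_0 intro: continuous_on_inverse\<close>)

lemma Ck_exp:
  fixes f :: "real \<Rightarrow> complex"
  shows "f \<in> Ck K \<Longrightarrow> (\<lambda>t. exp (f t)) \<in> Ck K"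
proof (induction K)
  case (Suc K)
  have d: "((\<lambda>t. exp (f t)) has_vector_derivative nderiv 1 f t * exp (f t)) (at t)" for t
    using field_vector_diff_chain_at[OF Ck_has_derivative_Suc[OF Suc.prems, of t] DERIV_exp]
    by (simp add: o_def)
  show ?case
    by (rule Ck_SucI[OF d], rule Ck_mult) (use Suc.IH[OF Ck_SucD[OF Suc.prems]] Suc.prems in \<open>simp_all add: Ck_Suc\<close>)
qed (auto simp: Ck_0 intro: continuous_on_exp)

lemma Ck_powr:
  fixes f :: "real \<Rightarrow> real"
  assumes "\<And>t. f t > 0"
  shows "f \<in> Ck K \<Longrightarrow> (\<lambda>t. f t powr p) \<in> Ck K"
proof (induction K)
  case (Suc K)
  have nz: "f t \<noteq> 0" for t using assms[of t] by simp
  have d: "((\<lambda>t. f t powr p) has_vector_derivative p * (nderiv 1 f t * inverse (f t) * f t powr p)) (at t)" for t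
  proof -
    have "((\<lambda>t. f t powr p) has_real_derivative p * f t powr (p - 1) * nderiv 1 f t) (at t)"
      using Ck_has_derivative_Suc[OF Suc.prems, of t] assms[of t] DERIV_fun_powr[of f _ t p]
      unfolding has_real_derivative_iff_has_vector_derivative[symmetric] by simp
    moreover have "f t powr (p - 1) = inverse (f t) * f t powr p"
      using assms[of t] by (simp add: powr_diff field_simps)
    ultimately show ?thesis by (simp add: has_real_derivative_iff_has_vector_derivative mult_ac)
  qed
  show ?case
    by (rule Ck_SucI[OF d], intro Ck_mult Ck_const Ck_inverse nz)
       (use Suc.IH[OF Ck_SucD[OF Suc.prems]] Suc.prems Ck_SucD[OF Suc.prems] in \<open>simp_all add: Ck_Suc\<close>)
qed (use assms in \<open>auto simp: Ck_0 intro!: continuous_on_powr continuous_on_const\<close>, metis less_irrefl)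

lemma Ck0_iff: "f \<in> Ck0 K \<longleftrightarrow> f \<in> Ck K \<and> (\<exists>R. \<forall>t. \<bar>t\<bar> > R \<longrightarrow> f t = 0)"
proof -
  have "compact (closure {t. f t \<noteq> 0}) \<longleftrightarrow> (\<exists>R. \<forall>t. \<bar>t\<bar> > R \<longrightarrow> f t = 0)"
    unfolding compact_closure bounded_iff
    by (auto simp: not_less[symmetric])
  then show ?thesis unfolding Ck0_def by simp
qed

lemma nderiv_zero_outside:
  fixes R :: real
  assumes "\<And>t. \<bar>t\<bar> > R \<Longrightarrow> f t = 0" "\<bar>t\<bar> > R"
  shows "nderiv k f t = 0"
proof -
  have "nderiv k f t = nderiv k (\<lambda>t. 0) t"
  proof (rule nderiv_cong_open)
    show "open {t. R < \<bar>t\<bar>}" by (intro open_Collect_less continuous_intros)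
  qed (use assms in auto)
  also have "\<dots> = 0" by (cases k) (simp_all add: nderiv_const)
  finally show ?thesis .
qed

lemma Ck0_Ck: "f \<in> Ck0 K \<Longrightarrow> f \<in> Ck K"
  by (simp add: Ck0_def)

lemma nderiv_in_Ck0: "f \<in> Ck0 K \<Longrightarrow> k + j \<le> K \<Longrightarrow> nderiv k f \<in> Ck0 j"
  unfolding Ck0_iff by (metis nderiv_in_Ck' nderiv_zero_outside)

lemma Ck0_mult_left:
  fixes f g :: "real \<Rightarrow> 'a::real_normed_algebra"
  shows "f \<in> Ck0 K \<Longrightarrow> g \<in> Ck K \<Longrightarrow> (\<lambda>t. f t * g t) \<in> Ck0 K"
  unfolding Ck0_iff by (metis Ck_mult mult_zero_left mult_zero_right)

lemma Ck0_mult_right: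
  fixes f g :: "real \<Rightarrow> 'a::real_normed_algebra"
  shows "f \<in> Ck K \<Longrightarrow> g \<in> Ck0 K \<Longrightarrow> (\<lambda>t. f t * g t) \<in> Ck0 K"
  unfolding Ck0_iff by (metis Ck_mult mult_zero_left mult_zero_right)

lemma Ck0_add: "f \<in> Ck0 K \<Longrightarrow> g \<in> Ck0 K \<Longrightarrow> (\<lambda>t. f t + g t) \<in> Ck0 K"
proof -
  assume a: "f \<in> Ck0 K" "g \<in> Ck0 K"
  then obtain R S where "\<And>t. \<bar>t\<bar> > R \<Longrightarrow> f t = 0" "\<And>t. \<bar>t\<bar> > S \<Longrightarrow> g t = 0"
    unfolding Ck0_iff by blast
  then have "\<And>t. \<bar>t\<bar> > max R S \<Longrightarrow> f t + g t = 0" by simp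
  then show ?thesis using a Ck_add unfolding Ck0_iff by blast
qed

lemma Ck0_diff:
  fixes f g :: "real \<Rightarrow> 'a::real_normed_algebra_1"
  assumes "f \<in> Ck0 K" "g \<in> Ck0 K" shows "(\<lambda>t. f t - g t) \<in> Ck0 K"
  using Ck0_add[OF assms(1) Ck0_mult_right[OF Ck_const[of "-1"] assms(2)]] by simp

text \<open>What Leibniz' rule says about cutoffs: the leading terms cancel in the commutator, so only lower
  derivatives of \<open>w\<close> remain. The bound is pointwise, and \<open>M\<close> may be \<open>0\<close> wherever \<open>\<eta>\<close> is locally
  constant.\<close>

lemma nderiv_commutator_bound:
  fixes \<eta> w :: "real \<Rightarrow> 'a::real_normed_algebra_1"
  assumes "\<eta> \<in> Ck k" "w \<in> Ck k" "\<And>j. 1 \<le> j \<Longrightarrow> j \<le> k \<Longrightarrow> norm (nderiv j \<eta> t) \<le> M"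
  shows "norm (nderiv k (\<lambda>s. \<eta> s * w s) t - \<eta> t * nderiv k w t) \<le> 2 ^ k * M * (\<Sum>j<k. norm (nderiv j w t))"
  using assms
proof (induction k arbitrary: \<eta> w)
  case (Suc k)
  let ?\<eta>' = "nderiv (Suc 0) \<eta>" and ?w' = "nderiv (Suc 0) w"
  have M: "norm (?\<eta>' t) \<le> M" using Suc.prems(3)[of 1] by simp
  then have M0: "M \<ge> 0" using norm_ge_zero order_trans by blast
  have C: "?\<eta>' \<in> Ck k" "?w' \<in> Ck k" "\<eta> \<in> Ck k" "w \<in> Ck k"
    using Suc.prems(1,2) Suc.prems(1,2)[THEN Ck_SucD] by (simp_all add: Ck_Suc)
  have split: "nderiv (Suc k) (\<lambda>s. \<eta> s * w s) t
      = nderiv k (\<lambda>s. \<eta> s * ?w' s) t + nderiv k (\<lambda>s. ?\<eta>' s * w s) t"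
    unfolding nderiv_Suc_shift[of k "\<lambda>s. \<eta> s * w s"] nderiv_1_mult[OF Suc.prems(1,2)] One_nat_def
    by (rule nderiv_add[of _ k]) (use Ck_mult[OF C(3,2)] Ck_mult[OF C(1,4)] in simp_all)
  have 1: "norm (nderiv k (\<lambda>s. \<eta> s * ?w' s) t - \<eta> t * nderiv k ?w' t)
      \<le> 2 ^ k * M * (\<Sum>j<k. norm (nderiv j ?w' t))"
    by (rule Suc.IH) (use C Suc.prems in auto)
  have 2: "norm (nderiv k (\<lambda>s. ?\<eta>' s * w s) t - ?\<eta>' t * nderiv k w t)
      \<le> 2 ^ k * M * (\<Sum>j<k. norm (nderiv j w t))"
    by (rule Suc.IH) (use C Suc.prems(3) in \<open>auto simp: nderiv_of_deriv\<close>)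
  have 3: "norm (?\<eta>' t * nderiv k w t) \<le> 2 ^ k * M * norm (nderiv k w t)"
  proof -
    have "norm (?\<eta>' t * nderiv k w t) \<le> M * norm (nderiv k w t)"
      by (meson M mult_right_mono norm_ge_zero norm_mult_ineq order_trans)
    also have "\<dots> \<le> (2 ^ k * M) * norm (nderiv k w t)"
      using M0 by (intro mult_right_mono) (auto simp: mult_le_cancel_right1)
    finally show ?thesis .
  qed
  have "norm (nderiv (Suc k) (\<lambda>s. \<eta> s * w s) t - \<eta> t * nderiv (Suc k) w t)
      \<le> norm (nderiv k (\<lambda>s. \<eta> s * ?w' s) t - \<eta> t * nderiv k ?w' t)
        + (norm (nderiv k (\<lambda>s. ?\<eta>' s * w s) t - ?\<eta>' t * nderiv k w t) + norm (?\<eta>' t * nderiv k w t))"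
    unfolding split nderiv_of_deriv[of k w]
    by (rule order_trans[OF _ add_left_mono[OF norm_triangle_ineq]])
       (rule order_trans[OF _ norm_triangle_ineq], simp add: algebra_simps)
  also have "\<dots> \<le> 2 ^ k * M * (\<Sum>j<k. norm (nderiv (Suc j) w t))
      + (2 ^ k * M * (\<Sum>j<k. norm (nderiv j w t)) + 2 ^ k * M * norm (nderiv k w t))"
    using 1 2 3 by (simp add: nderiv_of_deriv)
  also have "\<dots> = 2 ^ k * M * (\<Sum>j<k. norm (nderiv (Suc j) w t))
      + 2 ^ k * M * (\<Sum>j<Suc k. norm (nderiv j w t))"
    by (simp add: algebra_simps)
  also have "(\<Sum>j<k. norm (nderiv (Suc j) w t)) \<le> (\<Sum>j<Suc k. norm (nderiv j w t))"
    by (subst sum.lessThan_Suc_shift) simp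
  also have "2 ^ k * M * (\<Sum>j<Suc k. norm (nderiv j w t)) + 2 ^ k * M * (\<Sum>j<Suc k. norm (nderiv j w t))
      = 2 ^ Suc k * M * (\<Sum>j<Suc k. norm (nderiv j w t))"
    by (simp add: algebra_simps)
  finally show ?case using M0 by (simp add: mult_left_mono)
qed simp


section \<open>The Hilbert space of square-integrable functions\<close>

definition ip :: "(real \<Rightarrow> complex) \<Rightarrow> (real \<Rightarrow> complex) \<Rightarrow> complex" where
  "ip f g = (LINT t|lborel. f t * cnj (g t))"

lemma L2_measurable: "f \<in> L2 \<Longrightarrow> f \<in> borel_measurable borel"
  by (simp add: L2_def)

lemma L2_integrable: "f \<in> L2 \<Longrightarrow> integrable lborel (\<lambda>t. (norm (f t))\<^sup>2)"
  by (simp add: L2_def)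

lemma L2I: "f \<in> borel_measurable borel \<Longrightarrow> integrable lborel (\<lambda>t. (norm (f t))\<^sup>2) \<Longrightarrow> f \<in> L2"
  by (simp add: L2_def)

lemma l2norm_nonneg [simp]: "0 \<le> l2norm f"
  by (simp add: l2norm_def)

lemma l2norm_power2: "(l2norm f)\<^sup>2 = (LINT t|lborel. (norm (f t))\<^sup>2)"
  by (simp add: l2norm_def)

lemma L2_cong_AE: "f \<in> L2 \<Longrightarrow> g \<in> borel_measurable borel \<Longrightarrow> AE t in lborel. g t = f t \<Longrightarrow> g \<in> L2"
  by (rule L2I, assumption, rule integrable_cong_AE_imp[OF L2_integrable]) auto

lemma l2norm_cong_AE:
  "f \<in> borel_measurable borel \<Longrightarrow> g \<in> borel_measurable borel \<Longrightarrow> AE t in lborel. g t = f t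
    \<Longrightarrow> l2norm g = l2norm f"
  unfolding l2norm_def by (intro arg_cong[where f=sqrt] integral_cong_AE) auto

lemma L2_dominated:
  assumes "f \<in> L2" "g \<in> borel_measurable borel" "\<And>t. norm (g t) \<le> B * norm (f t)"
  shows "g \<in> L2" "l2norm g \<le> \<bar>B\<bar> * l2norm f"
proof -
  have le: "(norm (g t))\<^sup>2 \<le> B\<^sup>2 * (norm (f t))\<^sup>2" for t
    using power_mono[OF assms(3), of t 2] by (simp add: power_mult_distrib)
  have i: "integrable lborel (\<lambda>t. B\<^sup>2 * (norm (f t))\<^sup>2)" using L2_integrable[OF assms(1)] by simp
  have ig: "integrable lborel (\<lambda>t. (norm (g t))\<^sup>2)"
    by (rule Bochner_Integration.integrable_bound[OF i]) (use assms le in \<open>auto simp: abs_mult\<close>)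
  then show "g \<in> L2" using assms(2) by (simp add: L2I)
  have "(l2norm g)\<^sup>2 \<le> (LINT t|lborel. B\<^sup>2 * (norm (f t))\<^sup>2)"
    unfolding l2norm_power2 by (rule integral_mono[OF ig i le])
  also have "\<dots> = (\<bar>B\<bar> * l2norm f)\<^sup>2" by (simp add: l2norm_power2 power_mult_distrib)
  finally show "l2norm g \<le> \<bar>B\<bar> * l2norm f" by (rule power2_le_imp_le) simp
qed

lemma L2_cmult: "f \<in> L2 \<Longrightarrow> (\<lambda>t. c * f t) \<in> L2"
  by (rule L2_dominated(1)[of f _ "norm c"]) (auto simp: norm_mult dest: L2_measurable)

lemma borel_measurable_cnj [measurable (raw)]:
  "f \<in> borel_measurable M \<Longrightarrow> (\<lambda>t. cnj (f t)) \<in> borel_measurable M"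
  by (rule borel_measurable_continuous_on[of cnj]) (auto intro: continuous_intros)

lemma L2_cnj: "f \<in> L2 \<Longrightarrow> (\<lambda>t. cnj (f t)) \<in> L2"
  by (rule L2_dominated(1)[of f _ 1]) (auto dest: L2_measurable)

lemma L2_zero [simp]: "(\<lambda>t. 0) \<in> L2"
  by (simp add: L2_def)

lemma L2_add:
  assumes "f \<in> L2" "g \<in> L2" shows "(\<lambda>t. f t + g t) \<in> L2"
proof (rule L2I)
  note [measurable] = assms[THEN L2_measurable]
  have le: "(norm (f t + g t))\<^sup>2 \<le> 2 * (norm (f t))\<^sup>2 + 2 * (norm (g t))\<^sup>2" for t
    using power_mono[OF norm_triangle_ineq[of "f t" "g t"], of 2] sum_squares_bound[of "norm (f t)" "norm (g t)"]
    by (simp add: power2_sum)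
  have i: "integrable lborel (\<lambda>t. 2 * (norm (f t))\<^sup>2 + 2 * (norm (g t))\<^sup>2)"
    using assms[THEN L2_integrable] by simp
  show "integrable lborel (\<lambda>t. (norm (f t + g t))\<^sup>2)"
  proof (rule Bochner_Integration.integrable_bound[OF i], measurable, rule AE_I2)
    show "norm ((norm (f t + g t))\<^sup>2) \<le> norm (2 * (norm (f t))\<^sup>2 + 2 * (norm (g t))\<^sup>2)" for t
      using le[of t] by simp
  qed
  show "(\<lambda>t. f t + g t) \<in> borel_measurable borel" by measurable
qed

lemma L2_diff: "f \<in> L2 \<Longrightarrow> g \<in> L2 \<Longrightarrow> (\<lambda>t. f t - g t) \<in> L2"
  using L2_add[of f "\<lambda>t. (-1) * g t"] L2_cmult[of g "-1"] by simp

lemma L2_sum: "(\<And>i. i \<in> I \<Longrightarrow> f i \<in> L2) \<Longrightarrow> (\<lambda>t. \<Sum>i\<in>I. f i t) \<in> L2"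
  by (induction I rule: infinite_finite_induct) (auto intro: L2_add)

lemma integrable_L2_mult:
  assumes "f \<in> L2" "g \<in> L2"
  shows "integrable lborel (\<lambda>t. norm (f t) * norm (g t))" "integrable lborel (\<lambda>t. f t * g t)"
proof -
  have i: "integrable lborel (\<lambda>t. (norm (f t))\<^sup>2 + (norm (g t))\<^sup>2)"
    using assms[THEN L2_integrable] by simp
  have "norm (f t) * norm (g t) \<le> (norm (f t))\<^sup>2 + (norm (g t))\<^sup>2" for t
  proof -
    have "0 \<le> norm (f t) * norm (g t)" by simp
    then show ?thesis using sum_squares_bound[of "norm (f t)" "norm (g t)"] by linarith
  qed
  note le = this
  note [measurable] = assms[THEN L2_measurable]
  have le': "norm (norm (f t) * norm (g t)) \<le> norm ((norm (f t))\<^sup>2 + (norm (g t))\<^sup>2)"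
    "norm (f t * g t) \<le> norm ((norm (f t))\<^sup>2 + (norm (g t))\<^sup>2)" for t
    using le[of t] by (simp_all add: norm_mult)
  show "integrable lborel (\<lambda>t. norm (f t) * norm (g t))"
    by (rule Bochner_Integration.integrable_bound[OF i], measurable, rule AE_I2, rule le'(1))
  show "integrable lborel (\<lambda>t. f t * g t)"
    by (rule Bochner_Integration.integrable_bound[OF i], measurable, rule AE_I2, rule le'(2))
qed

lemma integral_mult_le_l2norm:
  assumes f: "f \<in> L2" and g: "g \<in> L2"
  shows "(LINT t|lborel. norm (f t) * norm (g t)) \<le> l2norm f * l2norm g"
proof -
  define X where "X = (LINT t|lborel. norm (f t) * norm (g t))"
  have X0: "X \<ge> 0" unfolding X_def by simp
  have quad: "0 \<le> s\<^sup>2 * (l2norm f)\<^sup>2 - 2 * s * X + (l2norm g)\<^sup>2" for s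
  proof -
    have "0 \<le> (LINT t|lborel. (s * norm (f t) - norm (g t))\<^sup>2)" by simp
    also have "\<dots> = (LINT t|lborel. s\<^sup>2 * (norm (f t))\<^sup>2 - 2 * s * (norm (f t) * norm (g t)) + (norm (g t))\<^sup>2)"
      by (simp add: power2_diff power_mult_distrib algebra_simps)
    also have "\<dots> = s\<^sup>2 * (l2norm f)\<^sup>2 - 2 * s * X + (l2norm g)\<^sup>2"
      unfolding l2norm_power2 X_def
      using f[THEN L2_integrable] g[THEN L2_integrable] integrable_L2_mult(1)[OF f g] by simp
    finally show ?thesis .
  qed
  have "X\<^sup>2 \<le> (l2norm f)\<^sup>2 * (l2norm g)\<^sup>2"
  proof (cases "l2norm f = 0")
    case True
    have "X = 0"
    proof (rule ccontr)
      assume "X \<noteq> 0"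
      then have "2 * (((l2norm g)\<^sup>2 + 1) / (2 * X)) * X = (l2norm g)\<^sup>2 + 1" by (simp add: field_simps)
      then show False using quad[of "((l2norm g)\<^sup>2 + 1) / (2 * X)"] True by simp
    qed
    then show ?thesis by simp
  next
    case False
    then have "(X / (l2norm f)\<^sup>2)\<^sup>2 * (l2norm f)\<^sup>2 - 2 * (X / (l2norm f)\<^sup>2) * X = - (X\<^sup>2 / (l2norm f)\<^sup>2)"
      by (simp add: field_simps power2_eq_square)
    with quad[of "X / (l2norm f)\<^sup>2"] have "X\<^sup>2 / (l2norm f)\<^sup>2 \<le> (l2norm g)\<^sup>2" by simp
    then show ?thesis using False by (simp add: divide_le_eq mult.commute)
  qed
  then show ?thesis unfolding X_def[symmetric] power_mult_distrib[symmetric]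
    by (rule power2_le_imp_le) simp
qed

lemma ip_cauchy_schwarz:
  assumes "f \<in> L2" "g \<in> L2" shows "norm (ip f g) \<le> l2norm f * l2norm g"
proof -
  have "norm (ip f g) \<le> (LINT t|lborel. norm (f t) * norm (g t))"
    unfolding ip_def using integral_norm_bound[of lborel "\<lambda>t. f t * cnj (g t)"] by (simp add: norm_mult)
  then show ?thesis using integral_mult_le_l2norm[OF assms] by linarith
qed

lemma ip_integrable: "f \<in> L2 \<Longrightarrow> g \<in> L2 \<Longrightarrow> integrable lborel (\<lambda>t. f t * cnj (g t))"
  by (rule integrable_L2_mult(2)[OF _ L2_cnj])

lemma ip_add_left: "f \<in> L2 \<Longrightarrow> g \<in> L2 \<Longrightarrow> h \<in> L2 \<Longrightarrow> ip (\<lambda>t. f t + g t) h = ip f h + ip g h"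
  unfolding ip_def by (simp add: distrib_right ip_integrable)

lemma ip_diff_left: "f \<in> L2 \<Longrightarrow> g \<in> L2 \<Longrightarrow> h \<in> L2 \<Longrightarrow> ip (\<lambda>t. f t - g t) h = ip f h - ip g h"
  unfolding ip_def by (simp add: left_diff_distrib ip_integrable)

lemma ip_cmult_left: "ip (\<lambda>t. c * f t) h = c * ip f h"
  unfolding ip_def by (simp add: mult.assoc)

lemma ip_cnj: "ip g f = cnj (ip f g)"
  using Bochner_Integration.integral_cnj[of lborel "\<lambda>t. f t * cnj (g t)"] unfolding ip_def by (simp add: mult.commute)

lemma ip_add_right: "f \<in> L2 \<Longrightarrow> g \<in> L2 \<Longrightarrow> h \<in> L2 \<Longrightarrow> ip h (\<lambda>t. f t + g t) = ip h f + ip h g"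
  unfolding ip_cnj[of h "\<lambda>t. f t + g t"] ip_cnj[of h f] ip_cnj[of h g] by (simp add: ip_add_left)

lemma ip_cmult_right: "ip h (\<lambda>t. c * f t) = cnj c * ip h f"
  unfolding ip_cnj[of h "\<lambda>t. c * f t"] ip_cnj[of h f] by (simp add: ip_cmult_left)

lemma ip_self: "ip f f = of_real ((l2norm f)\<^sup>2)"
  unfolding ip_def l2norm_power2 integral_complex_of_real[symmetric]
  by (simp add: complex_norm_square[symmetric])

lemma l2norm_add_power2:
  assumes "f \<in> L2" "g \<in> L2"
  shows "(l2norm (\<lambda>t. f t + g t))\<^sup>2 = (l2norm f)\<^sup>2 + (l2norm g)\<^sup>2 + 2 * Re (ip f g)"
proof -
  have "ip (\<lambda>t. f t + g t) (\<lambda>t. f t + g t) = ip f f + ip g g + (ip f g + cnj (ip f g))"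
    using assms L2_add[OF assms] by (simp add: ip_add_left ip_add_right ip_cnj[of g f])
  then have "of_real ((l2norm (\<lambda>t. f t + g t))\<^sup>2) = complex_of_real ((l2norm f)\<^sup>2 + (l2norm g)\<^sup>2 + 2 * Re (ip f g))"
    unfolding ip_self by (simp add: complex_add_cnj)
  then show ?thesis using of_real_eq_iff by blast
qed

lemma l2norm_triangle:
  assumes "f \<in> L2" "g \<in> L2" shows "l2norm (\<lambda>t. f t + g t) \<le> l2norm f + l2norm g"
proof -
  have "Re (ip f g) \<le> l2norm f * l2norm g"
    using ip_cauchy_schwarz[OF assms] complex_Re_le_cmod order_trans by blast
  then have "(l2norm (\<lambda>t. f t + g t))\<^sup>2 \<le> (l2norm f + l2norm g)\<^sup>2"
    unfolding l2norm_add_power2[OF assms] by (simp add: power2_sum)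
  then show ?thesis by (rule power2_le_imp_le) simp
qed

lemma l2norm_cmult: "l2norm (\<lambda>t. c * f t) = norm c * l2norm f"
  by (simp add: l2norm_def norm_mult power_mult_distrib real_sqrt_mult)

lemma l2norm_minus_commute: "l2norm (\<lambda>t. f t - g t) = l2norm (\<lambda>t. g t - f t)"
  by (simp add: l2norm_def norm_minus_commute)

lemma l2norm_diff_triangle:
  assumes "f \<in> L2" "g \<in> L2" "h \<in> L2"
  shows "l2norm (\<lambda>t. f t - h t) \<le> l2norm (\<lambda>t. f t - g t) + l2norm (\<lambda>t. g t - h t)"
  using l2norm_triangle[OF L2_diff[OF assms(1,2)] L2_diff[OF assms(2,3)]] by simp

lemma l2norm_triangle_diff:
  assumes "f \<in> L2" "g \<in> L2"
  shows "l2norm f \<le> l2norm (\<lambda>t. f t - g t) + l2norm g"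
  using l2norm_triangle[OF L2_diff[OF assms] assms(2)] by simp

lemma l2norm_triangle4:
  assumes "f \<in> L2" "g \<in> L2"
  shows "l2norm (\<lambda>t. f t - g t) \<le> l2norm f + l2norm g"
  using l2norm_triangle[OF assms(1) L2_cmult[OF assms(2), of "-1"]] l2norm_cmult[of "-1" g] by simp

lemma l2norm_eq_0_iff:
  assumes "f \<in> L2" shows "l2norm f = 0 \<longleftrightarrow> (AE t in lborel. f t = 0)"
  unfolding l2norm_def real_sqrt_eq_0_iff
  by (subst integral_nonneg_eq_0_iff_AE[OF L2_integrable[OF assms]]) auto

lemma l2norm_diff_power2:
  assumes "f \<in> L2" "g \<in> L2"
  shows "(l2norm (\<lambda>t. f t - g t))\<^sup>2 = (l2norm f)\<^sup>2 + (l2norm g)\<^sup>2 - 2 * Re (ip f g)"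
  using l2norm_add_power2[OF assms(1) L2_cmult[OF assms(2), of "-1"]] l2norm_cmult[of "-1" g]
    ip_cmult_right[of f "-1" g] by simp

lemma l2norm_tendsto:
  assumes "\<And>n. u n \<in> L2" "g \<in> L2" "(\<lambda>n. l2norm (\<lambda>t. u n t - g t)) \<longlonglongrightarrow> 0"
  shows "(\<lambda>n. l2norm (u n)) \<longlonglongrightarrow> l2norm g"
proof -
  have "\<bar>l2norm (u n) - l2norm g\<bar> \<le> l2norm (\<lambda>t. u n t - g t)" for n
    using l2norm_triangle_diff[OF assms(1) assms(2), of n] l2norm_triangle_diff[OF assms(2) assms(1), of n]
      l2norm_minus_commute[of g "u n"] by linarith
  then have "(\<lambda>n. l2norm (u n) - l2norm g) \<longlonglongrightarrow> 0"
    by (intro tendsto_rabs_zero_cancel[OF tendsto_sandwich[OF _ _ tendsto_const assms(3)]]) auto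
  then show ?thesis by (simp add: LIM_zero_iff)
qed

lemma ip_tendsto:
  assumes "\<And>n. u n \<in> L2" "g \<in> L2" "(\<lambda>n. l2norm (\<lambda>t. u n t - g t)) \<longlonglongrightarrow> 0" "h \<in> L2"
  shows "(\<lambda>n. ip (u n) h) \<longlonglongrightarrow> ip g h"
proof -
  have "norm (ip (u n) h - ip g h) \<le> l2norm (\<lambda>t. u n t - g t) * l2norm h" for n
    using ip_cauchy_schwarz[OF L2_diff[OF assms(1,2)] assms(4)] assms by (simp add: ip_diff_left)
  moreover have "(\<lambda>n. l2norm (\<lambda>t. u n t - g t) * l2norm h) \<longlonglongrightarrow> 0"
    using tendsto_mult_left_zero[OF assms(3)] .
  ultimately have "(\<lambda>n. ip (u n) h - ip g h) \<longlonglongrightarrow> 0"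
    by (rule Lim_null_comparison[OF always_eventually[OF allI]])
  then show ?thesis by (simp add: LIM_zero_iff)
qed

lemma L2_tail_tendsto_0:
  assumes f: "f \<in> L2"
  shows "(\<lambda>n::nat. l2norm (\<lambda>t. indicator {t. real n \<le> \<bar>t\<bar>} t * f t)) \<longlonglongrightarrow> 0"
proof -
  note [measurable] = L2_measurable[OF f]
  have "(\<lambda>n::nat. LINT t|lborel. (norm (indicator {t. real n \<le> \<bar>t\<bar>} t * f t))\<^sup>2) \<longlonglongrightarrow> integral\<^sup>L lborel (\<lambda>t::real. 0 :: real)"
  proof (rule integral_dominated_convergence[OF _ _ L2_integrable[OF f]])
    have "(\<lambda>n::nat. (norm (indicator {t. real n \<le> \<bar>t\<bar>} t * f t))\<^sup>2) \<longlonglongrightarrow> 0" for t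
    proof (rule tendsto_eventually)
      obtain N :: nat where "\<bar>t\<bar> < real N" using reals_Archimedean2 by blast
      then show "eventually (\<lambda>n::nat. (norm (indicator {t. real n \<le> \<bar>t\<bar>} t * f t))\<^sup>2 = 0) sequentially"
        unfolding eventually_sequentially by (intro exI[of _ N]) (auto simp: indicator_def)
    qed
    then show "AE t in lborel. (\<lambda>n::nat. (norm (indicator {t. real n \<le> \<bar>t\<bar>} t * f t))\<^sup>2) \<longlonglongrightarrow> 0" by simp
    show "AE t in lborel. norm ((norm (indicator {t. real n \<le> \<bar>t\<bar>} t * f t))\<^sup>2) \<le> (norm (f t))\<^sup>2" for n
      by (rule AE_I2) (simp add: indicator_def)
  qed measurable
  then have "(\<lambda>n::nat. LINT t|lborel. (norm (indicator {t. real n \<le> \<bar>t\<bar>} t * f t))\<^sup>2) \<longlonglongrightarrow> 0" by simp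
  from tendsto_real_sqrt[OF this] show ?thesis unfolding l2norm_def by simp
qed

lemma l2norm_sum_le:
  assumes "\<And>i. i \<in> I \<Longrightarrow> f i \<in> L2"
  shows "l2norm (\<lambda>t. \<Sum>i\<in>I. f i t) \<le> (\<Sum>i\<in>I. l2norm (f i))"
  using assms
proof (induction I rule: infinite_finite_induct)
  case (insert x F)
  then have "l2norm (\<lambda>t. f x t + (\<Sum>i\<in>F. f i t)) \<le> l2norm (f x) + l2norm (\<lambda>t. \<Sum>i\<in>F. f i t)"
    by (intro l2norm_triangle L2_sum) auto
  then show ?case using insert by simp
qed (auto simp: l2norm_def)

lemma L2_norm_of: "f \<in> L2 \<Longrightarrow> (\<lambda>t. complex_of_real (norm (f t))) \<in> L2"
  by (rule L2_dominated(1)[of f _ 1]) (auto dest: L2_measurable)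

lemma l2norm_norm_of: "l2norm (\<lambda>t. complex_of_real (norm (f t))) = l2norm f"
  by (simp add: l2norm_def)

lemma l2norm_mono:
  assumes "f \<in> L2" "g \<in> borel_measurable borel" "\<And>t. norm (g t) \<le> norm (f t)"
  shows "l2norm g \<le> l2norm f"
  using L2_dominated(2)[OF assms(1,2), of 1] assms(3) by simp

lemma continuous_AE_bound:
  fixes h :: "real \<Rightarrow> real"
  assumes c: "continuous_on UNIV h" and ae: "AE t in lborel. \<bar>h t\<bar> \<le> B"
  shows "\<bar>h t\<bar> \<le> B"
proof (rule ccontr)
  assume "\<not> \<bar>h t\<bar> \<le> B"
  then have t: "t \<in> {t. B < \<bar>h t\<bar>}" by simp
  have "open {t. B < \<bar>h t\<bar>}" by (intro open_Collect_less continuous_intros c)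
  then obtain e where e: "e > 0" "ball t e \<subseteq> {t. B < \<bar>h t\<bar>}" using t openE by blast
  have "AE s in lborel. s \<notin> ball t e" using ae by eventually_elim (use e in force)
  moreover have "(AE s in lborel. s \<notin> ball t e) \<longleftrightarrow> emeasure lborel (ball t e) = 0"
    by (rule AE_iff_measurable) auto
  ultimately have "emeasure lborel (ball t e) = 0" by simp
  moreover have "ball t e = {t - e<..<t + e}" by (auto simp: dist_real_def abs_less_iff)
  ultimately show False using e(1) by simp
qed


lemma ennreal_le_suminf: "F k \<le> (\<Sum>k. F k :: ennreal)"
  using sum_le_suminf[of F "{k}"] by (simp add: summableI)

text \<open>Along a subsequence with \<open>\<parallel>u\<^sub>n - u\<^sub>n\<^sub>+\<^sub>1\<parallel>\<^sup>2 \<le> 4\<^sup>-\<^sup>n\<close> the weighted sum of squares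
  \<open>\<Sum> 2\<^sup>n |u\<^sub>n - u\<^sub>n\<^sub>+\<^sub>1|\<^sup>2\<close> is integrable, hence finite almost everywhere; this gives pointwise
  convergence, and Fatou's lemma turns the pointwise limit into a limit in norm.\<close>

lemma L2_complete:
  assumes L: "\<And>n::nat. u n \<in> L2"
    and cauchy: "\<And>e. e > 0 \<Longrightarrow> \<exists>N. \<forall>m\<ge>N. \<forall>n\<ge>N. l2norm (\<lambda>t. u m t - u n t) < e"
  obtains g where "g \<in> L2" "(\<lambda>n. l2norm (\<lambda>t. u n t - g t)) \<longlonglongrightarrow> 0"
proof -
  obtain N where N: "\<And>k m n. m \<ge> N k \<Longrightarrow> n \<ge> N k \<Longrightarrow> l2norm (\<lambda>t. u m t - u n t) < (1/2) ^ k"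
  proof -
    have "\<forall>k. \<exists>N. \<forall>m\<ge>N. \<forall>n\<ge>N. l2norm (\<lambda>t. u m t - u n t) < (1/2) ^ k"
      using cauchy by (simp add: zero_less_power)
    then show ?thesis using that by metis
  qed
  define r where "r k = (\<Sum>j\<le>k. N j) + k" for k
  have rN: "r k \<ge> N k" for k unfolding r_def by (simp add: member_le_sum trans_le_add1)
  have rk: "r k \<ge> k" for k unfolding r_def by simp
  have rS: "r (Suc k) \<ge> r k" for k unfolding r_def by simp
  define d where "d k t = u (r (Suc k)) t - u (r k) t" for k t
  have dL: "d k \<in> L2" for k unfolding d_def using L by (intro L2_diff)
  have dn: "l2norm (d k) < (1/2) ^ k" for k
    unfolding d_def using N[of k "r (Suc k)" "r k"] rN[of k] rS[of k] by simp
  have [measurable]: "d k \<in> borel_measurable borel" "u k \<in> borel_measurable borel" for k using dL L L2_measurable by auto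
  have nn_eq: "(\<integral>\<^sup>+t. ennreal ((norm (f t))\<^sup>2) \<partial>lborel) = ennreal ((l2norm f)\<^sup>2)" if "f \<in> L2" for f
    unfolding l2norm_power2 using L2_integrable[OF that] by (intro nn_integral_eq_integral) auto
  have "(\<integral>\<^sup>+t. (\<Sum>k. ennreal (2 ^ k * (norm (d k t))\<^sup>2)) \<partial>lborel)
      = (\<Sum>k. \<integral>\<^sup>+t. ennreal (2 ^ k * (norm (d k t))\<^sup>2) \<partial>lborel)"
    by (rule nn_integral_suminf) simp
  also have "\<dots> \<le> (\<Sum>k. ennreal ((1/2) ^ k))"
  proof (rule suminf_le)
    fix k
    have "(\<integral>\<^sup>+t. ennreal (2 ^ k * (norm (d k t))\<^sup>2) \<partial>lborel) = ennreal (2 ^ k * (l2norm (d k))\<^sup>2)"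
      by (simp add: ennreal_mult nn_integral_cmult nn_eq[OF dL])
    also have "2 ^ k * (l2norm (d k))\<^sup>2 \<le> 2 ^ k * ((1/2) ^ k)\<^sup>2"
      using dn[of k] by (intro mult_left_mono power_mono) auto
    also have "2 ^ k * ((1/2::real) ^ k)\<^sup>2 = (1/2) ^ k"
      by (simp add: power2_eq_square power_one_over field_simps)
    finally show "(\<integral>\<^sup>+t. ennreal (2 ^ k * (norm (d k t))\<^sup>2) \<partial>lborel) \<le> ennreal ((1/2) ^ k)"
      by (simp add: ennreal_leI)
  qed auto
  also have "\<dots> = ennreal 2"
    by (subst suminf_ennreal2) (auto simp: suminf_geometric)
  finally have "(\<integral>\<^sup>+t. (\<Sum>k. ennreal (2 ^ k * (norm (d k t))\<^sup>2)) \<partial>lborel) \<le> ennreal 2" .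
  from le_less_trans[OF this ennreal_less_top]
  have fin: "(\<integral>\<^sup>+t. (\<Sum>k. ennreal (2 ^ k * (norm (d k t))\<^sup>2)) \<partial>lborel) \<noteq> \<infinity>" by simp
  have "AE t in lborel. (\<Sum>k. ennreal (2 ^ k * (norm (d k t))\<^sup>2)) \<noteq> \<infinity>"
    by (rule nn_integral_noteq_infinite[OF _ fin]) simp
  then have conv: "AE t in lborel. convergent (\<lambda>k. u (r k) t)"
  proof eventually_elim
    case (elim t)
    define c where "c = enn2real (\<Sum>k. ennreal (2 ^ k * (norm (d k t))\<^sup>2))"
    have c: "c \<ge> 0" "(\<Sum>k. ennreal (2 ^ k * (norm (d k t))\<^sup>2)) = ennreal c"
      using elim by (simp_all add: c_def less_top)
    have b: "norm (d k t) \<le> sqrt c * (sqrt (1/2)) ^ k" for k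
    proof -
      have "ennreal (2 ^ k * (norm (d k t))\<^sup>2) \<le> ennreal c"
        using ennreal_le_suminf[of "\<lambda>k. ennreal (2 ^ k * (norm (d k t))\<^sup>2)" k] c(2) by (rule ord_le_eq_trans)
      then have "2 ^ k * (norm (d k t))\<^sup>2 \<le> c" using ennreal_le_iff[OF c(1)] by blast
      then have "(norm (d k t))\<^sup>2 \<le> c / 2 ^ k" by (simp add: pos_le_divide_eq mult.commute)
      then have "(norm (d k t))\<^sup>2 \<le> c * (1/2) ^ k" by (simp add: power_one_over)
      then have "sqrt ((norm (d k t))\<^sup>2) \<le> sqrt (c * (1/2) ^ k)" by (rule real_sqrt_le_mono)
      then show ?thesis by (simp add: real_sqrt_mult real_sqrt_power)
    qed
    have "summable (\<lambda>k. sqrt c * (sqrt (1/2)) ^ k)"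
      by (intro summable_mult summable_geometric) (simp add: real_sqrt_divide)
    then have "summable (\<lambda>k. d k t)" by (rule summable_comparison_test[rotated]) (use b in auto)
    then have "convergent (\<lambda>n. (\<Sum>k<n. d k t) + u (r 0) t)"
      by (intro convergent_add convergent_const) (simp add: summable_iff_convergent)
    moreover have "(\<Sum>k<n. d k t) + u (r 0) t = u (r n) t" for n
      unfolding d_def by (subst sum_lessThan_telescope[of "\<lambda>k. u (r k) t"]) simp
    ultimately show ?case by simp
  qed
  define g where "g t = lim (\<lambda>k. u (r k) t)" for t
  have gm [measurable]: "g \<in> borel_measurable borel" unfolding g_def by (rule borel_measurable_lim_metric) measurable
  have lim: "AE t in lborel. (\<lambda>k. u (r k) t) \<longlonglongrightarrow> g t"
    using conv by eventually_elim (simp add: g_def convergent_LIMSEQ_iff)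
  have fatou: "(\<integral>\<^sup>+t. ennreal ((norm (u n t - g t))\<^sup>2) \<partial>lborel) \<le> ennreal (((1/2) ^ k)\<^sup>2)" if "n \<ge> N k" for n k
  proof -
    have "(\<integral>\<^sup>+t. ennreal ((norm (u n t - g t))\<^sup>2) \<partial>lborel)
        = (\<integral>\<^sup>+t. liminf (\<lambda>j. ennreal ((norm (u n t - u (r j) t))\<^sup>2)) \<partial>lborel)"
    proof (rule nn_integral_cong_AE)
      show "AE t in lborel. ennreal ((norm (u n t - g t))\<^sup>2) = liminf (\<lambda>j. ennreal ((norm (u n t - u (r j) t))\<^sup>2))"
        using lim
      proof eventually_elim
        case (elim t)
        then have "(\<lambda>j. ennreal ((norm (u n t - u (r j) t))\<^sup>2)) \<longlonglongrightarrow> ennreal ((norm (u n t - g t))\<^sup>2)"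
          by (intro tendsto_intros)
        then show ?case by (rule lim_imp_Liminf[OF trivial_limit_sequentially, symmetric])
      qed
    qed
    also have "\<dots> \<le> liminf (\<lambda>j. \<integral>\<^sup>+t. ennreal ((norm (u n t - u (r j) t))\<^sup>2) \<partial>lborel)"
      by (rule nn_integral_liminf) simp
    also have "\<dots> \<le> ennreal (((1/2) ^ k)\<^sup>2)"
    proof (rule Liminf_le)
      have "eventually (\<lambda>j. j \<ge> N k) sequentially" by simp
      then show "eventually (\<lambda>j. (\<integral>\<^sup>+t. ennreal ((norm (u n t - u (r j) t))\<^sup>2) \<partial>lborel) \<le> ennreal (((1/2) ^ k)\<^sup>2)) sequentially"
      proof eventually_elim
        case (elim j)
        then have "r j \<ge> N k" using rk[of j] by linarith
        then have "l2norm (\<lambda>t. u n t - u (r j) t) \<le> (1/2) ^ k"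
          using N[OF that] by (simp add: less_imp_le)
        then show ?case unfolding nn_eq[OF L2_diff[OF L L]]
          by (intro ennreal_leI power_mono) auto
      qed
    qed simp
    finally show ?thesis .
  qed
  have diffL: "(\<lambda>t. u (N 0) t - g t) \<in> L2"
  proof (rule L2I)
    show "integrable lborel (\<lambda>t. (norm (u (N 0) t - g t))\<^sup>2)"
      by (rule integrableI_nonneg) (use le_less_trans[OF fatou[of 0 "N 0", OF order_refl] ennreal_less_top] in auto)
  qed simp
  have gL: "g \<in> L2" using L2_diff[OF L[of "N 0"] diffL] by simp
  have "(\<lambda>n. l2norm (\<lambda>t. u n t - g t)) \<longlonglongrightarrow> 0"
  proof (rule LIMSEQ_I)
    fix e :: real assume "e > 0"
    then obtain k where k: "(1/2) ^ k < e" using real_arch_pow_inv[of e "1/2"] by auto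
    have "norm (l2norm (\<lambda>t. u n t - g t) - 0) < e" if "n \<ge> N k" for n
    proof -
      have "ennreal ((l2norm (\<lambda>t. u n t - g t))\<^sup>2) \<le> ennreal (((1/2) ^ k)\<^sup>2)"
        using fatou[OF that] unfolding nn_eq[OF L2_diff[OF L gL]] .
      then have "(l2norm (\<lambda>t. u n t - g t))\<^sup>2 \<le> ((1/2) ^ k)\<^sup>2" by simp
      then have "l2norm (\<lambda>t. u n t - g t) \<le> (1/2) ^ k" by (rule power2_le_imp_le) simp
      then show ?thesis using k by simp
    qed
    then show "\<exists>no. \<forall>n\<ge>no. norm (l2norm (\<lambda>t. u n t - g t) - 0) < e" by blast
  qed
  then show ?thesis using that gL by blast
qed

section \<open>Integration of functions with compact support\<close>

lemma Ck0_bounded: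
  fixes f :: "real \<Rightarrow> 'a::{real_normed_algebra_1}"
  assumes "f \<in> Ck0 K" obtains B where "B > 0" "\<And>t. norm (f t) \<le> B"
proof -
  obtain R where R: "\<And>t. \<bar>t\<bar> > R \<Longrightarrow> f t = 0" using assms unfolding Ck0_iff by blast
  have "bounded (f ` {-R..R})"
    by (intro compact_imp_bounded compact_continuous_image Ck_continuous[OF Ck0_Ck[OF assms]]) auto
  then obtain B where B: "\<And>t. t \<in> {-R..R} \<Longrightarrow> norm (f t) \<le> B" unfolding bounded_iff by blast
  have "norm (f t) \<le> \<bar>B\<bar> + 1" for t
  proof (cases "\<bar>t\<bar> > R")
    case False
    then have "t \<in> {-R..R}" by auto
    then show ?thesis using B[of t] by linarith
  qed (simp add: R)
  then show ?thesis using that[of "\<bar>B\<bar> + 1"] by simp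
qed

lemma integrable_compact_support:
  fixes f :: "real \<Rightarrow> 'a::euclidean_space"
  assumes "continuous_on UNIV f" "\<And>t. \<bar>t\<bar> > R \<Longrightarrow> f t = 0"
  shows "integrable lborel f" "integral\<^sup>L lborel f = (LINT t:{-R..R}|lborel. f t)"
proof -
  have eq: "(\<lambda>t. indicator {-R..R} t *\<^sub>R f t) = f"
    using assms(2) by (auto simp: indicator_def fun_eq_iff abs_if split: if_splits)
  have "set_integrable lborel {-R..R} f"
    by (rule borel_integrable_atLeastAtMost') (use assms(1) continuous_on_subset in blast)
  then show "integrable lborel f" unfolding set_integrable_def eq .
  show "integral\<^sup>L lborel f = (LINT t:{-R..R}|lborel. f t)" unfolding set_lebesgue_integral_def eq ..
qed

lemma Ck0_integrable:
  fixes f :: "real \<Rightarrow> 'a::euclidean_space"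
  assumes "f \<in> Ck0 K" shows "integrable lborel f"
  using assms integrable_compact_support(1)[of f] Ck_continuous[of f K UNIV] unfolding Ck0_iff by blast

lemma Ck0_L2: "f \<in> Ck0 K \<Longrightarrow> f \<in> L2"
proof (rule L2I)
  assume f: "f \<in> Ck0 K"
  then show "f \<in> borel_measurable borel"
    using Ck_continuous[OF Ck0_Ck[OF f], of UNIV] by (simp add: borel_measurable_continuous_onI)
  obtain R where R: "\<And>t. \<bar>t\<bar> > R \<Longrightarrow> f t = 0" using f unfolding Ck0_iff by blast
  show "integrable lborel (\<lambda>t. (norm (f t))\<^sup>2)"
    by (rule integrable_compact_support(1)[of _ R])
       (use R Ck_continuous[OF Ck0_Ck[OF f], of UNIV] in \<open>auto intro!: continuous_intros\<close>)
qed

lemma integral_deriv_compact_support: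
  fixes F :: "real \<Rightarrow> 'a::euclidean_space"
  assumes "F \<in> Ck 1" "\<And>t. \<bar>t\<bar> > R \<Longrightarrow> F t = 0"
  shows "(LINT t|lborel. nderiv 1 F t) = 0"
proof -
  define S where "S = \<bar>R\<bar> + 1"
  have S: "S > 0" "S > R" by (auto simp: S_def)
  have "(LINT t|lborel. nderiv 1 F t) = (LINT t:{-S..S}|lborel. nderiv 1 F t)"
    by (rule integrable_compact_support(2))
       (use nderiv_zero_outside[of R F] assms S Ck_continuous_nderiv[OF assms(1)] in auto)
  also have "\<dots> = F S - F (-S)"
    unfolding set_lebesgue_integral_def
    by (rule integral_FTC_atLeastAtMost)
       (use S assms(1) Ck_has_derivative_Suc[of F 0, THEN has_vector_derivative_at_within]
         Ck_continuous_nderiv[OF assms(1)] in auto)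
  also have "\<dots> = 0" using assms(2)[of S] assms(2)[of "-S"] S by simp
  finally show ?thesis .
qed

lemma integration_by_parts_compact:
  fixes f g :: "real \<Rightarrow> 'a::{euclidean_space,real_normed_algebra_1}"
  assumes "f \<in> Ck 1" "g \<in> Ck 1" "\<And>t. \<bar>t\<bar> > R \<Longrightarrow> f t = 0 \<or> g t = 0"
  shows "(LINT t|lborel. nderiv 1 f t * g t) = - (LINT t|lborel. f t * nderiv 1 g t)"
proof -
  let ?U = "{t. \<bar>t\<bar> > R}"
  have U: "open ?U" by (intro open_Collect_less continuous_intros)
  have fg: "(\<lambda>t. f t * g t) \<in> Ck 1" by (rule Ck_mult[OF assms(1,2)])
  have D: "nderiv 1 (\<lambda>t. f t * g t) = (\<lambda>t. f t * nderiv 1 g t + nderiv 1 f t * g t)"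
    using nderiv_1_mult[of f 0 g 0] assms by simp
  have z1: "f t * g t = 0" if "\<bar>t\<bar> > R" for t using assms(3)[OF that] by auto
  have z: "f t * nderiv 1 g t = 0" "nderiv 1 f t * g t = 0" if t: "\<bar>t\<bar> > R" for t
  proof -
    have "f t * nderiv 1 g t = 0 \<and> nderiv 1 f t * g t = 0"
    proof (cases "f t = 0 \<and> g t = 0")
      case False
      then consider "f t \<noteq> 0" | "g t \<noteq> 0" by blast
      then show ?thesis
      proof cases
        case 1
        let ?V = "?U \<inter> {s. f s \<noteq> 0}"
        have V: "open ?V" using U Ck_continuous[OF assms(1), of UNIV] open_Collect_neq[of f "\<lambda>s. 0"] by auto
        have "nderiv 1 g t = nderiv 1 (\<lambda>s. 0) t"
          by (rule nderiv_cong_open[OF V]) (use assms(3) 1 t in auto)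
        then show ?thesis using assms(3)[OF t] 1 by (simp add: nderiv_const)
      next
        case 2
        let ?V = "?U \<inter> {s. g s \<noteq> 0}"
        have V: "open ?V" using U Ck_continuous[OF assms(2), of UNIV] open_Collect_neq[of g "\<lambda>s. 0"] by auto
        have "nderiv 1 f t = nderiv 1 (\<lambda>s. 0) t"
          by (rule nderiv_cong_open[OF V]) (use assms(3) 2 t in auto)
        then show ?thesis using assms(3)[OF t] 2 by (simp add: nderiv_const)
      qed
    qed auto
    then show "f t * nderiv 1 g t = 0" "nderiv 1 f t * g t = 0" by auto
  qed
  have c: "continuous_on UNIV f" "continuous_on UNIV g" "continuous_on UNIV (nderiv 1 f)" "continuous_on UNIV (nderiv 1 g)"
    using assms(1,2) Ck_continuous_nderiv[of f 1 1] Ck_continuous_nderiv[of g 1 1] by (simp_all add: Ck_continuous)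
  have i1: "integrable lborel (\<lambda>t. f t * nderiv 1 g t)"
    by (rule integrable_compact_support(1)[of _ R]) (use c z(1) in \<open>auto intro!: continuous_on_mult\<close>)
  have i2: "integrable lborel (\<lambda>t. nderiv 1 f t * g t)"
    by (rule integrable_compact_support(1)[of _ R]) (use c z(2) in \<open>auto intro!: continuous_on_mult\<close>)
  have "0 = (LINT t|lborel. nderiv 1 (\<lambda>t. f t * g t) t)"
    using integral_deriv_compact_support[OF fg z1] by simp
  also have "\<dots> = (LINT t|lborel. f t * nderiv 1 g t) + (LINT t|lborel. nderiv 1 f t * g t)"
    unfolding D by (rule Bochner_Integration.integral_add[OF i1 i2])
  finally show ?thesis by (simp add: eq_neg_iff_add_eq_0 add.commute)
qed

lemma integration_by_parts_compact_power:
  fixes f g :: "real \<Rightarrow> 'a::{euclidean_space,real_normed_algebra_1}"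
  assumes "f \<in> Ck0 k" "g \<in> Ck k"
  shows "(LINT t|lborel. nderiv k f t * g t) = (-1) ^ k * (LINT t|lborel. f t * nderiv k g t)"
  using assms
proof (induction k arbitrary: g)
  case (Suc k)
  obtain R where R: "\<And>t. \<bar>t\<bar> > R \<Longrightarrow> f t = 0" using Suc.prems unfolding Ck0_iff by blast
  have f: "nderiv k f \<in> Ck 1" using Suc.prems(1) by (intro nderiv_in_Ck'[OF Ck0_Ck]) auto
  have g: "nderiv 1 g \<in> Ck k" "g \<in> Ck 1" using Suc.prems(2) Ck_mono[of g "Suc k" 1] by (simp_all add: Ck_Suc)
  have f0: "f \<in> Ck0 k" using Suc.prems(1) nderiv_in_Ck0[of f "Suc k" 0 k] by simp
  have "(LINT t|lborel. nderiv (Suc k) f t * g t) = (LINT t|lborel. nderiv 1 (nderiv k f) t * g t)"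
    by (simp add: nderiv_add_index)
  also have "\<dots> = - (LINT t|lborel. nderiv k f t * nderiv 1 g t)"
    by (rule integration_by_parts_compact[OF f g(2), of R]) (simp add: nderiv_zero_outside[OF R])
  also have "\<dots> = (-1) ^ Suc k * (LINT t|lborel. f t * nderiv (Suc k) g t)"
    unfolding Suc.IH[OF f0 g(1)] nderiv_Suc_shift[of k g] by simp
  finally show ?case .
qed simp


section \<open>Cutoff functions\<close>

lemma has_real_derivative_pos_part_power:
  "((\<lambda>y::real. max 0 y ^ Suc (Suc n)) has_real_derivative real (Suc (Suc n)) * max 0 y ^ Suc n) (at y)"
proof -
  consider "y < 0" | "y > 0" | "y = 0" by linarith
  then show ?thesis
  proof cases
    case 1
    have "((\<lambda>y::real. 0) has_real_derivative 0) (at y)" by simp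
    then have "((\<lambda>y::real. max 0 y ^ Suc (Suc n)) has_real_derivative 0) (at y)"
      by (rule has_field_derivative_transform_within_open[where S = "{..<0}"]) (use 1 in \<open>auto simp: max_def\<close>)
    then show ?thesis using 1 by (simp add: max_def)
  next
    case 2
    have "((\<lambda>y::real. y ^ Suc (Suc n)) has_real_derivative real (Suc (Suc n)) * y ^ Suc n) (at y)"
      using DERIV_pow[of "Suc (Suc n)" y UNIV] by simp
    then have "((\<lambda>y::real. max 0 y ^ Suc (Suc n)) has_real_derivative real (Suc (Suc n)) * y ^ Suc n) (at y)"
      by (rule has_field_derivative_transform_within_open[where S = "{0<..}"]) (use 2 in \<open>auto simp: max_def\<close>)
    then show ?thesis using 2 by (simp add: max_def)
  next
    case 3
    have "((\<lambda>h::real. \<bar>h\<bar> ^ Suc n) \<longlongrightarrow> \<bar>0\<bar> ^ Suc n) (at 0)" by (intro tendsto_intros)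
    then have z: "((\<lambda>h::real. \<bar>h\<bar> ^ Suc n) \<longlongrightarrow> 0) (at 0)" by simp
    have "norm (max 0 h ^ Suc (Suc n) / h) \<le> \<bar>h\<bar> ^ Suc n" for h :: real
    proof (cases "h \<le> 0")
      case True
      then have z: "max 0 h ^ Suc (Suc n) / h = 0" by (simp add: max_def)
      show ?thesis unfolding z norm_zero by (rule zero_le_power) simp
    qed (auto simp: max_def)
    then have "((\<lambda>h::real. max 0 h ^ Suc (Suc n) / h) \<longlongrightarrow> 0) (at 0)"
      by (intro Lim_null_comparison[OF always_eventually z]) auto
    then show ?thesis unfolding 3 DERIV_def by simp
  qed
qed

lemma Ck_pos_part_power:
  fixes p :: "real \<Rightarrow> real"
  shows "p \<in> Ck m \<Longrightarrow> (\<lambda>x. max 0 (p x) ^ Suc m) \<in> Ck m"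
proof (induction m)
  case (Suc m)
  have d: "((\<lambda>x. max 0 (p x) ^ Suc (Suc m)) has_vector_derivative
     (real (Suc (Suc m)) * max 0 (p t) ^ Suc m) * nderiv 1 p t) (at t)" for t
    unfolding has_real_derivative_iff_has_vector_derivative[symmetric]
    by (rule DERIV_chain2[OF has_real_derivative_pos_part_power])
       (use Ck_has_derivative_Suc[OF Suc.prems] in \<open>simp add: has_real_derivative_iff_has_vector_derivative\<close>)
  show ?case
    by (rule Ck_SucI[OF d], intro Ck_mult Ck_const Suc.IH Ck_SucD[OF Suc.prems])
       (use Suc.prems in \<open>simp add: Ck_Suc\<close>)
qed (auto simp: Ck_0 intro!: continuous_intros)

lemma has_vector_derivative_scale_arg:
  assumes "(f has_vector_derivative d) (at (c * t))"
  shows "((\<lambda>x. f (c * x)) has_vector_derivative c *\<^sub>R d) (at t)"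
proof -
  have "((\<lambda>x. c * x) has_vector_derivative c) (at t)"
    by (auto simp: has_real_derivative_iff_has_vector_derivative[symmetric] intro!: derivative_eq_intros)
  from vector_diff_chain_at[OF this assms] show ?thesis by (simp add: o_def)
qed

lemma Ck_scale:
  fixes f :: "real \<Rightarrow> 'a::real_normed_vector"
  shows "f \<in> Ck K \<Longrightarrow> (\<lambda>x. f (c * x)) \<in> Ck K"
proof (induction K arbitrary: f)
  case 0
  then show ?case unfolding Ck_0 by (auto intro!: continuous_on_compose2[of UNIV f] continuous_intros)
next
  case (Suc K)
  have d: "((\<lambda>x. f (c * x)) has_vector_derivative c *\<^sub>R nderiv 1 f (c * t)) (at t)" for t
    by (rule has_vector_derivative_scale_arg[OF Ck_has_derivative_Suc[OF Suc.prems]])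
  have "nderiv 1 f \<in> Ck K" using Suc.prems by (simp add: Ck_Suc)
  from Suc.IH[OF this] show ?case
    by (intro Ck_SucI[OF d] Ck_bounded_linear[OF bounded_linear_scaleR_right])
qed

lemma nderiv_scale:
  fixes f :: "real \<Rightarrow> 'a::real_normed_vector"
  assumes "f \<in> Ck K" "k \<le> K"
  shows "nderiv k (\<lambda>x. f (c * x)) = (\<lambda>x. c ^ k *\<^sub>R nderiv k f (c * x))"
  using assms(2)
proof (induction k)
  case (Suc k)
  have "((\<lambda>x. nderiv k f (c * x)) has_vector_derivative c *\<^sub>R nderiv (Suc k) f (c * t)) (at t)" for t
    using Suc.prems by (intro has_vector_derivative_scale_arg Ck_has_vector_derivative[OF assms(1)]) simp
  then have d: "((\<lambda>x. c ^ k *\<^sub>R nderiv k f (c * x)) has_vector_derivative c ^ k *\<^sub>R (c *\<^sub>R nderiv (Suc k) f (c * t))) (at t)" for t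
    by (rule bounded_linear.has_vector_derivative[OF bounded_linear_scaleR_right])
  have IH: "nderiv k (\<lambda>x. f (c * x)) = (\<lambda>x. c ^ k *\<^sub>R nderiv k f (c * x))" using Suc by simp
  show ?case unfolding nderiv_Suc[of k "\<lambda>x. f (c * x)"] IH
    by (simp add: vector_derivative_at[OF d] mult.commute[of "c ^ k" c])
qed simp

text \<open>With \<open>p = (1 + \<delta>)\<^sup>2 - x\<^sup>2\<close>, \<open>q = x\<^sup>2 - 1\<close> and \<open>h(y) = max 0 y ^ (K + 1)\<close>, of class \<open>C\<^sup>K\<close>,
  the quotient \<open>h(p) / (h(p) + h(q))\<close> is a cutoff; its denominator vanishes nowhere because
  \<open>p\<close> and \<open>q\<close> are never both nonpositive.\<close>

lemma cutoff_exists: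
  fixes \<delta> :: real
  assumes "\<delta> > 0"
  obtains \<phi> :: "real \<Rightarrow> real" where "\<phi> \<in> Ck K" "\<And>x. 0 \<le> \<phi> x" "\<And>x. \<phi> x \<le> 1"
    "\<And>x. \<bar>x\<bar> \<le> 1 \<Longrightarrow> \<phi> x = 1" "\<And>x. \<bar>x\<bar> \<ge> 1 + \<delta> \<Longrightarrow> \<phi> x = 0"
proof -
  define P where "P x = max 0 ((1 + \<delta>)\<^sup>2 - x * x) ^ Suc K" for x :: real
  define R where "R x = max 0 (x * x - 1) ^ Suc K" for x :: real
  have C: "P \<in> Ck K" "R \<in> Ck K"
    unfolding P_def[abs_def] R_def[abs_def] by (intro Ck_pos_part_power Ck_diff Ck_mult Ck_const Ck_ident)+
  have nn: "P x \<ge> 0" "R x \<ge> 0" for x unfolding P_def R_def by simp_all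
  have pos: "P x + R x > 0" for x
  proof (cases "x * x > 1")
    case True
    then have "R x > 0" unfolding R_def by (simp add: max_def)
    then show ?thesis using nn[of x] by simp
  next
    case False
    have "(1 + \<delta>)\<^sup>2 > 1" using assms by (simp add: power2_eq_square algebra_simps add_pos_pos)
    then have "P x > 0" unfolding P_def using False by (simp add: max_def)
    then show ?thesis using nn[of x] by simp
  qed
  define \<phi> where "\<phi> x = P x * inverse (P x + R x)" for x
  show ?thesis
  proof (rule that[of \<phi>])
    show "\<phi> \<in> Ck K" unfolding \<phi>_def[abs_def]
      using pos by (intro Ck_mult Ck_inverse Ck_add C) (metis less_irrefl)
    show "0 \<le> \<phi> x" "\<phi> x \<le> 1" for x
      unfolding \<phi>_def using nn[of x] pos[of x] by (auto simp: field_simps)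
    show "\<phi> x = 1" if "\<bar>x\<bar> \<le> 1" for x
    proof -
      have "x * x \<le> 1" using that by (metis abs_le_square_iff abs_one power2_eq_square power_one)
      then have "R x = 0" by (simp add: R_def)
      then show ?thesis unfolding \<phi>_def using pos[of x] by (auto simp: field_simps)
    qed
    show "\<phi> x = 0" if "\<bar>x\<bar> \<ge> 1 + \<delta>" for x
    proof -
      have "(1 + \<delta>)\<^sup>2 \<le> x * x" using that assms
        by (metis abs_le_square_iff abs_of_pos add_pos_pos power2_eq_square zero_less_one)
      then have "P x = 0" by (simp add: P_def)
      then show ?thesis unfolding \<phi>_def by simp
    qed
  qed
qed

lemma cutoff_family:
  fixes \<delta> :: real
  assumes "\<delta> > 0"
  obtains M and \<eta> :: "nat \<Rightarrow> real \<Rightarrow> real" where "M > 0"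
    "\<And>n. n \<ge> 1 \<Longrightarrow> \<eta> n \<in> Ck K" "\<And>n x. 0 \<le> \<eta> n x" "\<And>n x. \<eta> n x \<le> 1"
    "\<And>n x. n \<ge> 1 \<Longrightarrow> \<bar>x\<bar> \<le> real n \<Longrightarrow> \<eta> n x = 1"
    "\<And>n x. n \<ge> 1 \<Longrightarrow> \<bar>x\<bar> \<ge> real n * (1 + \<delta>) \<Longrightarrow> \<eta> n x = 0"
    "\<And>n j x. n \<ge> 1 \<Longrightarrow> j \<le> K \<Longrightarrow> \<bar>nderiv j (\<eta> n) x\<bar> \<le> M"
    "\<And>n j x. n \<ge> 1 \<Longrightarrow> j \<ge> 1 \<Longrightarrow> \<bar>x\<bar> < real n \<Longrightarrow> nderiv j (\<eta> n) x = 0"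
proof -
  obtain \<phi> :: "real \<Rightarrow> real" where \<phi>: "\<phi> \<in> Ck K" "\<And>x. 0 \<le> \<phi> x" "\<And>x. \<phi> x \<le> 1"
    "\<And>x. \<bar>x\<bar> \<le> 1 \<Longrightarrow> \<phi> x = 1" "\<And>x. \<bar>x\<bar> \<ge> 1 + \<delta> \<Longrightarrow> \<phi> x = 0"
    using cutoff_exists[OF assms] by blast
  have \<phi>0: "\<phi> \<in> Ck0 K" unfolding Ck0_iff using \<phi> less_imp_le by blast
  have "\<forall>j. \<exists>B>0. j \<le> K \<longrightarrow> (\<forall>x. \<bar>nderiv j \<phi> x\<bar> \<le> B)"
  proof
    fix j show "\<exists>B>0. j \<le> K \<longrightarrow> (\<forall>x. \<bar>nderiv j \<phi> x\<bar> \<le> B)"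
    proof (cases "j \<le> K")
      case True
      then have "nderiv j \<phi> \<in> Ck0 0" using nderiv_in_Ck0[OF \<phi>0, of j 0] by simp
      then obtain B where "B > 0" "\<And>t. norm (nderiv j \<phi> t) \<le> B" by (rule Ck0_bounded) blast
      then show ?thesis by auto
    qed (auto intro: exI[of _ 1])
  qed
  then obtain B where B: "\<And>j. B j > 0" "\<And>j x. j \<le> K \<Longrightarrow> \<bar>nderiv j \<phi> x\<bar> \<le> B j" by metis
  define M where "M = (\<Sum>j\<le>K. B j)"
  have BM: "B j \<le> M" if "j \<le> K" for j
    unfolding M_def using that B(1) by (intro member_le_sum) (auto intro: less_imp_le)
  define \<eta> where "\<eta> n x = \<phi> (inverse (real n) * x)" for n :: nat and x :: real
  show ?thesis
  proof (rule that[of M \<eta>])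
    show "M > 0" using BM[of 0] B(1)[of 0] by simp
    show "\<eta> n \<in> Ck K" for n unfolding \<eta>_def[abs_def] by (rule Ck_scale[OF \<phi>(1)])
    show "0 \<le> \<eta> n x" "\<eta> n x \<le> 1" for n x unfolding \<eta>_def using \<phi>(2,3) by auto
    show one: "\<eta> n x = 1" if "n \<ge> 1" "\<bar>x\<bar> \<le> real n" for n x
      unfolding \<eta>_def using that by (intro \<phi>(4)) (auto simp: abs_mult field_simps)
    show "\<eta> n x = 0" if "n \<ge> 1" "\<bar>x\<bar> \<ge> real n * (1 + \<delta>)" for n x
      unfolding \<eta>_def using that by (intro \<phi>(5)) (auto simp: abs_mult field_simps)
    show "\<bar>nderiv j (\<eta> n) x\<bar> \<le> M" if "n \<ge> 1" "j \<le> K" for n j x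
    proof -
      have le: "inverse (real n) ^ j \<le> 1" using that(1) by (intro power_le_one) (auto simp: field_simps)
      have "\<bar>nderiv j (\<eta> n) x\<bar> = inverse (real n) ^ j * \<bar>nderiv j \<phi> (inverse (real n) * x)\<bar>"
        unfolding \<eta>_def[abs_def] nderiv_scale[OF \<phi>(1) that(2)] by (simp add: abs_mult)
      also have "\<dots> \<le> 1 * M"
        using le B(2)[OF that(2)] BM[OF that(2)] by (intro mult_mono) (auto intro: order_trans)
      finally show ?thesis by simp
    qed
    show "nderiv j (\<eta> n) x = 0" if "n \<ge> 1" "j \<ge> 1" "\<bar>x\<bar> < real n" for n j x
    proof -
      have "nderiv j (\<eta> n) x = nderiv j (\<lambda>x. 1) x"
      proof (rule nderiv_cong_open)
        show "open {x. \<bar>x\<bar> < real n}" by (intro open_Collect_less continuous_intros)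
      qed (use that one in auto)
      then show ?thesis using that(2) nderiv_const[of "j - 1" "1::real"] by simp
    qed
  qed
qed

section \<open>Interpolation and the quadratic form of \<open>Q(D)\<close>\<close>

text \<open>A sequence of squared (weighted) derivative norms which is convex in the sense that each
  entry is an arbitrarily small multiple of its successor plus a multiple of its predecessor:
  the intermediate entries can be absorbed, with constants that depend on the
  convexity inequality only.\<close>

definition convex_chain :: "nat \<Rightarrow> (real \<Rightarrow> real) \<Rightarrow> (nat \<Rightarrow> real) \<Rightarrow> bool" where
  "convex_chain m D b \<longleftrightarrow> (\<forall>k. 0 \<le> b k) \<and>
     (\<forall>k \<eta>. Suc k < m \<longrightarrow> 0 < \<eta> \<longrightarrow> b (Suc k) \<le> \<eta> * b (Suc (Suc k)) + D \<eta> * b k)"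

text \<open>The predecessor is estimated by induction through the entry itself, with a factor
  so small that the resulting multiple of the entry can be absorbed on the left.\<close>

lemma convex_chain_step:
  assumes D: "\<And>\<eta>. \<eta> > 0 \<Longrightarrow> D \<eta> \<ge> 0" and "\<epsilon> > 0" "k < m"
  shows "\<exists>C\<ge>0. \<forall>b. convex_chain m D b \<longrightarrow> b k \<le> \<epsilon> * b (Suc k) + C * b 0"
  using assms(2,3)
proof (induction k arbitrary: \<epsilon>)
  case 0
  show ?case
    by (rule exI[of _ 1]) (use 0 in \<open>auto simp: convex_chain_def\<close>)
next
  case (Suc k)
  \<comment> \<open>The factor \<open>1 / (2 (d + 1))\<close> turns \<open>d * b k\<close> into at most half of \<open>b (Suc k)\<close>.\<close>
  define d where "d = D (\<epsilon> / 2)"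
  have d: "d \<ge> 0" unfolding d_def using D Suc.prems by simp
  have "1 / (2 * (d + 1)) > 0" using d by simp
  then obtain C where C: "C \<ge> 0" "\<And>b. convex_chain m D b \<Longrightarrow> b k \<le> 1 / (2 * (d + 1)) * b (Suc k) + C * b 0"
    using Suc.IH[of "1 / (2 * (d + 1))"] Suc.prems by auto
  show ?case
  proof (intro exI[of _ "2 * (d * C)"] conjI allI impI)
    fix b assume b: "convex_chain m D b"
    then have nn: "b (Suc k) \<ge> 0" unfolding convex_chain_def by blast
    have "b (Suc k) \<le> \<epsilon> / 2 * b (Suc (Suc k)) + d * b k"
      using b Suc.prems unfolding convex_chain_def d_def by (meson half_gt_zero)
    also have "d * b k \<le> d * (1 / (2 * (d + 1)) * b (Suc k) + C * b 0)"
      using C(2)[OF b] d by (rule mult_left_mono)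
    also have "d * (1 / (2 * (d + 1)) * b (Suc k) + C * b 0) = d / (2 * (d + 1)) * b (Suc k) + d * C * b 0"
      by (simp add: algebra_simps)
    also have "d / (2 * (d + 1)) * b (Suc k) \<le> 1 / 2 * b (Suc k)"
      using d nn by (intro mult_right_mono) (auto simp: field_simps)
    finally show "b (Suc k) \<le> \<epsilon> * b (Suc (Suc k)) + 2 * (d * C) * b 0" by simp
  qed (use d C in auto)
qed

lemma convex_chain_interpolation1:
  assumes D: "\<And>\<eta>. \<eta> > 0 \<Longrightarrow> D \<eta> \<ge> 0"
  shows "\<epsilon> > 0 \<Longrightarrow> k + Suc d = m \<Longrightarrow> \<exists>C\<ge>0. \<forall>b. convex_chain m D b \<longrightarrow> b k \<le> \<epsilon> * b m + C * b 0"
proof (induction d arbitrary: k)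
  case 0
  then show ?case using convex_chain_step[where D = D and \<epsilon> = \<epsilon> and k = k and m = m, OF D] by auto
next
  case (Suc d)
  obtain C where C: "C \<ge> 0" "\<And>b. convex_chain m D b \<Longrightarrow> b k \<le> 1 * b (Suc k) + C * b 0"
    using convex_chain_step[where D = D and \<epsilon> = 1 and k = k and m = m, OF D] Suc.prems by auto
  obtain C' where C': "C' \<ge> 0" "\<And>b. convex_chain m D b \<Longrightarrow> b (Suc k) \<le> \<epsilon> * b m + C' * b 0"
    using Suc.IH[of "Suc k"] Suc.prems by auto
  show ?case
    by (intro exI[of _ "C + C'"]) (use C C' in \<open>fastforce simp: algebra_simps\<close>)
qed

lemma convex_chain_interpolation:
  assumes D: "\<And>\<eta>. \<eta> > 0 \<Longrightarrow> D \<eta> \<ge> 0" and "\<epsilon> > 0"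
  obtains C where "C \<ge> 0" "\<And>b k. convex_chain m D b \<Longrightarrow> k < m \<Longrightarrow> b k \<le> \<epsilon> * b m + C * b 0"
proof -
  have "\<exists>C\<ge>0. \<forall>b. convex_chain m D b \<longrightarrow> k < m \<longrightarrow> b k \<le> \<epsilon> * b m + C * b 0" for k
  proof (cases "k < m")
    case True
    then have "k + Suc (m - k - 1) = m" by simp
    then show ?thesis using convex_chain_interpolation1[where D = D, OF D assms(2)] by blast
  qed auto
  then obtain C where C: "\<And>k. C k \<ge> 0" "\<And>k b. convex_chain m D b \<Longrightarrow> k < m \<Longrightarrow> b k \<le> \<epsilon> * b m + C k * b 0"
    by metis
  show ?thesis
  proof (rule that[of "\<Sum>k<m. C k"])
    show "0 \<le> (\<Sum>k<m. C k)" using C(1) by (simp add: sum_nonneg)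
    fix b k assume b: "convex_chain m D b" "k < m"
    have "C k \<le> (\<Sum>k<m. C k)" using b C(1) by (intro member_le_sum) auto
    then have "C k * b 0 \<le> (\<Sum>k<m. C k) * b 0"
      using b by (intro mult_right_mono) (auto simp: convex_chain_def)
    then show "b k \<le> \<epsilon> * b m + (\<Sum>k<m. C k) * b 0" using C(2)[OF b] by linarith
  qed
qed

lemma mult_le_weighted_squares:
  fixes x y \<eta> :: real
  assumes "\<eta> > 0" shows "x * y \<le> \<eta> * x\<^sup>2 + 1 / (4 * \<eta>) * y\<^sup>2"
proof -
  have "0 \<le> (2 * \<eta> * x - y)\<^sup>2 / (4 * \<eta>)" using assms by simp
  also have "\<dots> = \<eta> * x\<^sup>2 + 1 / (4 * \<eta>) * y\<^sup>2 - x * y"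
    using assms by (simp add: power2_eq_square field_simps)
  finally show ?thesis by simp
qed

lemma nderiv_Ck0_L2: "\<phi> \<in> Ck0 K \<Longrightarrow> k \<le> K \<Longrightarrow> nderiv k \<phi> \<in> L2"
  using Ck0_L2 nderiv_in_Ck0[of \<phi> K k 0] by simp

lemma ip_nderiv_shift:
  assumes "\<phi> \<in> Ck0 (j + k)" "\<psi> \<in> Ck0 j"
  shows "ip (nderiv (j + k) \<phi>) \<psi> = (-1) ^ j * ip (nderiv k \<phi>) (nderiv j \<psi>)"
proof -
  have "ip (nderiv (j + k) \<phi>) \<psi> = (LINT t|lborel. nderiv j (nderiv k \<phi>) t * cnj (\<psi> t))"
    unfolding ip_def nderiv_add_index ..
  also have "\<dots> = (-1) ^ j * (LINT t|lborel. nderiv k \<phi> t * nderiv j (\<lambda>t. cnj (\<psi> t)) t)"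
    by (rule integration_by_parts_compact_power[OF nderiv_in_Ck0[OF assms(1)] Ck_cnj[OF Ck0_Ck[OF assms(2)]]]) simp
  finally show ?thesis unfolding ip_def using Ck0_Ck[OF assms(2)] by (simp add: nderiv_cnj)
qed

lemma ip_D_power_symmetric:
  assumes "\<phi> \<in> Ck0 k" "\<psi> \<in> Ck0 k"
  shows "ip (\<lambda>t. \<i> ^ k * nderiv k \<phi> t) \<psi> = ip \<phi> (\<lambda>t. \<i> ^ k * nderiv k \<psi> t)"
  unfolding ip_cmult_left ip_cmult_right using ip_nderiv_shift[of \<phi> k 0 \<psi>] assms
  by (simp add: power_mult_distrib[symmetric])

lemma polyD_L2: "\<phi> \<in> Ck0 (degree Q) \<Longrightarrow> polyD Q \<phi> \<in> L2"
  unfolding polyD_def[abs_def] by (intro L2_sum L2_cmult nderiv_Ck0_L2) auto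

lemma ip_sum_left:
  assumes "\<And>k. k \<in> I \<Longrightarrow> f k \<in> L2" "h \<in> L2"
  shows "ip (\<lambda>t. \<Sum>k\<in>I. f k t) h = (\<Sum>k\<in>I. ip (f k) h)"
  using assms(1)
proof (induction I rule: infinite_finite_induct)
  case (insert x F)
  then show ?case using assms(2) ip_add_left[of "f x" "\<lambda>t. \<Sum>k\<in>F. f k t" h] L2_sum[of F f] by simp
qed (auto simp: ip_def)

lemma ip_polyD_left:
  assumes "\<phi> \<in> Ck0 (degree Q)" "\<psi> \<in> L2"
  shows "ip (polyD Q \<phi>) \<psi> = (\<Sum>k\<le>degree Q. of_real (coeff Q k) * ip (\<lambda>t. \<i> ^ k * nderiv k \<phi> t) \<psi>)"
proof -
  have "ip (polyD Q \<phi>) \<psi> = (\<Sum>k\<le>degree Q. ip (\<lambda>t. of_real (coeff Q k) * (\<i> ^ k * nderiv k \<phi> t)) \<psi>)"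
    unfolding polyD_def[abs_def] mult.assoc
    by (intro ip_sum_left L2_cmult nderiv_Ck0_L2[OF assms(1)] assms(2)) simp
  then show ?thesis by (simp add: ip_cmult_left)
qed

lemma ip_polyD_symmetric:
  assumes "\<phi> \<in> Ck0 (degree Q)" "\<psi> \<in> Ck0 (degree Q)"
  shows "ip (polyD Q \<phi>) \<psi> = ip \<phi> (polyD Q \<psi>)"
proof -
  have m: "f \<in> Ck0 (degree Q) \<Longrightarrow> k \<le> degree Q \<Longrightarrow> f \<in> Ck0 k" for f :: "real \<Rightarrow> complex" and k
    using nderiv_in_Ck0[of f "degree Q" 0 k] by simp
  show ?thesis
    unfolding ip_cnj[of \<phi> "polyD Q \<psi>"] ip_polyD_left[OF assms(1) Ck0_L2[OF assms(2)]]
      ip_polyD_left[OF assms(2) Ck0_L2[OF assms(1)]]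
    using m[OF assms(1)] m[OF assms(2)]
    by (simp add: ip_D_power_symmetric ip_cnj[of _ \<phi>] cong: sum.cong)
       (auto intro!: sum.cong simp: ip_D_power_symmetric simp flip: ip_cnj)
qed

lemma convex_chain_derivatives:
  assumes "\<phi> \<in> Ck0 m"
  shows "convex_chain m (\<lambda>\<eta>. 1 / (4 * \<eta>)) (\<lambda>k. (l2norm (nderiv k \<phi>))\<^sup>2)"
  unfolding convex_chain_def
proof (intro conjI allI impI)
  fix k and \<eta> :: real assume k: "Suc k < m" and \<eta>: "0 < \<eta>"
  have L: "nderiv (Suc (Suc k)) \<phi> \<in> L2" "nderiv k \<phi> \<in> L2"
    using nderiv_Ck0_L2[OF assms] k by auto
  have \<psi>: "nderiv k \<phi> \<in> Ck0 1" using nderiv_in_Ck0[OF assms, of k 1] k by simp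
  have p2: "\<phi> \<in> Ck0 (1 + Suc k)" using nderiv_in_Ck0[OF assms, of 0 "1 + Suc k"] k by simp
  have "complex_of_real ((l2norm (nderiv (Suc k) \<phi>))\<^sup>2) = - ip (nderiv (Suc (Suc k)) \<phi>) (nderiv k \<phi>)"
    using ip_nderiv_shift[OF p2 \<psi>] ip_self[of "nderiv (Suc k) \<phi>"] by (simp add: nderiv_add_index)
  then have "norm (complex_of_real ((l2norm (nderiv (Suc k) \<phi>))\<^sup>2)) = norm (ip (nderiv (Suc (Suc k)) \<phi>) (nderiv k \<phi>))"
    by simp
  then have "(l2norm (nderiv (Suc k) \<phi>))\<^sup>2 = norm (ip (nderiv (Suc (Suc k)) \<phi>) (nderiv k \<phi>))"
    unfolding norm_of_real by simp
  also have "\<dots> \<le> l2norm (nderiv (Suc (Suc k)) \<phi>) * l2norm (nderiv k \<phi>)"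
    by (rule ip_cauchy_schwarz[OF L])
  also have "\<dots> \<le> \<eta> * (l2norm (nderiv (Suc (Suc k)) \<phi>))\<^sup>2 + 1 / (4 * \<eta>) * (l2norm (nderiv k \<phi>))\<^sup>2"
    by (rule mult_le_weighted_squares[OF \<eta>])
  finally show "(l2norm (nderiv (Suc k) \<phi>))\<^sup>2 \<le> \<eta> * (l2norm (nderiv (Suc (Suc k)) \<phi>))\<^sup>2 + 1 / (4 * \<eta>) * (l2norm (nderiv k \<phi>))\<^sup>2" .
qed simp

text \<open>Moving half of the derivatives to the other factor leaves orders at most \<open>m\<close>, of which at least one
  is smaller than \<open>m\<close>.\<close>

lemma ip_nderiv_self_bound:
  assumes "\<epsilon> > 0" "k < 2 * m"
  shows "\<exists>C\<ge>0. \<forall>\<phi>\<in>Ck0 (2 * m). norm (ip (nderiv k \<phi>) \<phi>) \<le> \<epsilon> * (l2norm (nderiv m \<phi>))\<^sup>2 + C * (l2norm \<phi>)\<^sup>2"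
proof -
  have C0: "\<phi> \<in> Ck0 j" if "\<phi> \<in> Ck0 (2 * m)" "j \<le> 2 * m" for \<phi> :: "real \<Rightarrow> complex" and j
    using nderiv_in_Ck0[OF that(1), of 0 j] that(2) by simp
  have Dnn: "\<And>\<eta>::real. \<eta> > 0 \<Longrightarrow> 1 / (4 * \<eta>) \<ge> 0" by simp
  define j where "j = k div 2"
  have jm: "j < m" using assms by (auto simp: j_def)
  show ?thesis
  proof (cases "even k")
    case True
    then have k: "k = j + j" by (auto simp: j_def)
    obtain C where C: "C \<ge> 0" "\<And>b k. convex_chain m (\<lambda>\<eta>. 1 / (4 * \<eta>)) b \<Longrightarrow> k < m \<Longrightarrow> b k \<le> \<epsilon> * b m + C * b 0"
      using convex_chain_interpolation[where D = "\<lambda>\<eta>. 1 / (4 * \<eta>)", OF Dnn assms(1)] by blast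
    show ?thesis
    proof (intro exI[of _ C] conjI ballI C(1))
      fix \<phi> :: "real \<Rightarrow> complex" assume \<phi>: "\<phi> \<in> Ck0 (2 * m)"
      have "norm (ip (nderiv k \<phi>) \<phi>) = (l2norm (nderiv j \<phi>))\<^sup>2"
        unfolding k using ip_nderiv_shift[of \<phi> j j \<phi>] C0[OF \<phi>] jm
        by (simp add: norm_mult norm_power ip_self del: of_real_power)
      also have "\<dots> \<le> \<epsilon> * (l2norm (nderiv m \<phi>))\<^sup>2 + C * (l2norm \<phi>)\<^sup>2"
        using C(2)[OF convex_chain_derivatives jm, of \<phi>] C0[OF \<phi>, of m] by simp
      finally show "norm (ip (nderiv k \<phi>) \<phi>) \<le> \<epsilon> * (l2norm (nderiv m \<phi>))\<^sup>2 + C * (l2norm \<phi>)\<^sup>2" .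
    qed
  next
    case False
    then have k: "k = j + Suc j" by (auto simp: j_def elim: oddE)
    obtain C1 where C1: "C1 \<ge> 0" "\<And>b k. convex_chain m (\<lambda>\<eta>. 1 / (4 * \<eta>)) b \<Longrightarrow> k < m \<Longrightarrow> b k \<le> 1 * b m + C1 * b 0"
      using convex_chain_interpolation[where D = "\<lambda>\<eta>. 1 / (4 * \<eta>)" and \<epsilon> = 1, OF Dnn] by auto
    have "\<epsilon> * \<epsilon> > 0" using assms by simp
    then obtain C2 where C2: "C2 \<ge> 0" "\<And>b k. convex_chain m (\<lambda>\<eta>. 1 / (4 * \<eta>)) b \<Longrightarrow> k < m \<Longrightarrow> b k \<le> (\<epsilon> * \<epsilon>) * b m + C2 * b 0"
      using convex_chain_interpolation[where D = "\<lambda>\<eta>. 1 / (4 * \<eta>)" and \<epsilon> = "\<epsilon> * \<epsilon>", OF Dnn] by auto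
    show ?thesis
    proof (intro exI[of _ "\<epsilon> / 2 * C1 + 1 / (2 * \<epsilon>) * C2"] conjI ballI)
      show "0 \<le> \<epsilon> / 2 * C1 + 1 / (2 * \<epsilon>) * C2" using C1(1) C2(1) assms by simp
      fix \<phi> :: "real \<Rightarrow> complex" assume \<phi>: "\<phi> \<in> Ck0 (2 * m)"
      let ?a = "\<lambda>k. (l2norm (nderiv k \<phi>))\<^sup>2"
      have cc: "convex_chain m (\<lambda>\<eta>. 1 / (4 * \<eta>)) ?a" by (rule convex_chain_derivatives) (use C0[OF \<phi>] in simp)
      have aS: "?a (Suc j) \<le> ?a m + C1 * ?a 0"
      proof (cases "Suc j < m")
        case True
        then show ?thesis using C1(2)[OF cc True] by simp
      next
        case False
        then have "Suc j = m" using jm by simp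
        then show ?thesis using C1(1) by simp
      qed
      have "norm (ip (nderiv k \<phi>) \<phi>) = norm (ip (nderiv (Suc j) \<phi>) (nderiv j \<phi>))"
        unfolding k using ip_nderiv_shift[of \<phi> j "Suc j" \<phi>] C0[OF \<phi>] jm
        by (simp add: norm_mult norm_power)
      also have "\<dots> \<le> l2norm (nderiv (Suc j) \<phi>) * l2norm (nderiv j \<phi>)"
        by (rule ip_cauchy_schwarz; rule nderiv_Ck0_L2[OF \<phi>]) (use jm in auto)
      also have "\<dots> \<le> \<epsilon> / 2 * ?a (Suc j) + 1 / (4 * (\<epsilon> / 2)) * ?a j"
        by (rule mult_le_weighted_squares) (use assms in simp)
      also have "\<dots> \<le> \<epsilon> / 2 * (?a m + C1 * ?a 0) + 1 / (4 * (\<epsilon> / 2)) * ((\<epsilon> * \<epsilon>) * ?a m + C2 * ?a 0)"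
        using aS C2(2)[OF cc jm] assms by (intro add_mono mult_left_mono) auto
      also have "\<dots> = \<epsilon> * ?a m + (\<epsilon> / 2 * C1 + 1 / (2 * \<epsilon>) * C2) * ?a 0"
        using assms by (simp add: field_simps)
      finally show "norm (ip (nderiv k \<phi>) \<phi>) \<le> \<epsilon> * ?a m + (\<epsilon> / 2 * C1 + 1 / (2 * \<epsilon>) * C2) * (l2norm \<phi>)\<^sup>2"
        by simp
    qed
  qed
qed

text \<open>In Fourier space this is the inequality \<open>Q(x) \<ge> c\<^sub>1 x\<^sup>2 - c\<^sub>2\<close>, which holds because the degree is
  even and the leading coefficient positive. Here it comes from integrating by parts until both
  factors carry (almost) equally many derivatives, and from interpolation.\<close>

lemma polyD_form_lower_bound:
  assumes deg: "degree Q = 2 * m" and m: "m \<ge> 1" and lead: "coeff Q (2 * m) > 0"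
  obtains c1 c2 where "c1 > 0" "c2 \<ge> 0"
    "\<And>\<phi>. \<phi> \<in> Ck0 (2 * m) \<Longrightarrow> Re (ip (polyD Q \<phi>) \<phi>) \<ge> c1 * (l2norm (nderiv 1 \<phi>))\<^sup>2 - c2 * (l2norm \<phi>)\<^sup>2"
proof -
  define q where "q = coeff Q (2 * m)"
  define S where "S = (\<Sum>k<2*m. \<bar>coeff Q k\<bar>)"
  have S0: "S \<ge> 0" unfolding S_def by (simp add: sum_nonneg)
  \<comment> \<open>With this choice all lower-order terms together use up at most half of the leading term.\<close>
  define \<epsilon> where "\<epsilon> = q / (2 * (S + 1))"
  have q0: "q > 0" using lead by (simp add: q_def)
  have \<epsilon>: "\<epsilon> > 0" unfolding \<epsilon>_def using q0 S0 by simp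
  have "\<forall>k. \<exists>C\<ge>0. k < 2 * m \<longrightarrow> (\<forall>\<phi>\<in>Ck0 (2 * m). norm (ip (nderiv k \<phi>) \<phi>) \<le> \<epsilon> * (l2norm (nderiv m \<phi>))\<^sup>2 + C * (l2norm \<phi>)\<^sup>2)"
    using ip_nderiv_self_bound[OF \<epsilon>] by (metis order_refl)
  then obtain C where C: "\<And>k. C k \<ge> 0"
    "\<And>k \<phi>. k < 2 * m \<Longrightarrow> \<phi> \<in> Ck0 (2 * m) \<Longrightarrow> norm (ip (nderiv k \<phi>) \<phi>) \<le> \<epsilon> * (l2norm (nderiv m \<phi>))\<^sup>2 + C k * (l2norm \<phi>)\<^sup>2"
    by metis
  obtain C1 where C1: "C1 \<ge> 0" "\<And>b k. convex_chain m (\<lambda>\<eta>. 1 / (4 * \<eta>)) b \<Longrightarrow> k < m \<Longrightarrow> b k \<le> 1 * b m + C1 * b 0"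
    using convex_chain_interpolation[where D = "\<lambda>\<eta>. 1 / (4 * \<eta>)" and \<epsilon> = 1 and m = m] by auto
  define c2 where "c2 = q / 2 * C1 + (\<Sum>k<2*m. \<bar>coeff Q k\<bar> * C k)"
  show ?thesis
  proof (rule that[of "q / 2" c2])
    show "q / 2 > 0" using q0 by simp
    show "c2 \<ge> 0" unfolding c2_def using q0 C1(1) C(1) by (simp add: sum_nonneg)
    fix \<phi> :: "real \<Rightarrow> complex" assume \<phi>: "\<phi> \<in> Ck0 (2 * m)"
    let ?a = "\<lambda>k. (l2norm (nderiv k \<phi>))\<^sup>2"
    have \<phi>m: "\<phi> \<in> Ck0 m" using nderiv_in_Ck0[OF \<phi>, of 0 m] by simp
    have cc: "convex_chain m (\<lambda>\<eta>. 1 / (4 * \<eta>)) ?a" by (rule convex_chain_derivatives[OF \<phi>m])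
    have a1: "?a 1 \<le> ?a m + C1 * ?a 0"
    proof (cases "1 < m")
      case True
      then show ?thesis using C1(2)[OF cc True] by simp
    next
      case False
      then have "m = 1" using m by simp
      then show ?thesis using C1(1) by simp
    qed
    let ?T = "\<lambda>k. of_real (coeff Q k) * ip (\<lambda>t. \<i> ^ k * nderiv k \<phi> t) \<phi>"
    have top: "ip (\<lambda>t. \<i> ^ (2 * m) * nderiv (2 * m) \<phi> t) \<phi> = of_real (?a m)"
      unfolding ip_cmult_left mult_2 using ip_nderiv_shift[of \<phi> m m \<phi>] \<phi> \<phi>m
      by (simp add: ip_self mult_2 power_add power_mult_distrib[symmetric] mult.assoc[symmetric] del: of_real_power)
    have low: "\<bar>Re (\<Sum>k<2*m. ?T k)\<bar> \<le> q / 2 * ?a m + (\<Sum>k<2*m. \<bar>coeff Q k\<bar> * C k) * ?a 0"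
    proof -
      have "\<bar>Re (\<Sum>k<2*m. ?T k)\<bar> \<le> norm (\<Sum>k<2*m. ?T k)" by (rule abs_Re_le_cmod)
      also have "\<dots> \<le> (\<Sum>k<2*m. \<bar>coeff Q k\<bar> * (\<epsilon> * ?a m + C k * ?a 0))"
      proof (rule sum_norm_le)
        fix k assume k: "k \<in> {..<2*m}"
        have "norm (?T k) = \<bar>coeff Q k\<bar> * norm (ip (nderiv k \<phi>) \<phi>)"
          by (simp add: ip_cmult_left norm_mult norm_power)
        also have "\<dots> \<le> \<bar>coeff Q k\<bar> * (\<epsilon> * ?a m + C k * ?a 0)"
          using C(2)[OF _ \<phi>, of k] k by (intro mult_left_mono) auto
        finally show "norm (?T k) \<le> \<bar>coeff Q k\<bar> * (\<epsilon> * ?a m + C k * ?a 0)" .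
      qed
      also have "\<dots> = S * \<epsilon> * ?a m + (\<Sum>k<2*m. \<bar>coeff Q k\<bar> * C k) * ?a 0"
        by (simp add: distrib_left sum.distrib sum_distrib_right S_def mult.assoc)
      also have "S * \<epsilon> * ?a m \<le> q / 2 * ?a m"
      proof (rule mult_right_mono)
        have "S / (S + 1) \<le> 1" using S0 by simp
        then have "q / 2 * (S / (S + 1)) \<le> q / 2 * 1" using q0 by (intro mult_left_mono) auto
        then show "S * \<epsilon> \<le> q / 2" unfolding \<epsilon>_def by (simp add: mult.commute)
      qed simp
      finally show ?thesis by simp
    qed
    have "Re (ip (polyD Q \<phi>) \<phi>) = Re (\<Sum>k<2*m. ?T k) + q * ?a m"
    proof -
      have "ip (polyD Q \<phi>) \<phi> = (\<Sum>k\<le>2*m. ?T k)"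
        using ip_polyD_left[of \<phi> Q \<phi>] \<phi> deg Ck0_L2[OF \<phi>] by simp
      also have "\<dots> = (\<Sum>k<2*m. ?T k) + ?T (2 * m)" by (simp add: lessThan_Suc_atMost[symmetric])
      finally show ?thesis unfolding top by (simp add: q_def)
    qed
    also have "\<dots> \<ge> q / 2 * ?a m - (\<Sum>k<2*m. \<bar>coeff Q k\<bar> * C k) * ?a 0"
      using low by (simp add: abs_le_iff)
    finally have "Re (ip (polyD Q \<phi>) \<phi>) \<ge> q / 2 * ?a m - (\<Sum>k<2*m. \<bar>coeff Q k\<bar> * C k) * ?a 0" .
    moreover have "q / 2 * ?a 1 \<le> q / 2 * (?a m + C1 * ?a 0)"
      using a1 q0 by (intro mult_left_mono) auto
    ultimately show "Re (ip (polyD Q \<phi>) \<phi>) \<ge> q / 2 * ?a 1 - c2 * (l2norm \<phi>)\<^sup>2"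
      unfolding c2_def by (simp add: algebra_simps)
  qed
qed


section \<open>The operator on compactly supported functions\<close>

lemma polyD_diff:
  assumes "f \<in> Ck (degree Q)" "g \<in> Ck (degree Q)"
  shows "polyD Q (\<lambda>t. f t - g t) t = polyD Q f t - polyD Q g t"
  unfolding polyD_def sum_subtractf[symmetric]
  by (intro sum.cong) (auto simp: nderiv_diff[OF assms] algebra_simps)

lemma Ck0_interval_integral:
  fixes \<phi> :: "real \<Rightarrow> complex"
  assumes "\<phi> \<in> Ck 1" "x \<le> y"
  shows "(LINT t|lborel. indicator {x..y} t * nderiv 1 \<phi> t) = \<phi> y - \<phi> x"
proof -
  have "(LINT t|lborel. indicator {x..y} t *\<^sub>R nderiv 1 \<phi> t) = \<phi> y - \<phi> x"
    by (rule integral_FTC_atLeastAtMost)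
       (use assms Ck_has_derivative_Suc[of \<phi> 0, THEN has_vector_derivative_at_within] Ck_continuous_nderiv[OF assms(1)] in auto)
  moreover have "(indicator {x..y} t *\<^sub>R nderiv 1 \<phi> t) = indicator {x..y} t * nderiv 1 \<phi> t" for t
    by (simp add: indicator_def)
  ultimately show ?thesis by simp
qed

lemma indicator_interval_L2:
  assumes "x \<le> y"
  shows "(\<lambda>t. indicator {x..y} t :: complex) \<in> L2" "l2norm (\<lambda>t. indicator {x..y} t) = sqrt (y - x)"
proof -
  have eq: "(norm (indicator {x..y} t :: complex))\<^sup>2 = indicator {x..y} t" for t by (simp add: indicator_def)
  show "(\<lambda>t. indicator {x..y} t :: complex) \<in> L2"
    by (rule L2I) (simp_all add: eq assms)
  show "l2norm (\<lambda>t. indicator {x..y} t) = sqrt (y - x)"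
    unfolding l2norm_def eq using assms by simp
qed

text \<open>Sobolev's inequality in dimension one: the supremum norm and the Hoelder-1/2 seminorm are
  controlled by the norms of the function and its derivative.\<close>

lemma Ck0_holder:
  fixes \<phi> :: "real \<Rightarrow> complex"
  assumes "\<phi> \<in> Ck0 1"
  shows "norm (\<phi> y - \<phi> x) \<le> l2norm (nderiv 1 \<phi>) * sqrt \<bar>y - x\<bar>"
proof -
  have main: "norm (\<phi> y - \<phi> x) \<le> l2norm (nderiv 1 \<phi>) * sqrt (y - x)" if "x \<le> y" for x y
  proof -
    have "cnj (indicator {x..y} t) = indicator {x..y} t" for t :: real by (simp add: indicator_def)
    then have "\<phi> y - \<phi> x = ip (nderiv 1 \<phi>) (indicator {x..y})"
      unfolding ip_def using Ck0_interval_integral[OF Ck0_Ck[OF assms] that]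
      by (simp add: mult.commute)
    then show ?thesis
      using ip_cauchy_schwarz[OF nderiv_Ck0_L2[OF assms order_refl] indicator_interval_L2(1)[OF that]]
        indicator_interval_L2(2)[OF that] by simp
  qed
  show ?thesis
  proof (cases "x \<le> y")
    case True then show ?thesis using main[OF True] by simp
  next
    case False then show ?thesis using main[of y x] by (simp add: norm_minus_commute)
  qed
qed

lemma Ck0_sup_bound:
  fixes \<phi> :: "real \<Rightarrow> complex"
  assumes "\<phi> \<in> Ck0 1"
  shows "(norm (\<phi> x))\<^sup>2 \<le> 2 * l2norm \<phi> * l2norm (nderiv 1 \<phi>)"
proof -
  obtain R where R: "\<And>t. \<bar>t\<bar> > R \<Longrightarrow> \<phi> t = 0" using assms unfolding Ck0_iff by blast
  define y where "y = - (\<bar>R\<bar> + \<bar>x\<bar> + 1)"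
  have y: "y \<le> x" "\<phi> y = 0" using R[of y] by (auto simp: y_def)
  have \<phi>: "\<phi> \<in> Ck 1" by (rule Ck0_Ck[OF assms])
  define F where "F t = \<phi> t * cnj (\<phi> t)" for t
  have FC: "F \<in> Ck 1" unfolding F_def[abs_def] by (intro Ck_mult Ck_cnj \<phi>)
  have D: "nderiv 1 F t = \<phi> t * cnj (nderiv 1 \<phi> t) + nderiv 1 \<phi> t * cnj (\<phi> t)" for t
    unfolding F_def[abs_def] using nderiv_1_mult[of \<phi> 0 "\<lambda>t. cnj (\<phi> t)" 0] \<phi> Ck_cnj[OF \<phi>]
    by (simp add: nderiv_cnj[of \<phi> 1 1, simplified])
  have L: "\<phi> \<in> L2" "nderiv 1 \<phi> \<in> L2" using Ck0_L2[OF assms] nderiv_Ck0_L2[OF assms order_refl] by auto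
  have "F x = (LINT t|lborel. indicator {y..x} t * nderiv 1 F t)"
    using Ck0_interval_integral[OF FC y(1)] y(2) by (simp add: F_def)
  then have "norm (F x) \<le> (LINT t|lborel. norm (indicator {y..x} t * nderiv 1 F t))"
    by (simp add: integral_norm_bound)
  also have "\<dots> \<le> (LINT t|lborel. 2 * (norm (\<phi> t) * norm (nderiv 1 \<phi> t)))"
  proof (rule integral_mono')
    show "integrable lborel (\<lambda>t. 2 * (norm (\<phi> t) * norm (nderiv 1 \<phi> t)))"
      using integrable_L2_mult(1)[OF L] by simp
    show "norm (indicator {y..x} t * nderiv 1 F t) \<le> 2 * (norm (\<phi> t) * norm (nderiv 1 \<phi> t))" for t
    proof -
      have "norm (nderiv 1 F t) \<le> 2 * (norm (\<phi> t) * norm (nderiv 1 \<phi> t))"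
        unfolding D by (rule order_trans[OF norm_triangle_ineq]) (simp add: norm_mult)
      then show ?thesis by (auto simp: indicator_def)
    qed
  qed auto
  also have "\<dots> \<le> 2 * (l2norm \<phi> * l2norm (nderiv 1 \<phi>))"
    using integral_mult_le_l2norm[OF L] by simp
  finally show ?thesis by (simp add: F_def norm_mult power2_eq_square)
qed

locale weighted_op =
  fixes Q :: "real poly" and v :: "real \<Rightarrow> real" and C :: real
  assumes deg_even: "even (degree Q)" and deg_ge_2: "degree Q \<ge> 2"
    and lead_pos: "coeff Q (degree Q) > 0"
    and v_Ck: "v \<in> Ck (degree Q)" and v_pos: "\<And>t. v t > 0"
    and v_deriv: "\<And>t. \<bar>nderiv 1 v t\<bar> \<le> C * v t"
    and v_lim: "(v \<longlongrightarrow> 0) at_infinity"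
begin

abbreviation "K \<equiv> degree Q"

definition A :: "(real \<Rightarrow> complex) \<Rightarrow> real \<Rightarrow> complex" where
  "A g t = of_real (v t) * polyD Q (\<lambda>s. of_real (v s) * g s) t"

lemma op_A0_eq: "op_A0 v Q = {(g, A g) | g. g \<in> Ck0 K}"
  unfolding op_A0_def A_def[abs_def] by simp

lemma v_nonzero: "v t \<noteq> 0"
  using v_pos[of t] by simp

lemma v_small:
  assumes "\<epsilon> > 0" obtains R where "R > 0" "\<And>t. \<bar>t\<bar> > R \<Longrightarrow> v t \<le> \<epsilon>"
proof -
  have "eventually (\<lambda>t. v t < \<epsilon>) at_infinity" using order_tendstoD(2)[OF v_lim assms] .
  then obtain b where "\<And>t. b \<le> \<bar>t\<bar> \<Longrightarrow> v t < \<epsilon>" unfolding eventually_at_infinity by auto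
  then have b: "v t \<le> \<epsilon>" if "\<bar>b\<bar> + 1 < \<bar>t\<bar>" for t using that by (simp add: less_imp_le)
  show ?thesis by (rule that[of "\<bar>b\<bar> + 1"]) (use b in auto)
qed

lemma v_bounded: obtains B where "B > 0" "\<And>t. v t \<le> B"
proof -
  obtain R where R: "\<And>t. \<bar>t\<bar> > R \<Longrightarrow> v t \<le> 1" using v_small[of 1] by auto
  have "bounded (v ` {-R..R})"
    by (intro compact_imp_bounded compact_continuous_image Ck_continuous[OF v_Ck]) auto
  then obtain B where B: "\<And>t. t \<in> {-R..R} \<Longrightarrow> norm (v t) \<le> B" unfolding bounded_iff by blast
  have "v t \<le> \<bar>B\<bar> + 1" for t
  proof (cases "\<bar>t\<bar> > R")
    case True then show ?thesis using R[OF True] by simp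
  next
    case False
    then have "t \<in> {-R..R}" by auto
    then show ?thesis using B[of t] by simp
  qed
  then show ?thesis using that[of "\<bar>B\<bar> + 1"] by simp
qed

lemma v_measurable [measurable]: "v \<in> borel_measurable borel"
  using Ck_measurable[OF v_Ck, of 0] by simp

lemma v_mult_Ck: "g \<in> Ck K \<Longrightarrow> (\<lambda>s. of_real (v s) * g s :: complex) \<in> Ck K"
  by (intro Ck_mult Ck_of_real v_Ck)

lemma v_mult_Ck0: "g \<in> Ck0 K \<Longrightarrow> (\<lambda>s. of_real (v s) * g s :: complex) \<in> Ck0 K"
  by (intro Ck0_mult_right Ck_of_real v_Ck)

lemma v_mult_L2:
  assumes "f \<in> L2" shows "(\<lambda>t. of_real (v t) * f t) \<in> L2"
proof -
  obtain B where B: "B > 0" "\<And>t. v t \<le> B" using v_bounded by blast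
  have "norm (of_real (v t) * f t) \<le> B * norm (f t)" for t
    using B(2)[of t] v_pos[of t] by (simp add: norm_mult mult_right_mono)
  then show ?thesis using assms L2_measurable[OF assms]
    by (intro L2_dominated(1)[OF assms, of _ B]) measurable
qed

lemma v_mult_l2norm_le:
  obtains B where "B > 0" "\<And>f. f \<in> L2 \<Longrightarrow> l2norm (\<lambda>t. of_real (v t) * f t) \<le> B * l2norm f"
proof -
  obtain B where B: "B > 0" "\<And>t. v t \<le> B" using v_bounded by blast
  show ?thesis
  proof (rule that[OF B(1)])
    fix f :: "real \<Rightarrow> complex" assume f: "f \<in> L2"
    have "norm (of_real (v t) * f t) \<le> B * norm (f t)" for t
      using B(2)[of t] v_pos[of t] by (simp add: norm_mult mult_right_mono)
    then have "l2norm (\<lambda>t. of_real (v t) * f t) \<le> \<bar>B\<bar> * l2norm f"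
      using L2_measurable[OF v_mult_L2[OF f]] by (intro L2_dominated(2)[OF f])
    then show "l2norm (\<lambda>t. of_real (v t) * f t) \<le> B * l2norm f" using B by simp
  qed
qed

lemma A_L2: "g \<in> Ck0 K \<Longrightarrow> A g \<in> L2"
  unfolding A_def[abs_def] by (intro v_mult_L2 polyD_L2 v_mult_Ck0)

lemma A_diff:
  assumes "g \<in> Ck0 K" "h \<in> Ck0 K"
  shows "A (\<lambda>t. g t - h t) = (\<lambda>t. A g t - A h t)"
proof
  fix t
  show "A (\<lambda>t. g t - h t) t = A g t - A h t"
    unfolding A_def using polyD_diff[OF v_mult_Ck[OF Ck0_Ck[OF assms(1)]] v_mult_Ck[OF Ck0_Ck[OF assms(2)]], of t]
    by (simp add: right_diff_distrib)
qed

lemma ip_v_mult: "ip (\<lambda>t. of_real (v t) * f t) g = ip f (\<lambda>t. of_real (v t) * g t)"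
  unfolding ip_def by (simp add: mult_ac)

lemma A_form: "ip (A g) h = ip (polyD Q (\<lambda>s. of_real (v s) * g s)) (\<lambda>s. of_real (v s) * h s)"
  unfolding A_def[abs_def] ip_v_mult ..

lemma A_symmetric:
  assumes "g \<in> Ck0 K" "h \<in> Ck0 K" shows "ip (A g) h = ip g (A h)"
  unfolding ip_cnj[of g "A h"] A_form using ip_polyD_symmetric[OF v_mult_Ck0[OF assms(1)] v_mult_Ck0[OF assms(2)]]
  by (simp flip: ip_cnj)

lemma A_form_lower_bound:
  obtains c1 c2 where "c1 > 0" "c2 \<ge> 0"
    "\<And>g. g \<in> Ck0 K \<Longrightarrow> Re (ip (A g) g) \<ge> c1 * (l2norm (nderiv 1 (\<lambda>s. of_real (v s) * g s)))\<^sup>2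
      - c2 * (l2norm (\<lambda>s. of_real (v s) * g s))\<^sup>2"
proof -
  define m where "m = K div 2"
  have m: "K = 2 * m" "m \<ge> 1" using deg_even deg_ge_2 by (auto simp: m_def)
  obtain c1 c2 where "c1 > 0" "c2 \<ge> 0"
    "\<And>\<phi>. \<phi> \<in> Ck0 (2 * m) \<Longrightarrow> Re (ip (polyD Q \<phi>) \<phi>) \<ge> c1 * (l2norm (nderiv 1 \<phi>))\<^sup>2 - c2 * (l2norm \<phi>)\<^sup>2"
    using polyD_form_lower_bound[OF m] lead_pos m(1) by metis
  then show ?thesis using that[of c1 c2] v_mult_Ck0 unfolding A_form m(1)[symmetric] by blast
qed

lemma shifted_L2: "g \<in> Ck0 K \<Longrightarrow> (\<lambda>t. A g t - z * g t) \<in> L2"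
  by (intro L2_diff A_L2 L2_cmult Ck0_L2)

section \<open>Compactness below the essential spectrum\<close>

text \<open>A diagonal argument gives convergence on the rationals, equicontinuity carries it over to the
  whole line. Unlike in the theorem of Arzela and Ascoli, no compact domain is needed for pointwise
  convergence.\<close>

lemma equicontinuous_pointwise_subsequence:
  fixes w :: "nat \<Rightarrow> real \<Rightarrow> complex"
  assumes bnd: "\<And>n t. norm (w n t) \<le> M"
    and hoe: "\<And>n x y. norm (w n y - w n x) \<le> P * sqrt \<bar>y - x\<bar>"
  obtains r :: "nat \<Rightarrow> nat" where "strict_mono r" "\<And>t. convergent (\<lambda>n. w (r n) t)"
proof -
  have "countable (\<rat> :: real set)" by (rule countable_rat)
  then obtain r :: "nat \<Rightarrow> nat" where r: "strict_mono r" "\<And>q. q \<in> \<rat> \<Longrightarrow> \<exists>l. (\<lambda>n. w (r n) q) \<longlonglongrightarrow> l"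
    using function_convergent_subsequence[of \<rat> w M] bnd by metis
  have "convergent (\<lambda>n. w (r n) t)" for t
  proof -
    have "Cauchy (\<lambda>n. w (r n) t)"
    proof (rule metric_CauchyI)
      fix e :: real assume e: "e > 0"
      define d where "d = (e / (4 * (\<bar>P\<bar> + 1)))\<^sup>2"
      have d: "d > 0" unfolding d_def using e by (intro zero_less_power) simp
      obtain q where q: "q \<in> \<rat>" "t < q" "q < t + d" using Rats_dense_in_real[of t "t + d"] d by auto
      have close: "norm (w n t - w n q) \<le> e / 4" for n
      proof -
        have "sqrt \<bar>t - q\<bar> \<le> sqrt d" using q by (intro real_sqrt_le_mono) auto
        also have "sqrt d = e / (4 * (\<bar>P\<bar> + 1))" unfolding d_def using e by simp
        finally have s: "sqrt \<bar>t - q\<bar> \<le> e / (4 * (\<bar>P\<bar> + 1))" .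
        have "norm (w n t - w n q) \<le> P * sqrt \<bar>t - q\<bar>" by (rule hoe)
        also have "\<dots> \<le> (\<bar>P\<bar> + 1) * (e / (4 * (\<bar>P\<bar> + 1)))"
          using s by (intro mult_mono) auto
        also have "\<dots> = e / 4" by (simp add: field_simps)
        finally show ?thesis .
      qed
      obtain l where "(\<lambda>n. w (r n) q) \<longlonglongrightarrow> l" using r(2)[OF q(1)] by blast
      then have "Cauchy (\<lambda>n. w (r n) q)" by (rule LIMSEQ_imp_Cauchy)
      then obtain N where N: "\<And>m n. m \<ge> N \<Longrightarrow> n \<ge> N \<Longrightarrow> dist (w (r m) q) (w (r n) q) < e / 4"
        using e metric_CauchyD[of _ "e / 4"] by (metis divide_pos_pos zero_less_numeral)
      have "dist (w (r m) t) (w (r n) t) < e" if "m \<ge> N" "n \<ge> N" for m n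
      proof -
        have "w (r m) t - w (r n) t = (w (r m) t - w (r m) q) + (w (r m) q - w (r n) q) - (w (r n) t - w (r n) q)"
          by simp
        then have "norm (w (r m) t - w (r n) t) \<le> norm (w (r m) t - w (r m) q) + norm (w (r m) q - w (r n) q) + norm (w (r n) t - w (r n) q)"
          by (metis norm_triangle_ineq norm_triangle_ineq4 add_right_mono order_trans)
        also have "\<dots> < e" using close[of "r m"] close[of "r n"] N[OF that] e by (simp add: dist_norm)
        finally show ?thesis by (simp add: dist_norm)
      qed
      then show "\<exists>N. \<forall>m\<ge>N. \<forall>n\<ge>N. dist (w (r m) t) (w (r n) t) < e" by blast
    qed
    then show ?thesis by (simp add: Cauchy_convergent_iff)
  qed
  then show ?thesis using that r(1) by blast
qed

text \<open>On a bounded interval this is dominated convergence; outside of it \<open>v\<close> is small and the norms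
  of \<open>g\<^sub>n\<close> are bounded.\<close>

lemma weighted_cauchy:
  assumes g: "\<And>n. g n \<in> L2" "\<And>n. l2norm (g n) \<le> M"
    and bnd: "\<And>n t. norm (of_real (v t) * g n t) \<le> B"
    and conv: "\<And>t. convergent (\<lambda>n::nat. of_real (v t) * g n t)"
    and e: "e > 0"
  shows "\<exists>N. \<forall>m\<ge>N. \<forall>n\<ge>N. (l2norm (\<lambda>t. of_real (v t) * (g m t - g n t)))\<^sup>2 < e"
proof -
  have M0: "M \<ge> 0" using g(2)[of 0] l2norm_nonneg order_trans by blast
  have B0: "B \<ge> 0" using bnd[of 0 0] norm_ge_zero order_trans by blast
  define w where "w n t = of_real (v t) * g n t" for n t
  define W where "W t = lim (\<lambda>n. w n t)" for t
  note [measurable] = g(1)[THEN L2_measurable]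
  have wm [measurable]: "w n \<in> borel_measurable borel" for n unfolding w_def by measurable
  have Wm [measurable]: "W \<in> borel_measurable borel" unfolding W_def by (rule borel_measurable_lim_metric) measurable
  have lim: "(\<lambda>n. w n t) \<longlonglongrightarrow> W t" for t
    using conv[of t] unfolding W_def w_def by (simp add: convergent_LIMSEQ_iff)
  have WB: "norm (W t) \<le> B" for t
    by (rule Lim_norm_ubound[OF _ lim]) (use bnd in \<open>auto simp: w_def\<close>)
  \<comment> \<open>The square norm of a difference is at most \<open>4 M\<^sup>2\<close>, so the tail contributes less than \<open>e / 2\<close>.\<close>
  define \<epsilon> where "\<epsilon> = sqrt (e / (4 * (4 * M\<^sup>2 + 1)))"
  have \<epsilon>: "\<epsilon> > 0" "\<epsilon>\<^sup>2 * (4 * M\<^sup>2) < e / 2"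
  proof -
    have p: "4 * (4 * M\<^sup>2 + 1) > 0" by (simp add: add_nonneg_pos)
    show "\<epsilon> > 0" unfolding \<epsilon>_def using e p by (intro real_sqrt_gt_zero divide_pos_pos)
    have "\<epsilon>\<^sup>2 = e / (4 * (4 * M\<^sup>2 + 1))" unfolding \<epsilon>_def using e p by simp
    moreover have "e / (4 * (4 * M\<^sup>2 + 1)) * (4 * M\<^sup>2) < e / (4 * (4 * M\<^sup>2 + 1)) * ((4 * (4 * M\<^sup>2 + 1)) / 2)"
      using e p by (intro mult_strict_left_mono divide_pos_pos) (auto simp: add_nonneg_pos)
    moreover have "e / (4 * (4 * M\<^sup>2 + 1)) * ((4 * (4 * M\<^sup>2 + 1)) / 2) = e / 2" using p by simp
    ultimately show "\<epsilon>\<^sup>2 * (4 * M\<^sup>2) < e / 2" by simp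
  qed
  obtain R where R: "R > 0" "\<And>t. \<bar>t\<bar> > R \<Longrightarrow> v t \<le> \<epsilon>" using v_small[OF \<epsilon>(1)] by blast
  define I where "I n = (LINT t|lborel. indicator {-R..R} t * (norm (w n t - W t))\<^sup>2)" for n
  have dom: "norm (indicator {-R..R} t * (norm (w n t - W t))\<^sup>2) \<le> indicator {-R..R} t * (2 * B)\<^sup>2" for n t
  proof -
    have "norm (w n t - W t) \<le> 2 * B"
      using norm_triangle_ineq4[of "w n t" "W t"] WB[of t] bnd[of t n] by (simp add: w_def)
    then have "(norm (w n t - W t))\<^sup>2 \<le> (2 * B)\<^sup>2" by (intro power_mono) auto
    then show ?thesis by (auto simp: indicator_def)
  qed
  have idom: "integrable lborel (\<lambda>t. indicator {-R..R} t * (2 * B)\<^sup>2)" using R(1) by simp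
  have "I \<longlonglongrightarrow> integral\<^sup>L lborel (\<lambda>t::real. 0 :: real)"
    unfolding I_def
  proof (rule Bochner_Integration.integral_dominated_convergence[where w = "\<lambda>t. indicator {-R..R} t * (2 * B)\<^sup>2"])
    have "(\<lambda>n. indicator {-R..R} t * (norm (w n t - W t))\<^sup>2) \<longlonglongrightarrow> indicator {-R..R} t * (norm (W t - W t))\<^sup>2" for t
      by (intro tendsto_intros lim)
    then show "AE t in lborel. (\<lambda>n. indicator {-R..R} t * (norm (w n t - W t))\<^sup>2) \<longlonglongrightarrow> 0" by simp
  qed (use dom idom in auto)
  then have I0: "I \<longlonglongrightarrow> 0" by simp
  have iI: "integrable lborel (\<lambda>t. indicator {-R..R} t * (norm (w n t - W t))\<^sup>2)" for n
    by (rule Bochner_Integration.integrable_bound[OF idom], measurable, rule AE_I2)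
       (use dom[of _ n] in \<open>simp add: abs_mult\<close>)
  obtain N where N: "\<And>n. n \<ge> N \<Longrightarrow> I n < e / 8"
    using order_tendstoD(2)[OF I0, of "e / 8"] e unfolding eventually_sequentially by auto
  have "(l2norm (\<lambda>t. of_real (v t) * (g m t - g n t)))\<^sup>2 < e" if mn: "m \<ge> N" "n \<ge> N" for m n
  proof -
    let ?d = "\<lambda>t. g m t - g n t"
    have dL: "?d \<in> L2" using g(1) by (rule L2_diff) (rule g(1))
    have le: "(norm (of_real (v t) * ?d t))\<^sup>2 \<le> 2 * (indicator {-R..R} t * (norm (w m t - W t))\<^sup>2)
        + 2 * (indicator {-R..R} t * (norm (w n t - W t))\<^sup>2) + \<epsilon>\<^sup>2 * (norm (?d t))\<^sup>2" for t
    proof (cases "t \<in> {-R..R}")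
      case True
      have "of_real (v t) * ?d t = (w m t - W t) - (w n t - W t)" by (simp add: w_def right_diff_distrib)
      then have "norm (of_real (v t) * ?d t) \<le> norm (w m t - W t) + norm (w n t - W t)"
        using norm_triangle_ineq4 by metis
      then have "(norm (of_real (v t) * ?d t))\<^sup>2 \<le> (norm (w m t - W t) + norm (w n t - W t))\<^sup>2"
        by (intro power_mono) auto
      also have "\<dots> \<le> 2 * (norm (w m t - W t))\<^sup>2 + 2 * (norm (w n t - W t))\<^sup>2"
        using sum_squares_bound[of "norm (w m t - W t)" "norm (w n t - W t)"] by (simp add: power2_sum)
      also have "\<dots> \<le> 2 * (norm (w m t - W t))\<^sup>2 + 2 * (norm (w n t - W t))\<^sup>2 + \<epsilon>\<^sup>2 * (norm (?d t))\<^sup>2" by simp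
      finally show ?thesis using True by simp
    next
      case False
      then have "v t \<le> \<epsilon>" using R(2)[of t] by auto
      then have "(v t)\<^sup>2 \<le> \<epsilon>\<^sup>2" using v_pos[of t] by (intro power_mono) auto
      then have "(v t)\<^sup>2 * (norm (?d t))\<^sup>2 \<le> \<epsilon>\<^sup>2 * (norm (?d t))\<^sup>2" by (rule mult_right_mono) simp
      then show ?thesis using False by (simp add: norm_mult power_mult_distrib)
    qed
    have "(l2norm (\<lambda>t. of_real (v t) * ?d t))\<^sup>2 \<le> (LINT t|lborel. 2 * (indicator {-R..R} t * (norm (w m t - W t))\<^sup>2)
        + 2 * (indicator {-R..R} t * (norm (w n t - W t))\<^sup>2) + \<epsilon>\<^sup>2 * (norm (?d t))\<^sup>2)"
      unfolding l2norm_power2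
    proof (rule integral_mono)
      show "integrable lborel (\<lambda>t. (norm (of_real (v t) * ?d t))\<^sup>2)"
        by (rule L2_integrable[OF v_mult_L2[OF dL]])
      show "integrable lborel (\<lambda>t. 2 * (indicator {-R..R} t * (norm (w m t - W t))\<^sup>2)
        + 2 * (indicator {-R..R} t * (norm (w n t - W t))\<^sup>2) + \<epsilon>\<^sup>2 * (norm (?d t))\<^sup>2)"
        by (intro Bochner_Integration.integrable_add integrable_mult_right iI L2_integrable[OF dL])
    qed (rule le)
    also have "\<dots> = 2 * I m + 2 * I n + \<epsilon>\<^sup>2 * (l2norm ?d)\<^sup>2"
      unfolding I_def l2norm_power2
      using iI L2_integrable[OF dL] by (simp add: Bochner_Integration.integral_add)
    also have "\<epsilon>\<^sup>2 * (l2norm ?d)\<^sup>2 \<le> \<epsilon>\<^sup>2 * (4 * M\<^sup>2)"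
    proof (rule mult_left_mono)
      have "l2norm ?d \<le> 2 * M" using l2norm_triangle4[OF g(1)[of m] g(1)[of n]] g(2)[of m] g(2)[of n] by linarith
      then have "(l2norm ?d)\<^sup>2 \<le> (2 * M)\<^sup>2" by (intro power_mono) auto
      then show "(l2norm ?d)\<^sup>2 \<le> 4 * M\<^sup>2" by (simp add: power_mult_distrib)
    qed simp
    finally show ?thesis using N[OF mn(1)] N[OF mn(2)] \<epsilon>(2) by linarith
  qed
  then show ?thesis by blast
qed

text \<open>The form bound turns a bounded sequence of approximate eigenfunctions for a negative number
  into a sequence \<open>v g\<^sub>n\<close> bounded in \<open>H\<^sup>1\<close>. Because \<open>v\<close> vanishes at infinity, \<open>v g\<^sub>n\<close> has a
  Cauchy subsequence, and the form bound for the differences carries this over to \<open>g\<^sub>n\<close>.\<close>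

lemma approximate_eigenfunctions_compact:
  assumes lam: "\<mu> < 0" and g: "\<And>n. g n \<in> Ck0 K" and gM: "\<And>n. l2norm (g n) \<le> M"
    and lim: "(\<lambda>n. l2norm (\<lambda>t. A (g n) t - of_real \<mu> * g n t)) \<longlonglongrightarrow> 0"
  obtains r :: "nat \<Rightarrow> nat" where "strict_mono r"
    "\<And>e. e > 0 \<Longrightarrow> \<exists>N. \<forall>m\<ge>N. \<forall>n\<ge>N. l2norm (\<lambda>t. g (r m) t - g (r n) t) < e"
proof -
  obtain c1 c2 where c: "c1 > 0" "c2 \<ge> 0"
    "\<And>g. g \<in> Ck0 K \<Longrightarrow> Re (ip (A g) g) \<ge> c1 * (l2norm (nderiv 1 (\<lambda>s. of_real (v s) * g s)))\<^sup>2
      - c2 * (l2norm (\<lambda>s. of_real (v s) * g s))\<^sup>2" using A_form_lower_bound by metis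
  obtain B where B: "B > 0" "\<And>f. f \<in> L2 \<Longrightarrow> l2norm (\<lambda>t. of_real (v t) * f t) \<le> B * l2norm f"
    using v_mult_l2norm_le by blast
  have M0: "M \<ge> 0" using gM[of 0] l2norm_nonneg order_trans by blast
  define \<rho> where "\<rho> f = l2norm (\<lambda>t. A f t - of_real \<mu> * f t)" for f
  have form: "Re (ip (A f) f) \<le> \<rho> f * l2norm f + \<mu> * (l2norm f)\<^sup>2" if "f \<in> Ck0 K" for f
  proof -
    have L: "f \<in> L2" "A f \<in> L2" "(\<lambda>t. A f t - of_real \<mu> * f t) \<in> L2" "(\<lambda>t. of_real \<mu> * f t) \<in> L2"
      using that Ck0_L2 A_L2 shifted_L2 L2_cmult by auto
    have "ip (A f) f = ip (\<lambda>t. A f t - of_real \<mu> * f t) f + of_real (\<mu> * (l2norm f)\<^sup>2)"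
      using ip_add_left[OF L(3,4,1)] by (simp add: ip_cmult_left ip_self)
    then have "Re (ip (A f) f) = Re (ip (\<lambda>t. A f t - of_real \<mu> * f t) f) + \<mu> * (l2norm f)\<^sup>2" by simp
    also have "Re (ip (\<lambda>t. A f t - of_real \<mu> * f t) f) \<le> \<rho> f * l2norm f"
      unfolding \<rho>_def using ip_cauchy_schwarz[OF L(3,1)] complex_Re_le_cmod order_trans by blast
    finally show ?thesis by simp
  qed
  obtain E where E: "\<And>n. \<rho> (g n) \<le> E"
  proof -
    have "Bseq (\<lambda>n. \<rho> (g n))" using lim unfolding \<rho>_def by (intro convergent_imp_Bseq convergentI)
    then show ?thesis using that unfolding Bseq_def by (metis abs_le_D1 real_norm_def)
  qed
  have E0: "E \<ge> 0" using E[of 0] unfolding \<rho>_def using l2norm_nonneg order_trans by blast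
  define w where "w n t = of_real (v t) * g n t" for n t
  have w0: "w n \<in> Ck0 K" for n unfolding w_def[abs_def] by (rule v_mult_Ck0[OF g])
  have w1: "w n \<in> Ck0 1" for n using nderiv_in_Ck0[OF w0, of 0 1] deg_ge_2 by simp
  have wn: "l2norm (w n) \<le> B * M" for n
    using order_trans[OF B(2)[OF Ck0_L2[OF g], of n] mult_left_mono[OF gM[of n], of B]] B(1)
    unfolding w_def[abs_def] by simp
  define P where "P = sqrt ((E * M + c2 * (B * M)\<^sup>2) / c1)"
  have wd: "l2norm (nderiv 1 (w n)) \<le> P" for n
  proof -
    have "c1 * (l2norm (nderiv 1 (w n)))\<^sup>2 \<le> Re (ip (A (g n)) (g n)) + c2 * (l2norm (w n))\<^sup>2"
      using c(3)[OF g, of n] unfolding w_def[abs_def] by simp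
    also have "\<dots> \<le> (\<rho> (g n) * l2norm (g n) + \<mu> * (l2norm (g n))\<^sup>2) + c2 * (B * M)\<^sup>2"
      using form[OF g] wn c(2) by (intro add_mono mult_left_mono power_mono) auto
    also have "\<rho> (g n) * l2norm (g n) \<le> E * M"
      using E gM E0 by (intro mult_mono) auto
    also have "\<mu> * (l2norm (g n))\<^sup>2 \<le> 0" using lam by (simp add: mult_nonpos_nonneg)
    finally have "(l2norm (nderiv 1 (w n)))\<^sup>2 \<le> (E * M + c2 * (B * M)\<^sup>2) / c1"
      using c(1) by (simp add: pos_le_divide_eq mult.commute)
    then show ?thesis unfolding P_def by (simp add: real_le_rsqrt)
  qed
  have P0: "P \<ge> 0" using wd[of 0] l2norm_nonneg order_trans by blast
  define S where "S = sqrt (2 * (B * M) * P)"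
  have wS: "norm (w n t) \<le> S" for n t
  proof -
    have "(norm (w n t))\<^sup>2 \<le> 2 * l2norm (w n) * l2norm (nderiv 1 (w n))" by (rule Ck0_sup_bound[OF w1])
    also have "\<dots> \<le> 2 * (B * M) * P" using wn wd B(1) M0 by (intro mult_mono) auto
    finally show ?thesis unfolding S_def by (simp add: real_le_rsqrt)
  qed
  have wH: "norm (w n y - w n x) \<le> P * sqrt \<bar>y - x\<bar>" for n x y
    using Ck0_holder[OF w1, of n y x] wd[of n] mult_right_mono[OF wd[of n], of "sqrt \<bar>y - x\<bar>"] by simp
  obtain r :: "nat \<Rightarrow> nat" where r: "strict_mono r" "\<And>t. convergent (\<lambda>n. w (r n) t)"
    using equicontinuous_pointwise_subsequence[of w S P] wS wH by blast
  have "\<exists>N. \<forall>m\<ge>N. \<forall>n\<ge>N. l2norm (\<lambda>t. g (r m) t - g (r n) t) < e" if e: "e > 0" for e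
  proof -
    define a where "a = - \<mu> * e\<^sup>2"
    have a: "a > 0" unfolding a_def using lam e by (simp add: mult_neg_pos)
    have "a / (2 * (c2 + 1)) > 0" using a c(2) by simp
    then obtain N1 where N1: "\<And>m n. m \<ge> N1 \<Longrightarrow> n \<ge> N1 \<Longrightarrow>
        (l2norm (\<lambda>t. of_real (v t) * (g (r m) t - g (r n) t)))\<^sup>2 < a / (2 * (c2 + 1))"
      using weighted_cauchy[of "\<lambda>n. g (r n)" M S "a / (2 * (c2 + 1))"] g gM Ck0_L2 wS r(2)
      unfolding w_def by metis
    define b where "b = a / (8 * (M + 1))"
    have b: "b > 0" unfolding b_def using a M0 by simp
    have "(\<lambda>n. \<rho> (g (r n))) \<longlonglongrightarrow> 0"
      using LIMSEQ_subseq_LIMSEQ[OF lim r(1)] unfolding \<rho>_def by (simp add: o_def)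
    from order_tendstoD(2)[OF this b] obtain N2 where N2: "\<And>n. n \<ge> N2 \<Longrightarrow> \<rho> (g (r n)) < b"
      unfolding eventually_sequentially by blast
    have "l2norm (\<lambda>t. g (r m) t - g (r n) t) < e" if mn: "m \<ge> max N1 N2" "n \<ge> max N1 N2" for m n
    proof -
      let ?d = "\<lambda>t. g (r m) t - g (r n) t"
      have dC: "?d \<in> Ck0 K" by (rule Ck0_diff[OF g g])
      have dM: "l2norm ?d \<le> 2 * M"
        using l2norm_triangle4[OF Ck0_L2[OF g] Ck0_L2[OF g], of "r m" "r n"] gM[of "r m"] gM[of "r n"] by linarith
      have "\<rho> ?d \<le> \<rho> (g (r m)) + \<rho> (g (r n))"
        unfolding \<rho>_def A_diff[OF g g]
        using l2norm_triangle4[OF shifted_L2[OF g[of "r m"], where z = "of_real \<mu>"] shifted_L2[OF g[of "r n"], where z = "of_real \<mu>"]]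
        by (simp add: algebra_simps)
      then have \<rho>d: "\<rho> ?d \<le> 2 * b" using N2[of m] N2[of n] mn by simp
      have "- c2 * (l2norm (\<lambda>s. of_real (v s) * ?d s))\<^sup>2 \<le> Re (ip (A ?d) ?d)"
        using c(3)[OF dC] c(1) by (smt (verit) mult_nonneg_nonneg zero_le_power2 mult_minus_left)
      then have "- \<mu> * (l2norm ?d)\<^sup>2 \<le> \<rho> ?d * l2norm ?d + c2 * (l2norm (\<lambda>s. of_real (v s) * ?d s))\<^sup>2"
        using form[OF dC] by simp
      also have "\<rho> ?d * l2norm ?d \<le> (2 * b) * (2 * M)"
        using \<rho>d dM b by (intro mult_mono) auto
      also have "(2 * b) * (2 * M) \<le> a / 2" unfolding b_def using a M0 by (simp add: field_simps)
      also have "c2 * (l2norm (\<lambda>s. of_real (v s) * ?d s))\<^sup>2 \<le> c2 * (a / (2 * (c2 + 1)))"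
        using N1[of m n] mn c(2) by (intro mult_left_mono) auto
      also have "c2 * (a / (2 * (c2 + 1))) < a / 2" using a c(2) by (simp add: field_simps)
      finally have "- \<mu> * (l2norm ?d)\<^sup>2 < - \<mu> * e\<^sup>2" unfolding a_def by simp
      then have "(l2norm ?d)\<^sup>2 < e\<^sup>2" using lam by (simp add: mult_less_cancel_left)
      then show ?thesis using e by (simp add: power_less_imp_less_base)
    qed
    then show ?thesis by blast
  qed
  then show ?thesis using that r(1) by blast
qed

end


section \<open>Weak solutions of ordinary differential equations\<close>

definition loc_int :: "(real \<Rightarrow> complex) \<Rightarrow> bool" where
  "loc_int F \<longleftrightarrow> F \<in> borel_measurable borel \<and> (\<forall>R. set_integrable lborel {-R..R} F)"

text \<open>The primitive vanishing at the origin, written with a kernel so that Fubini's theorem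
  applies to it.\<close>

definition prim_kernel :: "real \<Rightarrow> real \<Rightarrow> real" where
  "prim_kernel x t = (if 0 \<le> t \<and> t \<le> x then 1 else 0) - (if x \<le> t \<and> t \<le> 0 then 1 else 0)"

definition prim :: "(real \<Rightarrow> complex) \<Rightarrow> real \<Rightarrow> complex" where
  "prim F x = (LINT t|lborel. prim_kernel x t *\<^sub>R F t)"

lemma loc_int_measurable: "loc_int F \<Longrightarrow> F \<in> borel_measurable borel"
  by (simp add: loc_int_def)

lemma loc_int_integrable_Icc:
  assumes "loc_int F" shows "set_integrable lborel {a..b} F"
proof -
  have "set_integrable lborel {-(\<bar>a\<bar> + \<bar>b\<bar>)..\<bar>a\<bar> + \<bar>b\<bar>} F" using assms unfolding loc_int_def by blast
  then show ?thesis by (rule set_integrable_subset) auto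
qed

lemma loc_int_continuous: "continuous_on UNIV F \<Longrightarrow> loc_int F"
  unfolding loc_int_def
  by (auto intro!: borel_measurable_continuous_onI borel_integrable_atLeastAtMost' intro: continuous_on_subset)

lemma loc_int_diff:
  assumes "loc_int F" "loc_int G" shows "loc_int (\<lambda>t. F t - G t)"
  using assms unfolding loc_int_def by (auto intro: set_integral_diff)

lemma loc_int_mult_compact:
  assumes F: "loc_int F" and h: "continuous_on UNIV h" and R: "\<And>t. \<bar>t\<bar> > R \<Longrightarrow> h t = 0"
  shows "integrable lborel (\<lambda>t. h t * F t)"
proof -
  have "h \<in> Ck0 0" unfolding Ck0_iff Ck_0 using h R by blast
  then obtain B where B: "B > 0" "\<And>t. norm (h t) \<le> B" by (rule Ck0_bounded) blast
  note [measurable] = loc_int_measurable[OF F] borel_measurable_continuous_onI[OF h]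
  have i: "integrable lborel (\<lambda>t. B * norm (indicator {-R..R} t *\<^sub>R F t))"
    using F unfolding loc_int_def set_integrable_def by (intro integrable_mult_right integrable_norm) simp
  show ?thesis
  proof (rule Bochner_Integration.integrable_bound[OF i], measurable, rule AE_I2)
    fix t show "norm (h t * F t) \<le> norm (B * norm (indicator {-R..R} t *\<^sub>R F t))"
    proof (cases "\<bar>t\<bar> > R")
      case False
      then have "t \<in> {-R..R}" by auto
      then show ?thesis using B by (simp add: norm_mult mult_right_mono)
    qed (simp add: R)
  qed
qed

lemma loc_int_mult_continuous:
  assumes F: "loc_int F" and h: "continuous_on UNIV h"
  shows "loc_int (\<lambda>t. h t * F t)"
  unfolding loc_int_def
proof (intro conjI allI)
  note [measurable] = loc_int_measurable[OF F] borel_measurable_continuous_onI[OF h]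
  show "(\<lambda>t. h t * F t) \<in> borel_measurable borel" by measurable
  fix R :: real
  have "bounded (h ` {-R..R})"
    by (intro compact_imp_bounded compact_continuous_image continuous_on_subset[OF h]) auto
  then obtain B where B: "\<And>t. t \<in> {-R..R} \<Longrightarrow> norm (h t) \<le> B" unfolding bounded_iff by blast
  have i: "integrable lborel (\<lambda>t. B * norm (indicator {-R..R} t *\<^sub>R F t))"
    using F unfolding loc_int_def set_integrable_def by (intro integrable_mult_right integrable_norm) simp
  show "set_integrable lborel {-R..R} (\<lambda>t. h t * F t)"
    unfolding set_integrable_def
  proof (rule Bochner_Integration.integrable_bound[OF i], measurable, rule AE_I2)
    fix t show "norm (indicator {-R..R} t *\<^sub>R (h t * F t)) \<le> norm (B * norm (indicator {-R..R} t *\<^sub>R F t))"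
    proof (cases "t \<in> {-R..R}")
      case True
      then have "norm (h t) \<le> \<bar>B\<bar>" using B[OF True] by linarith
      then show ?thesis using True by (simp add: norm_mult abs_mult mult_right_mono)
    qed simp
  qed
qed

lemma L2_loc_int:
  assumes "f \<in> L2" shows "loc_int f"
  unfolding loc_int_def
proof (intro conjI allI)
  note [measurable] = L2_measurable[OF assms]
  show "f \<in> borel_measurable borel" by simp
  fix R :: real
  have i: "integrable lborel (\<lambda>t. indicator {-R..R} t + (norm (f t))\<^sup>2)"
    using L2_integrable[OF assms]
    by (intro Bochner_Integration.integrable_add integrable_real_indicator) (auto simp: emeasure_lborel_Icc_eq)
  show "set_integrable lborel {-R..R} f"
    unfolding set_integrable_def
  proof (rule Bochner_Integration.integrable_bound[OF i], measurable, rule AE_I2)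
    fix t
    have "norm (f t) \<le> 1 + (norm (f t))\<^sup>2"
      using sum_squares_bound[of "norm (f t)" 1] by (simp add: power2_eq_square)
         (smt (verit) mult_nonneg_nonneg norm_ge_zero)
    then show "norm (indicator {-R..R} t *\<^sub>R f t) \<le> norm (indicator {-R..R} t + (norm (f t))\<^sup>2)"
      by (auto simp: indicator_def)
  qed
qed

lemma prim_eq_integral:
  assumes F: "loc_int F"
  shows "prim F x = integral {0..x} F - integral {x..0} F"
proof -
  have k: "prim_kernel x t *\<^sub>R F t = indicator {0..x} t *\<^sub>R F t - indicator {x..0} t *\<^sub>R F t" for t
    by (auto simp: prim_kernel_def indicator_def)
  have "prim F x = (LINT t:{0..x}|lborel. F t) - (LINT t:{x..0}|lborel. F t)"
    unfolding prim_def k set_lebesgue_integral_def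
    using loc_int_integrable_Icc[OF F] unfolding set_integrable_def
    by (intro Bochner_Integration.integral_diff) auto
  then show ?thesis using set_borel_integral_eq_integral(2)[OF loc_int_integrable_Icc[OF F]] by simp
qed

lemma prim_eq_integral_shifted:
  assumes F: "loc_int F" and R: "R > 0" "-R \<le> x"
  shows "prim F x = integral {-R..x} F - integral {-R..0} F"
proof -
  have i: "F integrable_on {a..b}" for a b
    using set_borel_integral_eq_integral(1)[OF loc_int_integrable_Icc[OF F]] .
  show ?thesis
  proof (cases "x \<ge> 0")
    case True
    have "integral {-R..0} F + integral {0..x} F = integral {-R..x} F"
      using True R i by (intro Henstock_Kurzweil_Integration.integral_combine) auto
    moreover have "integral {x..0} F = 0" using True by (cases "x = 0") auto
    ultimately show ?thesis unfolding prim_eq_integral[OF F] by (simp add: algebra_simps)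
  next
    case False
    have "integral {-R..x} F + integral {x..0} F = integral {-R..0} F"
      using False R i by (intro Henstock_Kurzweil_Integration.integral_combine) auto
    moreover have "integral {0..x} F = 0" using False by auto
    ultimately show ?thesis unfolding prim_eq_integral[OF F] by (simp add: algebra_simps)
  qed
qed

lemma prim_continuous:
  assumes F: "loc_int F" shows "continuous_on UNIV (prim F)"
proof (rule continuous_at_imp_continuous_on, rule ballI)
  fix x :: real
  define R where "R = \<bar>x\<bar> + 1"
  have R: "R > 0" "x \<in> {-R<..<R}" by (auto simp: R_def)
  have "continuous_on {-R..R} (\<lambda>y. integral {-R..y} F - integral {-R..0} F)"
    using set_borel_integral_eq_integral(1)[OF loc_int_integrable_Icc[OF F]]
    by (intro continuous_intros indefinite_integral_continuous_1)
  then have "continuous_on {-R..R} (prim F)"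
    by (rule continuous_on_eq) (use prim_eq_integral_shifted[OF F R(1)] in auto)
  then have "continuous_on {-R<..<R} (prim F)" by (rule continuous_on_subset) auto
  then show "isCont (prim F) x" using R(2) by (simp add: continuous_on_eq_continuous_at)
qed

lemma prim_has_vector_derivative:
  assumes F: "continuous_on UNIV F"
  shows "(prim F has_vector_derivative F x) (at x)"
proof -
  define R where "R = \<bar>x\<bar> + 1"
  have R: "R > 0" "x \<in> {-R<..<R}" by (auto simp: R_def)
  have "((\<lambda>y. integral {-R..y} F) has_vector_derivative F x) (at x within {-R..R})"
    using R by (intro integral_has_vector_derivative continuous_on_subset[OF F]) auto
  then have "((\<lambda>y. integral {-R..y} F - integral {-R..0} F) has_vector_derivative F x) (at x within {-R..R})"
    by (auto intro!: derivative_eq_intros)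
  then have "((\<lambda>y. integral {-R..y} F - integral {-R..0} F) has_vector_derivative F x) (at x within {-R<..<R})"
    by (rule has_vector_derivative_within_subset) auto
  then have "((\<lambda>y. integral {-R..y} F - integral {-R..0} F) has_vector_derivative F x) (at x)"
    using at_within_open[OF R(2) open_greaterThanLessThan] by simp
  then show ?thesis
    by (rule has_vector_derivative_transform_within_open[of _ _ _ "{-R<..<R}"])
       (use R prim_eq_integral_shifted[OF loc_int_continuous[OF F] R(1)] in auto)
qed

lemma prim_Ck: "F \<in> Ck j \<Longrightarrow> prim F \<in> Ck (Suc j)"
  by (rule Ck_SucI[OF prim_has_vector_derivative]) (auto intro: Ck_continuous)

lemma prim_cong_AE:
  assumes "loc_int F" "loc_int G" "AE t in lborel. F t = G t"
  shows "prim F = prim G"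
proof
  fix x
  note [measurable] = assms(1,2)[THEN loc_int_measurable]
  have [measurable]: "prim_kernel x \<in> borel_measurable borel" unfolding prim_kernel_def[abs_def] by measurable
  show "prim F x = prim G x" unfolding prim_def
    by (rule integral_cong_AE, measurable, measurable) (use assms(3) in auto)
qed

lemma integral_prim_kernel:
  fixes \<phi> :: "real \<Rightarrow> complex"
  assumes \<phi>: "\<phi> \<in> Ck0 1" and t: "t \<noteq> 0"
  shows "(LINT s|lborel. prim_kernel s t *\<^sub>R nderiv 1 \<phi> s) = - \<phi> t"
proof -
  obtain R where R: "\<And>t. \<bar>t\<bar> > R \<Longrightarrow> \<phi> t = 0" using \<phi> unfolding Ck0_iff by blast
  define S where "S = \<bar>R\<bar> + \<bar>t\<bar> + 1"
  have z: "nderiv 1 \<phi> s = 0" if "\<bar>s\<bar> > S" for s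
    by (rule nderiv_zero_outside[OF R]) (use that in \<open>auto simp: S_def\<close>)
  have \<phi>S: "\<phi> S = 0" "\<phi> (-S) = 0" using R[of S] R[of "-S"] by (auto simp: S_def)
  have tS: "-S \<le> t" "t \<le> S" by (auto simp: S_def)
  have FTC: "(LINT s|lborel. indicator {x..y} s * nderiv 1 \<phi> s) = \<phi> y - \<phi> x" if "x \<le> y" for x y
    by (rule Ck0_interval_integral[OF Ck0_Ck[OF \<phi>] that])
  show ?thesis
  proof (cases "t > 0")
    case True
    have "prim_kernel s t *\<^sub>R nderiv 1 \<phi> s = indicator {t..S} s * nderiv 1 \<phi> s" for s
      using z[of s] True by (cases "s > S") (auto simp: prim_kernel_def indicator_def)
    then show ?thesis using FTC[OF tS(2)] \<phi>S by simp
  next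
    case False
    have "prim_kernel s t *\<^sub>R nderiv 1 \<phi> s = - (indicator {-S..t} s * nderiv 1 \<phi> s)" for s
      using z[of s] False t by (cases "s < - S") (auto simp: prim_kernel_def indicator_def)
    then show ?thesis using FTC[OF tS(1)] \<phi>S by simp
  qed
qed

text \<open>Fubini's theorem takes the place of the product rule, since the primitive of a locally integrable
  function need not be differentiable everywhere.\<close>

lemma integration_by_parts_prim:
  assumes F: "loc_int F" and \<phi>: "\<phi> \<in> Ck0 1"
  shows "(LINT t|lborel. \<phi> t * F t) = - (LINT t|lborel. nderiv 1 \<phi> t * prim F t)"
proof -
  obtain R where R: "\<And>t. \<bar>t\<bar> > R \<Longrightarrow> \<phi> t = 0" using \<phi> unfolding Ck0_iff by blast
  define S where "S = \<bar>R\<bar> + 1"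
  have z: "nderiv 1 \<phi> s = 0" if "\<bar>s\<bar> > S" for s
    by (rule nderiv_zero_outside[OF R]) (use that in \<open>auto simp: S_def\<close>)
  have dc: "continuous_on UNIV (nderiv 1 \<phi>)" using Ck_continuous_nderiv[OF Ck0_Ck[OF \<phi>]] by simp
  note [measurable] = loc_int_measurable[OF F] borel_measurable_continuous_onI[OF dc]
  have [measurable]: "(\<lambda>p. prim_kernel (fst p) (snd p)) \<in> borel_measurable (lborel \<Otimes>\<^sub>M lborel)"
    unfolding prim_kernel_def[abs_def] by measurable
  define f where "f = (\<lambda>(s, t). prim_kernel s t *\<^sub>R (nderiv 1 \<phi> s * F t))"
  have fm [measurable]: "f \<in> borel_measurable (lborel \<Otimes>\<^sub>M lborel)"
    unfolding f_def split_beta' by measurable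
  have FS: "integrable lborel (\<lambda>t. norm (indicator {-S..S} t *\<^sub>R F t))"
    using F unfolding loc_int_def set_integrable_def by (intro integrable_norm) simp
  have fb: "norm (f (s, t)) \<le> norm (nderiv 1 \<phi> s) * norm (indicator {-S..S} t *\<^sub>R F t)" for s t
  proof (cases "\<bar>s\<bar> > S")
    case False
    then show ?thesis unfolding f_def by (auto simp: prim_kernel_def indicator_def norm_mult)
  qed (simp add: f_def z[unfolded One_nat_def])
  have i2: "integrable lborel (\<lambda>t. f (s, t))" for s
  proof (rule Bochner_Integration.integrable_bound[OF integrable_mult_right[OF FS, of "norm (nderiv 1 \<phi> s)"]])
    show "(\<lambda>t. f (s, t)) \<in> borel_measurable lborel" by measurable
  qed (use fb in auto)
  define J where "J = (LINT t|lborel. norm (indicator {-S..S} t *\<^sub>R F t))"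
  have i1: "integrable lborel (\<lambda>s. LINT t|lborel. norm (f (s, t)))"
  proof (rule Bochner_Integration.integrable_bound)
    show "integrable lborel (\<lambda>s. norm (nderiv 1 \<phi> s) * J)"
      using Ck0_integrable[OF nderiv_in_Ck0[OF \<phi>, of 1 0]] by (intro integrable_mult_left integrable_norm) simp
    show "(\<lambda>s. LINT t|lborel. norm (f (s, t))) \<in> borel_measurable lborel" by measurable
    show "AE s in lborel. norm (LINT t|lborel. norm (f (s, t))) \<le> norm (norm (nderiv 1 \<phi> s) * J)"
    proof (rule AE_I2)
      fix s
      have "(LINT t|lborel. norm (f (s, t))) \<le> (LINT t|lborel. norm (nderiv 1 \<phi> s) * norm (indicator {-S..S} t *\<^sub>R F t))"
        by (rule integral_mono[OF integrable_norm[OF i2] integrable_mult_right[OF FS] fb])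
      also have "\<dots> = norm (nderiv 1 \<phi> s) * J" unfolding J_def by simp
      finally show "norm (LINT t|lborel. norm (f (s, t))) \<le> norm (norm (nderiv 1 \<phi> s) * J)" by simp
    qed
  qed
  have fi: "integrable (lborel \<Otimes>\<^sub>M lborel) f"
    by (rule lborel_pair.Fubini_integrable[OF fm i1]) (use i2 in auto)
  have "(LINT t|lborel. nderiv 1 \<phi> t * prim F t) = (LINT s|lborel. LINT t|lborel. f (s, t))"
  proof (rule Bochner_Integration.integral_cong[OF refl])
    fix s
    show "nderiv 1 \<phi> s * prim F s = (LINT t|lborel. f (s, t))"
      unfolding f_def prod.case mult_scaleR_right[symmetric] prim_def by (rule integral_mult_right_zero[symmetric])
  qed
  also have "\<dots> = (LINT t|lborel. LINT s|lborel. f (s, t))"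
    using lborel_pair.Fubini_integral[OF fi[unfolded f_def]] unfolding f_def by simp
  also have "\<dots> = (LINT t|lborel. - (\<phi> t * F t))"
  proof (rule integral_cong_AE)
    show "(\<lambda>t. LINT s|lborel. f (s, t)) \<in> borel_measurable lborel" by measurable
    have [measurable]: "\<phi> \<in> borel_measurable borel"
      by (rule borel_measurable_continuous_onI[OF Ck_continuous[OF Ck0_Ck[OF \<phi>]]])
    show "(\<lambda>t. - (\<phi> t * F t)) \<in> borel_measurable lborel" by measurable
    have "AE t in lborel. t \<noteq> (0::real)" by (rule AE_lborel_singleton)
    then show "AE t in lborel. (LINT s|lborel. f (s, t)) = - (\<phi> t * F t)"
    proof eventually_elim
      case (elim t)
      have "(LINT s|lborel. f (s, t)) = (LINT s|lborel. (prim_kernel s t *\<^sub>R nderiv 1 \<phi> s) * F t)"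
        unfolding f_def by simp
      also have "\<dots> = (LINT s|lborel. prim_kernel s t *\<^sub>R nderiv 1 \<phi> s) * F t" by (rule integral_mult_left_zero)
      also have "\<dots> = - (\<phi> t * F t)" using integral_prim_kernel[OF \<phi> elim] by simp
      finally show ?case .
    qed
  qed
  finally show ?thesis by simp
qed

text \<open>The integral over an open bounded set is a limit of integrals against continuous functions;
  open sets generate the Borel sets, so all integrals over Borel sets vanish.\<close>

lemma fundamental_lemma:
  assumes F: "loc_int F" and orth: "\<And>\<phi>. \<phi> \<in> Ck0 0 \<Longrightarrow> (LINT t|lborel. \<phi> t * F t) = 0"
  shows "AE t in lborel. F t = 0"
proof -
  note [measurable] = loc_int_measurable[OF F]
  have open0: "(LINT t|lborel. indicator V t *\<^sub>R F t) = 0" if V: "open V" "V \<subseteq> {-R<..<R}" for V R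
  proof -
    define h where "h n t = min 1 (real n * infdist t (- V))" for n :: nat and t
    have ne: "- V \<noteq> {}" using V(2) by (metis Compl_empty_eq double_compl not_bounded_UNIV bounded_subset bounded_Ioo)
    have hc: "continuous_on UNIV (h n)" for n unfolding h_def by (intro continuous_intros)
    have h0: "h n t = 0" if "t \<notin> V" for n t unfolding h_def using that by simp
    have h01: "0 \<le> h n t" "h n t \<le> 1" for n t unfolding h_def by (auto simp: infdist_nonneg)
    have hC: "(\<lambda>t. of_real (h n t) :: complex) \<in> Ck0 0" for n
      unfolding Ck0_iff Ck_0
    proof (intro conjI exI[of _ "\<bar>R\<bar>"] allI impI)
      show "continuous_on UNIV (\<lambda>t. of_real (h n t) :: complex)" by (intro continuous_intros hc)
      fix t assume "\<bar>t\<bar> > \<bar>R\<bar>"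
      then have "\<not> (- R < t \<and> t < R)" by linarith
      then have "t \<notin> V" using V(2) by auto
      then show "of_real (h n t) = (0::complex)" by (simp add: h0)
    qed
    have lim: "(\<lambda>n. h n t) \<longlonglongrightarrow> indicator V t" for t
    proof (cases "t \<in> V")
      case True
      have "infdist t (- V) \<noteq> 0"
        using in_closed_iff_infdist_zero[of "- V" t] V(1) ne True by auto
      then have d: "infdist t (- V) > 0" using infdist_nonneg[of t "- V"] by linarith
      obtain N :: nat where N: "1 / infdist t (- V) < real N" using reals_Archimedean2 by blast
      have "h n t = 1" if "n \<ge> N" for n
      proof -
        have "1 / infdist t (- V) \<le> real n" using N that by linarith
        then show ?thesis unfolding h_def using d by (simp add: pos_divide_le_eq min_def)
      qed
      then have "eventually (\<lambda>n. h n t = 1) sequentially" unfolding eventually_sequentially by blast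
      then show ?thesis using True by (simp add: tendsto_eventually)
    qed (simp add: h0)
    have w: "integrable lborel (\<lambda>t. norm (indicator {-R..R} t *\<^sub>R F t))"
      using F unfolding loc_int_def set_integrable_def by (intro integrable_norm) simp
    have [measurable]: "h n \<in> borel_measurable borel" for n by (rule borel_measurable_continuous_onI[OF hc])
    have [measurable]: "V \<in> sets borel" using V(1) by simp
    have "(\<lambda>n. LINT t|lborel. of_real (h n t) * F t) \<longlonglongrightarrow> (LINT t|lborel. indicator V t *\<^sub>R F t)"
    proof (rule integral_dominated_convergence[OF _ _ w])
      show "AE t in lborel. (\<lambda>n. of_real (h n t) * F t) \<longlonglongrightarrow> indicator V t *\<^sub>R F t"
        unfolding scaleR_conv_of_real by (intro AE_I2 tendsto_intros lim)
      show "AE t in lborel. norm (of_real (h n t) * F t) \<le> norm (indicator {-R..R} t *\<^sub>R F t)" for n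
      proof (rule AE_I2)
        fix t show "norm (of_real (h n t) * F t) \<le> norm (indicator {-R..R} t *\<^sub>R F t)"
        proof (cases "t \<in> V")
          case True
          then have "t \<in> {-R..R}" using V(2) by auto
          then show ?thesis using h01[of n t] by (simp add: norm_mult mult_left_le_one_le)
        qed (simp add: h0)
      qed
    qed measurable
    moreover have "(\<lambda>n. LINT t|lborel. of_real (h n t) * F t) = (\<lambda>n. 0)"
      using orth[OF hC] by simp
    ultimately show ?thesis by (metis LIMSEQ_const_iff)
  qed
  have "AE t in lborel. indicator {-real n<..<real n} t *\<^sub>R F t = 0" for n :: nat
  proof -
    let ?f = "\<lambda>t. indicator {-real n<..<real n} t *\<^sub>R F t"
    have fi: "integrable lborel ?f"
    proof -
      have "set_integrable lborel {-real n<..<real n} F"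
        by (rule set_integrable_subset[OF loc_int_integrable_Icc[OF F, of "-real n" "real n"]]) auto
      then show ?thesis unfolding set_integrable_def .
    qed
    show ?thesis
    proof (rule sigma_finite_measure.density_zero[OF sigma_finite_lborel fi])
      fix A :: "real set" assume "A \<in> sets lborel"
      then have A: "A \<in> sigma_sets UNIV {S::real set. open S}" by (simp add: borel_def)
      have si: "set_integrable lborel B ?f" if "B \<in> sets borel" for B
        unfolding set_integrable_def by (rule integrable_mult_indicator[OF _ fi]) (use that in simp)
      have bs: "B \<in> sets borel" if "B \<in> sigma_sets UNIV {S::real set. open S}" for B
        using that by (simp add: borel_def)
      have Is: "Int_stable {S::real set. open S}" by (auto simp: Int_stable_def)
      show "(LINT t:A|lborel. ?f t) = 0"
      proof (rule sigma_sets_induct_disjoint[OF Is _ A])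
        show "{S::real set. open S} \<subseteq> Pow UNIV" by simp
      next
        fix B :: "real set" assume "B \<in> {S. open S}"
        then have "(LINT t|lborel. indicator (B \<inter> {-real n<..<real n}) t *\<^sub>R F t) = 0"
          by (intro open0[of _ "real n"]) auto
        then show "(LINT t:B|lborel. ?f t) = 0"
          unfolding set_lebesgue_integral_def by (simp add: indicator_inter_arith)
      next
        show "(LINT t:{}|lborel. ?f t) = 0" by (simp add: set_lebesgue_integral_def)
      next
        fix B assume B: "B \<in> sigma_sets UNIV {S::real set. open S}" and IH: "(LINT t:B|lborel. ?f t) = 0"
        have all0: "(LINT t|lborel. ?f t) = 0" by (rule open0[of _ "real n"]) auto
        have "(LINT t:(UNIV - B)|lborel. ?f t) = (LINT t|lborel. ?f t - indicator B t *\<^sub>R ?f t)"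
          unfolding set_lebesgue_integral_def
          by (intro Bochner_Integration.integral_cong) (auto simp: indicator_def)
        also have "\<dots> = (LINT t|lborel. ?f t) - (LINT t:B|lborel. ?f t)"
          unfolding set_lebesgue_integral_def
          using fi si[OF bs[OF B]] unfolding set_integrable_def by (rule Bochner_Integration.integral_diff)
        finally show "(LINT t:(UNIV - B)|lborel. ?f t) = 0" using all0 IH by simp
      next
        fix B :: "nat \<Rightarrow> real set"
        assume B: "disjoint_family B" "range B \<subseteq> sigma_sets UNIV {S. open S}" "\<And>i. (LINT t:B i|lborel. ?f t) = 0"
        have Bi: "B i \<in> sets borel" for i using B(2) bs by blast
        have "(LINT t:(\<Union>i. B i)|lborel. ?f t) = (\<Sum>i. (LINT t:B i|lborel. ?f t))"
          using B(1) Bi si[of "\<Union>i. B i"]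
          by (intro lebesgue_integral_countable_add) (auto simp: disjoint_family_on_def)
        then show "(LINT t:(\<Union>i. B i)|lborel. ?f t) = 0" using B(3) by simp
      qed
    qed
  qed
  then have "AE t in lborel. \<forall>n::nat. indicator {-real n<..<real n} t *\<^sub>R F t = 0"
    unfolding AE_all_countable by blast
  then show ?thesis
  proof eventually_elim
    case (elim t)
    obtain n :: nat where "\<bar>t\<bar> < real n" using reals_Archimedean2 by blast
    then have "t \<in> {-real n<..<real n}" by auto
    then show ?case using elim[rule_format, of n] by simp
  qed
qed

lemma Ck0_primitive:
  assumes u: "u \<in> Ck0 k" and int0: "(LINT t|lborel. u t) = (0::complex)"
  obtains \<phi> where "\<phi> \<in> Ck0 (Suc k)" "nderiv 1 \<phi> = u"
proof -
  obtain R where R: "\<And>t. \<bar>t\<bar> > R \<Longrightarrow> u t = 0" using u unfolding Ck0_iff by blast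
  define S where "S = \<bar>R\<bar> + 1"
  have z: "u s = 0" if "\<bar>s\<bar> \<ge> S" for s using R[of s] that by (auto simp: S_def)
  have uc: "continuous_on UNIV u" by (rule Ck_continuous[OF Ck0_Ck[OF u]])
  define \<phi> where "\<phi> x = prim u x - prim u (-S)" for x
  have d: "(\<phi> has_vector_derivative u x) (at x)" for x
    unfolding \<phi>_def[abs_def] using prim_has_vector_derivative[OF uc, of x] by (auto intro!: derivative_eq_intros)
  have \<phi>C: "\<phi> \<in> Ck (Suc k)" by (rule Ck_SucI[OF d Ck0_Ck[OF u]])
  have D: "nderiv 1 \<phi> = u" using nderiv_1_eq[OF d] by simp
  have FTC: "(LINT s|lborel. indicator {x..y} s * u s) = \<phi> y - \<phi> x" if "x \<le> y" for x y
    using Ck0_interval_integral[OF Ck_mono[OF \<phi>C] that] unfolding D by simp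
  have \<phi>S: "\<phi> (-S) = 0" by (simp add: \<phi>_def)
  have "\<phi> x = 0" if "\<bar>x\<bar> > S" for x
  proof (cases "x > S")
    case True
    have "(\<lambda>s. indicator {-S..x} s * u s) = u"
    proof
      show "indicator {-S..x} s * u s = u s" for s
        using z[of s] True by (cases "\<bar>s\<bar> \<ge> S") (auto simp: indicator_def)
    qed
    then have "(LINT s|lborel. indicator {-S..x} s * u s) = 0" using int0 by (simp only:)
    then show ?thesis using FTC[of "-S" x] True \<phi>S by (simp add: S_def)
  next
    case False
    then have x: "x < -S" using that by auto
    have "(\<lambda>s. indicator {x..-S} s * u s) = (\<lambda>s. 0)"
    proof
      show "indicator {x..-S} s * u s = 0" for s
        using z[of s] x by (auto simp: indicator_def S_def)
    qed
    then have "(LINT s|lborel. indicator {x..-S} s * u s) = 0" by simp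
    then show ?thesis using FTC[of x "-S"] x \<phi>S by simp
  qed
  then have "\<phi> \<in> Ck0 (Suc k)" unfolding Ck0_iff using \<phi>C by blast
  then show ?thesis using that D by blast
qed

lemma Ck0_unit_mass:
  obtains \<theta> :: "real \<Rightarrow> complex" where "\<theta> \<in> Ck0 k" "(LINT t|lborel. \<theta> t) = 1"
proof -
  obtain \<phi> :: "real \<Rightarrow> real" where \<phi>: "\<phi> \<in> Ck k" "\<And>x. 0 \<le> \<phi> x" "\<And>x. \<phi> x \<le> 1"
    "\<And>x. \<bar>x\<bar> \<le> 1 \<Longrightarrow> \<phi> x = 1" "\<And>x. \<bar>x\<bar> \<ge> 1 + 1 \<Longrightarrow> \<phi> x = 0"
    using cutoff_exists[of 1] by (metis zero_less_one)
  have \<phi>0: "\<phi> \<in> Ck0 k" unfolding Ck0_iff using \<phi>(1,5) less_imp_le by blast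
  have i: "integrable lborel \<phi>" by (rule Ck0_integrable[OF \<phi>0])
  define J where "J = (LINT t|lborel. \<phi> t)"
  have "(LINT t|lborel. indicator {-1..1::real} t) \<le> J"
    unfolding J_def
  proof (rule integral_mono[OF _ i])
    show "indicator {-1..1} t \<le> \<phi> t" for t using \<phi>(2)[of t] \<phi>(4)[of t] by (auto simp: indicator_def)
  qed simp
  then have J: "J > 0" by simp
  define \<theta> where "\<theta> t = complex_of_real (inverse J) * of_real (\<phi> t)" for t
  have c0: "(\<lambda>t. complex_of_real (\<phi> t)) \<in> Ck0 k"
    using \<phi>0 Ck_of_real[OF \<phi>(1)] unfolding Ck0_iff by auto
  have "\<theta> \<in> Ck0 k" unfolding \<theta>_def[abs_def] by (rule Ck0_mult_right[OF Ck_const c0])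
  moreover have "(LINT t|lborel. \<theta> t) = 1"
    unfolding \<theta>_def using J by (simp add: J_def[symmetric])
  ultimately show ?thesis using that by blast
qed

lemma integrable_nderiv_loc_int:
  assumes "\<phi> \<in> Ck0 K" "k \<le> K" "loc_int F"
  shows "integrable lborel (\<lambda>t. nderiv k \<phi> t * F t)"
proof -
  have c: "nderiv k \<phi> \<in> Ck0 0" using nderiv_in_Ck0[OF assms(1), of k 0] assms(2) by simp
  then obtain R where "\<And>t. \<bar>t\<bar> > R \<Longrightarrow> nderiv k \<phi> t = 0" unfolding Ck0_iff by blast
  then show ?thesis using c by (intro loc_int_mult_compact[OF assms(3)]) (auto simp: Ck0_iff Ck_0)
qed

text \<open>A generalisation of the lemma of du Bois-Reymond. The lowest-order term is absorbed into the
  next one by integration by parts; the derivatives of test functions are the test functions of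
  mean value zero, so one order is gained at the price of a constant of integration.\<close>

lemma weak_identity_reduction:
  assumes "\<And>k. k \<le> K \<Longrightarrow> loc_int (F k)"
    and "\<And>\<phi>. \<phi> \<in> Ck0 K \<Longrightarrow> (\<Sum>k\<le>K. LINT t|lborel. nderiv k \<phi> t * F k t) = 0"
  shows "\<exists>G c. G 0 = F 0 \<and> (\<forall>k<K. G (Suc k) = (\<lambda>t. F (Suc k) t - c k - prim (G k) t)) \<and> (AE t in lborel. G K t = 0)"
  using assms
proof (induction K arbitrary: F)
  case 0
  have "AE t in lborel. F 0 t = 0" using 0 by (intro fundamental_lemma) auto
  then show ?case by (intro exI[of _ "\<lambda>_. F 0"]) auto
next
  case (Suc K)
  obtain \<theta> :: "real \<Rightarrow> complex" where \<theta>: "\<theta> \<in> Ck0 K" "(LINT t|lborel. \<theta> t) = 1" by (rule Ck0_unit_mass)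
  have pl: "loc_int (prim (F 0))" by (rule loc_int_continuous[OF prim_continuous[OF Suc.prems(1)]]) simp
  \<comment> \<open>The functional obtained by absorbing the term of order zero; it vanishes on functions of mean value zero.\<close>
  define L where "L u = (\<Sum>k\<le>K. LINT t|lborel. nderiv k u t * F (Suc k) t) - (LINT t|lborel. u t * prim (F 0) t)" for u
  have L0: "L u = 0" if u: "u \<in> Ck0 K" "(LINT t|lborel. u t) = 0" for u
  proof -
    obtain \<phi> where \<phi>: "\<phi> \<in> Ck0 (Suc K)" "nderiv 1 \<phi> = u" using Ck0_primitive[OF u] by blast
    have \<phi>1: "\<phi> \<in> Ck0 1" using nderiv_in_Ck0[OF \<phi>(1), of 0 1] by simp
    have "0 = (\<Sum>k\<le>Suc K. LINT t|lborel. nderiv k \<phi> t * F k t)" using Suc.prems(2)[OF \<phi>(1)] by simp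
    also have "\<dots> = (LINT t|lborel. \<phi> t * F 0 t) + (\<Sum>k\<le>K. LINT t|lborel. nderiv (Suc k) \<phi> t * F (Suc k) t)"
      by (subst sum.atMost_Suc_shift) simp
    also have "(LINT t|lborel. \<phi> t * F 0 t) = - (LINT t|lborel. u t * prim (F 0) t)"
      using integration_by_parts_prim[OF Suc.prems(1)[of 0] \<phi>1] \<phi>(2) by simp
    finally show ?thesis unfolding L_def nderiv_Suc_shift[of _ \<phi>] \<phi>(2) by simp
  qed
  have Ldiff: "L (\<lambda>t. \<psi> t - a * \<theta> t) = L \<psi> - a * L \<theta>" if \<psi>: "\<psi> \<in> Ck0 K" for \<psi> a
  proof -
    have 1: "(LINT t|lborel. nderiv k (\<lambda>t. \<psi> t - a * \<theta> t) t * F (Suc k) t)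
        = (LINT t|lborel. nderiv k \<psi> t * F (Suc k) t) - a * (LINT t|lborel. nderiv k \<theta> t * F (Suc k) t)" if "k \<le> K" for k
    proof -
      have i: "integrable lborel (\<lambda>t. nderiv k \<psi> t * F (Suc k) t)" "integrable lborel (\<lambda>t. nderiv k \<theta> t * F (Suc k) t)"
        using integrable_nderiv_loc_int[OF \<psi> that] integrable_nderiv_loc_int[OF \<theta>(1) that] Suc.prems(1)[of "Suc k"] that by auto
      have "nderiv k (\<lambda>t. \<psi> t - a * \<theta> t) t * F (Suc k) t
          = nderiv k \<psi> t * F (Suc k) t - a * (nderiv k \<theta> t * F (Suc k) t)" for t
        by (simp add: nderiv_diff[OF Ck0_Ck[OF \<psi>] Ck_cmult[OF Ck0_Ck[OF \<theta>(1)]] that]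
          nderiv_cmult[OF Ck0_Ck[OF \<theta>(1)] that] algebra_simps)
      then show ?thesis using i by simp
    qed
    have i: "integrable lborel (\<lambda>t. \<psi> t * prim (F 0) t)" "integrable lborel (\<lambda>t. \<theta> t * prim (F 0) t)"
      using integrable_nderiv_loc_int[OF \<psi> _ pl, of 0] integrable_nderiv_loc_int[OF \<theta>(1) _ pl, of 0] by auto
    have "(\<psi> t - a * \<theta> t) * prim (F 0) t = \<psi> t * prim (F 0) t - a * (\<theta> t * prim (F 0) t)" for t
      by (simp add: algebra_simps)
    then have 2: "(LINT t|lborel. (\<psi> t - a * \<theta> t) * prim (F 0) t)
        = (LINT t|lborel. \<psi> t * prim (F 0) t) - a * (LINT t|lborel. \<theta> t * prim (F 0) t)"
      using i by simp
    have 3: "(\<Sum>k\<le>K. LINT t|lborel. nderiv k (\<lambda>t. \<psi> t - a * \<theta> t) t * F (Suc k) t)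
        = (\<Sum>k\<le>K. (LINT t|lborel. nderiv k \<psi> t * F (Suc k) t) - a * (LINT t|lborel. nderiv k \<theta> t * F (Suc k) t))"
      by (intro sum.cong refl 1) simp
    show ?thesis unfolding L_def 2 3 by (simp add: sum_subtractf sum_distrib_left algebra_simps)
  qed
  define c where "c = L \<theta>"
  define F' where "F' k = (if k = 0 then (\<lambda>t. F (Suc 0) t - c - prim (F 0) t) else F (Suc k))" for k
  have lF': "loc_int (F' k)" if "k \<le> K" for k
    unfolding F'_def using Suc.prems(1) that pl loc_int_continuous[of "\<lambda>t. c"] by (auto intro!: loc_int_diff)
  have weak': "(\<Sum>k\<le>K. LINT t|lborel. nderiv k \<psi> t * F' k t) = 0" if \<psi>: "\<psi> \<in> Ck0 K" for \<psi>
  proof -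
    define a where "a = (LINT t|lborel. \<psi> t)"
    have u: "(\<lambda>t. \<psi> t - a * \<theta> t) \<in> Ck0 K" by (intro Ck0_diff \<psi> Ck0_mult_right Ck_const \<theta>(1))
    have "(LINT t|lborel. \<psi> t - a * \<theta> t) = 0"
      using Ck0_integrable[OF \<psi>] Ck0_integrable[OF \<theta>(1)] \<theta>(2) by (simp add: a_def)
    from L0[OF u this] have Lz: "L \<psi> = a * c" unfolding Ldiff[OF \<psi>] c_def by simp
    have i: "integrable lborel (\<lambda>t. \<psi> t * F (Suc 0) t)" "integrable lborel (\<lambda>t. \<psi> t * prim (F 0) t)" "integrable lborel \<psi>"
      using integrable_nderiv_loc_int[OF \<psi> _ pl, of 0] integrable_nderiv_loc_int[OF \<psi> _ Suc.prems(1)[of "Suc 0"], of 0]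
        Ck0_integrable[OF \<psi>] by auto
    have "\<psi> t * F' 0 t = \<psi> t * F (Suc 0) t - c * \<psi> t - \<psi> t * prim (F 0) t" for t
      by (simp add: F'_def algebra_simps)
    then have 0: "(LINT t|lborel. \<psi> t * F' 0 t) = (LINT t|lborel. \<psi> t * F (Suc 0) t) - c * a - (LINT t|lborel. \<psi> t * prim (F 0) t)"
      using i by (simp add: a_def)
    have split: "(\<Sum>k\<le>K. f k) = f 0 + (\<Sum>k\<in>{1..K}. f k)" for f :: "nat \<Rightarrow> complex"
      by (simp add: atMost_atLeast0 sum.atLeast_Suc_atMost)
    have "(\<Sum>k\<le>K. LINT t|lborel. nderiv k \<psi> t * F' k t) = L \<psi> - c * a"
      unfolding L_def split using 0 by (simp add: F'_def cong: sum.cong_simp)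
    then show ?thesis using Lz by simp
  qed
  obtain G c' where G: "G 0 = F' 0" "\<And>k. k < K \<Longrightarrow> G (Suc k) = (\<lambda>t. F' (Suc k) t - c' k - prim (G k) t)"
    "AE t in lborel. G K t = 0"
    using Suc.IH[OF lF' weak'] by auto
  define H where "H k = (case k of 0 \<Rightarrow> F 0 | Suc j \<Rightarrow> G j)" for k
  define d where "d k = (case k of 0 \<Rightarrow> c | Suc j \<Rightarrow> c' j)" for k
  have "H (Suc k) = (\<lambda>t. F (Suc k) t - d k - prim (H k) t)" if "k < Suc K" for k
  proof (cases k)
    case 0
    then show ?thesis using G(1) by (simp add: H_def d_def F'_def)
  next
    case (Suc j)
    then show ?thesis using G(2)[of j] that by (simp add: H_def d_def F'_def)
  qed
  moreover have "H 0 = F 0" "AE t in lborel. H (Suc K) t = 0" using G(3) by (simp_all add: H_def)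
  ultimately show ?case by blast
qed

text \<open>Elliptic regularity: a weak solution is a classical one. The reduction above
  expresses it through primitives of itself, which gains one derivative at a time; differentiating
  the reduced identity \<open>K\<close> times gives the equation back.\<close>

lemma weak_solution_regularity:
  fixes \<alpha> :: "nat \<Rightarrow> complex" and V W :: "real \<Rightarrow> complex"
  assumes W: "loc_int W" and V: "V \<in> Ck K" and K: "K \<ge> 1" and lead: "\<alpha> K \<noteq> 0"
    and weak: "\<And>\<phi>. \<phi> \<in> Ck0 K \<Longrightarrow>
      (\<Sum>k\<le>K. \<alpha> k * (LINT t|lborel. nderiv k \<phi> t * W t)) + (LINT t|lborel. \<phi> t * (V t * W t)) = 0"
  obtains w where "w \<in> Ck K" "AE t in lborel. W t = w t"
    "\<And>t. (\<Sum>k\<le>K. (-1) ^ k * \<alpha> k * nderiv k w t) + V t * w t = 0"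
proof -
  obtain J where J: "K = Suc J" using K by (cases K) auto
  define F where "F k t = (\<alpha> k + (if k = 0 then V t else 0)) * W t" for k t
  have Vc: "continuous_on UNIV V" by (rule Ck_continuous[OF V])
  have mc: "continuous_on UNIV (\<lambda>t. \<alpha> k + (if k = 0 then V t else 0))" for k
    using Vc by (cases k) (auto intro!: continuous_intros)
  have lF: "loc_int (F k)" for k unfolding F_def[abs_def] by (rule loc_int_mult_continuous[OF W mc])
  have weakF: "(\<Sum>k\<le>K. LINT t|lborel. nderiv k \<phi> t * F k t) = 0" if \<phi>: "\<phi> \<in> Ck0 K" for \<phi>
  proof -
    have split: "(\<Sum>k\<le>K. f k) = f 0 + (\<Sum>k\<in>{1..K}. f k)" for f :: "nat \<Rightarrow> complex"
      by (simp add: atMost_atLeast0 sum.atLeast_Suc_atMost)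
    have i: "integrable lborel (\<lambda>t. \<phi> t * W t)" "integrable lborel (\<lambda>t. \<phi> t * (V t * W t))"
      using integrable_nderiv_loc_int[OF \<phi> _ W, of 0]
        integrable_nderiv_loc_int[OF \<phi> _ loc_int_mult_continuous[OF W Vc], of 0] by auto
    have 1: "(\<Sum>k\<in>{1..K}. LINT t|lborel. nderiv k \<phi> t * F k t) = (\<Sum>k\<in>{1..K}. \<alpha> k * (LINT t|lborel. nderiv k \<phi> t * W t))"
    proof (intro sum.cong refl)
      fix k assume "k \<in> {1..K}"
      then have "(\<lambda>t. nderiv k \<phi> t * F k t) = (\<lambda>t. \<alpha> k * (nderiv k \<phi> t * W t))"
        by (auto simp: F_def)
      then show "(LINT t|lborel. nderiv k \<phi> t * F k t) = \<alpha> k * (LINT t|lborel. nderiv k \<phi> t * W t)" by simp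
    qed
    have "\<phi> t * F 0 t = \<alpha> 0 * (\<phi> t * W t) + \<phi> t * (V t * W t)" for t
      by (simp add: F_def algebra_simps)
    then have 0: "(LINT t|lborel. \<phi> t * F 0 t) = \<alpha> 0 * (LINT t|lborel. \<phi> t * W t) + (LINT t|lborel. \<phi> t * (V t * W t))"
      using i by simp
    show ?thesis using weak[OF \<phi>] unfolding split 1 by (simp add: 0 algebra_simps)
  qed
  obtain G c where G: "G 0 = F 0" "\<And>k. k < K \<Longrightarrow> G (Suc k) = (\<lambda>t. F (Suc k) t - c k - prim (G k) t)"
    "AE t in lborel. G K t = 0"
    using weak_identity_reduction[of K F] lF weakF by auto
  have lG: "k \<le> K \<Longrightarrow> loc_int (G k)" for k
  proof (induction k)
    case (Suc k)
    then have "loc_int (prim (G k))" by (intro loc_int_continuous[OF prim_continuous]) auto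
    then show ?case unfolding G(2)[OF Suc_le_lessD[OF Suc.prems]]
      using lF loc_int_continuous[of "\<lambda>t. c k"] by (auto intro!: loc_int_diff)
  qed (simp add: G(1) lF)
  define w where "w t = (c J + prim (G J) t) / \<alpha> K" for t
  have wc: "continuous_on UNIV w" unfolding w_def[abs_def]
    using lead prim_continuous[OF lG, of J] J by (intro continuous_intros) auto
  have Ww: "AE t in lborel. W t = w t"
    using G(3)
  proof eventually_elim
    case (elim t)
    then have "\<alpha> K * W t - c J - prim (G J) t = 0" using G(2)[of J] unfolding J by (simp add: F_def)
    then show ?case unfolding w_def using lead by (simp add: field_simps)
  qed
  define H where "H = rec_nat (\<lambda>t. (\<alpha> 0 + V t) * w t) (\<lambda>k h t. \<alpha> (Suc k) * w t - c k - prim h t)"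
  have H0: "H 0 = (\<lambda>t. (\<alpha> 0 + V t) * w t)" and HS: "\<And>k. H (Suc k) = (\<lambda>t. \<alpha> (Suc k) * w t - c k - prim (H k) t)"
    unfolding H_def by auto
  have Hc: "continuous_on UNIV (H k)" for k
  proof (induction k)
    case 0 then show ?case unfolding H0 using Vc wc by (intro continuous_intros)
  next
    case (Suc k)
    then show ?case unfolding HS using wc prim_continuous[OF loc_int_continuous] by (intro continuous_intros) auto
  qed
  have HG: "k \<le> K \<Longrightarrow> AE t in lborel. H k t = G k t" for k
  proof (induction k)
    case 0
    show ?case using Ww by eventually_elim (simp add: H0 G(1) F_def)
  next
    case (Suc k)
    have p: "prim (H k) = prim (G k)"
      using Suc by (intro prim_cong_AE loc_int_continuous[OF Hc] lG) auto
    show ?case unfolding HS G(2)[OF Suc_le_lessD[OF Suc.prems]] p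
      using Ww by eventually_elim (simp add: F_def)
  qed
  have wH: "w = (\<lambda>t. inverse (\<alpha> K) * (c J + prim (H J) t))"
  proof -
    have "prim (H J) = prim (G J)"
      using HG[of J] J by (intro prim_cong_AE loc_int_continuous[OF Hc] lG) auto
    then show ?thesis unfolding w_def[abs_def] by (simp add: field_simps)
  qed
  have "\<alpha> (Suc J) * w t = c J + prim (H J) t" for t
    using fun_cong[OF wH, of t] lead J by (simp add: field_simps)
  then have HK: "H K = (\<lambda>t. 0)" unfolding J HS by simp
  have HC: "H k \<in> Ck j" if "w \<in> Ck j" "j \<le> K" for j k
  proof (induction k)
    case 0
    show ?case unfolding H0 using that Ck_mono[OF V] by (intro Ck_mult Ck_add Ck_const)
  next
    case (Suc k)
    then show ?case unfolding HS using that Ck_SucD[OF prim_Ck] by (intro Ck_diff Ck_mult Ck_const) auto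
  qed
  have wC: "j \<le> K \<Longrightarrow> w \<in> Ck j" for j
  proof (induction j)
    case 0 then show ?case using wc by (simp add: Ck_0)
  next
    case (Suc j)
    then have "prim (H J) \<in> Ck (Suc j)" by (intro prim_Ck HC) auto
    then show ?case by (subst wH) (intro Ck_mult Ck_add Ck_const)
  qed
  have formula: "d \<le> K \<Longrightarrow> H (K - d) t = (\<Sum>i\<in>{1..d}. (-1) ^ (i - 1) * \<alpha> (K - d + i) * nderiv i w t)" for d t
  proof (induction d arbitrary: t)
    case 0 then show ?case by (simp add: HK)
  next
    case (Suc d)
    define k where "k = K - Suc d"
    have k: "Suc k = K - d" "k = K - Suc d" using Suc.prems by (auto simp: k_def)
    have dw: "(nderiv i w has_vector_derivative nderiv (Suc i) w t) (at t)" if "i \<le> d" for i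
      by (rule Ck_has_vector_derivative[OF wC[OF order_refl]]) (use that Suc.prems in simp)
    have "(H (Suc k) has_vector_derivative \<alpha> (Suc k) * nderiv (Suc 0) w t - H k t) (at t)"
      unfolding HS using dw[of 0] prim_has_vector_derivative[OF Hc, of k t]
      by (auto intro!: derivative_eq_intros)
    moreover have "(H (Suc k) has_vector_derivative (\<Sum>i\<in>{1..d}. (-1) ^ (i - 1) * \<alpha> (K - d + i) * nderiv (Suc i) w t)) (at t)"
    proof -
      have e: "H (Suc k) = (\<lambda>t. \<Sum>i\<in>{1..d}. (-1) ^ (i - 1) * \<alpha> (K - d + i) * nderiv i w t)"
        using Suc.IH Suc.prems k by auto
      show ?thesis unfolding e
        by (rule has_vector_derivative_sum, rule has_vector_derivative_mult_right, rule dw) simp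
    qed
    ultimately have eq: "\<alpha> (Suc k) * nderiv (Suc 0) w t - H k t = (\<Sum>i\<in>{1..d}. (-1) ^ (i - 1) * \<alpha> (K - d + i) * nderiv (Suc i) w t)"
      by (rule vector_derivative_unique_at)
    have "(\<Sum>i\<in>{1..Suc d}. (-1) ^ (i - 1) * \<alpha> (k + i) * nderiv i w t)
        = \<alpha> (Suc k) * nderiv (Suc 0) w t + (\<Sum>i\<in>{Suc 1..Suc d}. (-1) ^ (i - 1) * \<alpha> (k + i) * nderiv i w t)"
      by (subst sum.atLeast_Suc_atMost) auto
    also have "(\<Sum>i\<in>{Suc 1..Suc d}. (-1) ^ (i - 1) * \<alpha> (k + i) * nderiv i w t)
        = (\<Sum>i\<in>{1..d}. (-1) ^ i * \<alpha> (Suc k + i) * nderiv (Suc i) w t)"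
      by (subst sum.shift_bounds_cl_Suc_ivl) simp
    also have "\<dots> = - (\<Sum>i\<in>{1..d}. (-1) ^ (i - 1) * \<alpha> (K - d + i) * nderiv (Suc i) w t)"
      unfolding sum_negf[symmetric] k(1)
    proof (intro sum.cong refl)
      fix i assume "i \<in> {1..d}"
      then obtain j where "i = Suc j" by (cases i) auto
      then show "(-1) ^ i * \<alpha> (K - d + i) * nderiv (Suc i) w t = - ((-1) ^ (i - 1) * \<alpha> (K - d + i) * nderiv (Suc i) w t)"
        by simp
    qed
    finally show ?case using eq unfolding k(2)[symmetric] by (simp add: algebra_simps)
  qed
  show ?thesis
  proof (rule that[OF wC[OF order_refl] Ww])
    fix t
    have "(\<alpha> 0 + V t) * w t = (\<Sum>i\<in>{1..K}. (-1) ^ (i - 1) * \<alpha> i * nderiv i w t)"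
      using formula[of K t] H0 by simp
    also have "\<dots> = - (\<Sum>i\<in>{1..K}. (-1) ^ i * \<alpha> i * nderiv i w t)"
      unfolding sum_negf[symmetric]
    proof (intro sum.cong refl)
      fix i assume "i \<in> {1..K}"
      then obtain j where "i = Suc j" by (cases i) auto
      then show "(-1) ^ (i - 1) * \<alpha> i * nderiv i w t = - ((-1) ^ i * \<alpha> i * nderiv i w t)" by simp
    qed
    finally have e: "(\<alpha> 0 + V t) * w t = - (\<Sum>i\<in>{1..K}. (-1) ^ i * \<alpha> i * nderiv i w t)" .
    have "(\<Sum>k\<le>K. (-1) ^ k * \<alpha> k * nderiv k w t) + V t * w t
        = (\<alpha> 0 + V t) * w t + (\<Sum>i\<in>{1..K}. (-1) ^ i * \<alpha> i * nderiv i w t)"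
      by (simp add: atMost_atLeast0 sum.atLeast_Suc_atMost[of 0 K] algebra_simps)
    then show "(\<Sum>k\<le>K. (-1) ^ k * \<alpha> k * nderiv k w t) + V t * w t = 0" unfolding e by simp
  qed
qed


context weighted_op
begin

section \<open>Solutions of the eigenvalue equation lie in the domain of the closure\<close>

text \<open>Integration by parts with the weights \<open>v\<^sup>2 \<eta>\<^sup>2\<^sup>k\<close>. The derivative of such a weight is at most a
  constant times \<open>v\<^sup>2 \<eta>\<^sup>2\<^sup>k\<^sup>-\<^sup>1\<close>, the geometric mean of the weights of index \<open>k - 1\<close> and \<open>k\<close>: the power of the
  cutoff that grows with the order of differentiation makes room for the derivative of the cutoff. Neither the
  size of the support of \<open>\<eta>\<close> nor boundary terms enter the constants.\<close>

lemma weighted_convex_chain: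
  assumes y: "y \<in> Ck K" and vy: "(\<lambda>t. of_real (v t) * y t) \<in> L2"
    and \<eta>: "\<eta> \<in> Ck K" "\<And>t. 0 \<le> \<eta> t" "\<And>t. \<eta> t \<le> 1" "\<And>t. \<bar>t\<bar> > R \<Longrightarrow> \<eta> t = 0" "\<And>t. \<bar>nderiv 1 \<eta> t\<bar> \<le> M"
  shows "convex_chain K (\<lambda>\<epsilon>. (2 * \<bar>C\<bar> + 2 * real K * M)\<^sup>2 + 1 / \<epsilon>)
    (\<lambda>k. (l2norm (\<lambda>t. of_real (v t * \<eta> t ^ k) * nderiv k y t))\<^sup>2)"
  unfolding convex_chain_def
proof (intro conjI allI impI)
  fix j and \<epsilon> :: real assume j: "Suc j < K" and \<epsilon>: "0 < \<epsilon>"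
  define N where "N = 2 * \<bar>C\<bar> + 2 * real K * M"
  have M0: "M \<ge> 0" using \<eta>(5)[of 0] by linarith
  have N0: "N \<ge> 0" unfolding N_def using M0 by simp
  define p where "p k t = complex_of_real (v t * \<eta> t ^ k) * nderiv k y t" for k t
  have pc: "continuous_on UNIV (p k)" if "k \<le> K" for k
    unfolding p_def[abs_def] using Ck_continuous_nderiv[OF y that] Ck_continuous[OF v_Ck] Ck_continuous[OF \<eta>(1)]
    by (intro continuous_intros)
  have pL: "p k \<in> L2" if "k \<le> K" for k
  proof (cases "k = 0")
    case True then show ?thesis using vy by (simp add: p_def[abs_def])
  next
    case False
    then have "p k \<in> Ck0 0" unfolding Ck0_iff Ck_0 using pc[OF that] \<eta>(4)
      by (auto simp: p_def intro!: exI[of _ R])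
    then show ?thesis by (rule Ck0_L2)
  qed
  let ?k = "Suc j"
  define f where "f = nderiv j y"
  define h where "h t = v t * v t * \<eta> t ^ (2 * ?k)" for t
  have fC: "f \<in> Ck 1" unfolding f_def by (rule nderiv_in_Ck'[OF y]) (use j in simp)
  have fd: "nderiv 1 f = nderiv ?k y" unfolding f_def by (simp add: nderiv_add_index)
  have fkC: "nderiv ?k y \<in> Ck 1" by (rule nderiv_in_Ck'[OF y]) (use j in simp)
  have v1: "(v has_real_derivative nderiv 1 v t) (at t)" for t
    using Ck_has_vector_derivative[OF v_Ck, of 0 t] deg_ge_2 by (simp add: has_real_derivative_iff_has_vector_derivative)
  have \<eta>1: "(\<eta> has_real_derivative nderiv 1 \<eta> t) (at t)" for t
    using Ck_has_vector_derivative[OF \<eta>(1), of 0 t] deg_ge_2 by (simp add: has_real_derivative_iff_has_vector_derivative)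
  define h' where "h' t = 2 * v t * nderiv 1 v t * \<eta> t ^ (2 * ?k)
     + v t * v t * (real (2 * ?k) * \<eta> t ^ (2 * ?k - 1) * nderiv 1 \<eta> t)" for t
  have hd: "(h has_vector_derivative h' t) (at t)" for t
    unfolding has_real_derivative_iff_has_vector_derivative[symmetric] h_def[abs_def] h'_def
    by (rule derivative_eq_intros v1 \<eta>1 refl | simp add: algebra_simps)+
  have hC: "h \<in> Ck 1"
  proof -
    have "v \<in> Ck 1" "\<eta> \<in> Ck 1" using Ck_mono[OF v_Ck, of 1] Ck_mono[OF \<eta>(1), of 1] deg_ge_2 by auto
    then have "continuous_on UNIV v" "continuous_on UNIV \<eta>" "continuous_on UNIV (nderiv 1 v)" "continuous_on UNIV (nderiv 1 \<eta>)"
      using Ck_continuous_nderiv[of v 1 1] Ck_continuous_nderiv[of \<eta> 1 1] Ck_continuous[of v 1] Ck_continuous[of \<eta> 1] by auto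
    then have c: "continuous_on UNIV h'" unfolding h'_def[abs_def] by (intro continuous_intros)
    show ?thesis using Ck_SucI[OF hd, of 0] c by (simp add: Ck_0)
  qed
  define g where "g t = complex_of_real (h t) * cnj (nderiv ?k y t)" for t
  have gC: "g \<in> Ck 1" unfolding g_def[abs_def] by (intro Ck_mult Ck_of_real hC Ck_cnj fkC)
  have nh: "nderiv (Suc 0) h = h'" by (rule nderiv_1_eq[OF hd])
  have gd: "nderiv 1 g t = of_real (h t) * cnj (nderiv (Suc ?k) y t) + of_real (h' t) * cnj (nderiv ?k y t)" for t
  proof -
    have "nderiv (Suc 0) (\<lambda>t. complex_of_real (h t)) t = of_real (h' t)"
      using nderiv_of_real[OF hC, of 1] nh by simp
    moreover have "nderiv (Suc 0) (\<lambda>t. cnj (nderiv ?k y t)) t = cnj (nderiv (Suc ?k) y t)"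
      using nderiv_cnj[OF fkC, of 1] by (simp add: nderiv_add_index)
    ultimately show ?thesis unfolding g_def[abs_def]
      using nderiv_1_mult[of "\<lambda>t. complex_of_real (h t)" 0 "\<lambda>t. cnj (nderiv ?k y t)" 0] hC fkC Ck_of_real Ck_cnj by simp
  qed
  have gz: "g t = 0" if "\<bar>t\<bar> > R" for t using \<eta>(4)[OF that] by (simp add: g_def h_def)
  have h'_le: "\<bar>h' t\<bar> \<le> N * ((v t * \<eta> t ^ j) * (v t * \<eta> t ^ ?k))" for t
  proof -
    have e: "\<eta> t ^ (2 * ?k) = \<eta> t * (\<eta> t ^ j * \<eta> t ^ ?k)" "\<eta> t ^ (2 * ?k - 1) = \<eta> t ^ j * \<eta> t ^ ?k"
      by (simp_all add: power_add[symmetric] mult_2)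
    define Z where "Z = \<eta> t ^ j * \<eta> t ^ ?k"
    have Z0: "Z \<ge> 0" unfolding Z_def using \<eta>(2) by simp
    have a: "\<bar>2 * v t * nderiv 1 v t * (\<eta> t * Z)\<bar> \<le> 2 * \<bar>C\<bar> * (v t * v t * Z)"
    proof -
      have "\<bar>nderiv 1 v t\<bar> \<le> \<bar>C\<bar> * v t"
        by (rule order_trans[OF v_deriv]) (use v_pos[of t] in \<open>simp add: mult_right_mono\<close>)
      then have "\<bar>nderiv 1 v t\<bar> * (\<eta> t * Z) \<le> (\<bar>C\<bar> * v t) * (1 * Z)"
        using \<eta>(2,3)[of t] Z0 v_pos[of t] by (intro mult_mono) auto
      then have "2 * v t * (\<bar>nderiv 1 v t\<bar> * (\<eta> t * Z)) \<le> 2 * v t * ((\<bar>C\<bar> * v t) * (1 * Z))"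
        using v_pos[of t] by (intro mult_left_mono) auto
      then show ?thesis using v_pos[of t] \<eta>(2)[of t] Z0 by (simp add: abs_mult mult_ac)
    qed
    have b: "\<bar>v t * v t * (real (2 * ?k) * Z * nderiv 1 \<eta> t)\<bar> \<le> (2 * real K * M) * (v t * v t * Z)"
    proof -
      have "real (2 * ?k) * \<bar>nderiv 1 \<eta> t\<bar> \<le> 2 * real K * M"
        using j \<eta>(5)[of t] by (intro mult_mono) auto
      then have "(real (2 * ?k) * \<bar>nderiv 1 \<eta> t\<bar>) * (v t * v t * Z) \<le> (2 * real K * M) * (v t * v t * Z)"
        using Z0 by (intro mult_right_mono) auto
      then show ?thesis using v_pos[of t] Z0 by (simp add: abs_mult mult_ac)
    qed
    have "\<bar>h' t\<bar> \<le> \<bar>2 * v t * nderiv 1 v t * (\<eta> t * Z)\<bar> + \<bar>v t * v t * (real (2 * ?k) * Z * nderiv 1 \<eta> t)\<bar>"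
      unfolding h'_def e Z_def[symmetric] by (rule abs_triangle_ineq)
    also have "\<dots> \<le> N * (v t * v t * Z)" using a b unfolding N_def by (simp add: distrib_right)
    finally show ?thesis unfolding Z_def by (simp add: mult_ac)
  qed
  let ?I = "\<lambda>t. N * (norm (p j t) * norm (p ?k t)) + norm (p j t) * norm (p (Suc ?k) t)"
  have L: "p j \<in> L2" "p ?k \<in> L2" "p (Suc ?k) \<in> L2" using pL j by auto
  have Ii: "integrable lborel ?I" using integrable_L2_mult(1)[OF L(1,2)] integrable_L2_mult(1)[OF L(1,3)] by simp
  have bound: "norm (f t * nderiv 1 g t) \<le> ?I t" for t
  proof -
    have "norm (f t * nderiv 1 g t) \<le> norm (f t) * (\<bar>h' t\<bar> * norm (nderiv ?k y t) + \<bar>h t\<bar> * norm (nderiv (Suc ?k) y t))"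
      unfolding gd norm_mult[of "f t"]
      by (intro mult_left_mono order_trans[OF norm_triangle_ineq]) (auto simp: norm_mult add.commute)
    also have "\<dots> \<le> norm (f t) * (N * ((v t * \<eta> t ^ j) * (v t * \<eta> t ^ ?k)) * norm (nderiv ?k y t) + \<bar>h t\<bar> * norm (nderiv (Suc ?k) y t))"
      using h'_le[of t] by (intro mult_left_mono add_right_mono mult_right_mono) auto
    also have "\<bar>h t\<bar> = (v t * \<eta> t ^ j) * (v t * \<eta> t ^ Suc ?k)"
      unfolding h_def using \<eta>(2)[of t] v_pos[of t] by (simp add: abs_mult power_add mult_2 mult_2_right mult_ac)
    also have "norm (f t) * (N * ((v t * \<eta> t ^ j) * (v t * \<eta> t ^ ?k)) * norm (nderiv ?k y t)
        + (v t * \<eta> t ^ j) * (v t * \<eta> t ^ Suc ?k) * norm (nderiv (Suc ?k) y t)) = ?I t"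
      unfolding p_def f_def norm_mult norm_of_real using \<eta>(2)[of t] v_pos[of t]
      by (simp add: abs_mult algebra_simps)
    finally show ?thesis .
  qed
  have "(l2norm (p ?k))\<^sup>2 = norm (LINT t|lborel. nderiv 1 f t * g t)"
  proof -
    have "nderiv 1 f t * g t = p ?k t * cnj (p ?k t)" for t
      unfolding fd g_def h_def p_def by (simp add: power_mult power2_eq_square power_mult_distrib mult_2 power_add algebra_simps)
    then have "(LINT t|lborel. nderiv 1 f t * g t) = ip (p ?k) (p ?k)" unfolding ip_def by simp
    then show ?thesis by (simp add: ip_self norm_power)
  qed
  also have "\<dots> = norm (LINT t|lborel. f t * nderiv 1 g t)"
    using integration_by_parts_compact[OF fC gC, of R] gz by simp
  also have "\<dots> \<le> (LINT t|lborel. norm (f t * nderiv 1 g t))" by (rule integral_norm_bound)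
  also have "\<dots> \<le> (LINT t|lborel. ?I t)"
    by (rule integral_mono'[OF Ii bound]) (simp add: N0)
  also have "\<dots> = N * (LINT t|lborel. norm (p j t) * norm (p ?k t)) + (LINT t|lborel. norm (p j t) * norm (p (Suc ?k) t))"
    using integrable_L2_mult(1)[OF L(1,2)] integrable_L2_mult(1)[OF L(1,3)] by simp
  also have "\<dots> \<le> N * (l2norm (p j) * l2norm (p ?k)) + l2norm (p j) * l2norm (p (Suc ?k))"
    using integral_mult_le_l2norm[OF L(1,2)] integral_mult_le_l2norm[OF L(1,3)] N0 by (intro add_mono mult_left_mono)
  also have "N * (l2norm (p j) * l2norm (p ?k)) \<le> 1 / 2 * (l2norm (p ?k))\<^sup>2 + 1 / 2 * N\<^sup>2 * (l2norm (p j))\<^sup>2"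
    using mult_le_weighted_squares[of "1 / 2" "l2norm (p ?k)" "N * l2norm (p j)"] by (simp add: power_mult_distrib mult_ac)
  also have "l2norm (p j) * l2norm (p (Suc ?k)) \<le> \<epsilon> / 2 * (l2norm (p (Suc ?k)))\<^sup>2 + 1 / (2 * \<epsilon>) * (l2norm (p j))\<^sup>2"
    using mult_le_weighted_squares[of "\<epsilon> / 2" "l2norm (p (Suc ?k))" "l2norm (p j)"] \<epsilon> by (simp add: mult_ac)
  finally have "(l2norm (p ?k))\<^sup>2 \<le> \<epsilon> * (l2norm (p (Suc ?k)))\<^sup>2 + (N\<^sup>2 + 1 / \<epsilon>) * (l2norm (p j))\<^sup>2"
    using \<epsilon> by (simp add: field_simps)
  then show "(l2norm (\<lambda>t. of_real (v t * \<eta> t ^ ?k) * nderiv ?k y t))\<^sup>2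
      \<le> \<epsilon> * (l2norm (\<lambda>t. of_real (v t * \<eta> t ^ Suc ?k) * nderiv (Suc ?k) y t))\<^sup>2
        + ((2 * \<bar>C\<bar> + 2 * real K * M)\<^sup>2 + 1 / \<epsilon>) * (l2norm (\<lambda>t. of_real (v t * \<eta> t ^ j) * nderiv j y t))\<^sup>2"
    unfolding p_def N_def .
qed simp

lemma top_derivative_bound:
  assumes eq: "polyD Q y t = z * y t / of_real (v t * v t)"
  shows "coeff Q K * (v t * norm (nderiv K y t))
    \<le> norm z * norm (y t / of_real (v t)) + (\<Sum>k<K. \<bar>coeff Q k\<bar> * (v t * norm (nderiv k y t)))"
proof -
  have "of_real (coeff Q K) * \<i> ^ K * nderiv K y t = polyD Q y t - (\<Sum>k<K. of_real (coeff Q k) * \<i> ^ k * nderiv k y t)"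
    unfolding polyD_def by (simp add: lessThan_Suc_atMost[symmetric])
  then have "norm (of_real (coeff Q K) * \<i> ^ K * nderiv K y t)
      \<le> norm (polyD Q y t) + norm (\<Sum>k<K. of_real (coeff Q k) * \<i> ^ k * nderiv k y t)"
    by (simp add: norm_triangle_ineq4)
  also have "\<dots> \<le> norm (polyD Q y t) + (\<Sum>k<K. \<bar>coeff Q k\<bar> * norm (nderiv k y t))"
    by (intro add_left_mono sum_norm_le) (simp add: norm_mult norm_power)
  finally have "coeff Q K * norm (nderiv K y t) \<le> norm (polyD Q y t) + (\<Sum>k<K. \<bar>coeff Q k\<bar> * norm (nderiv k y t))"
    using lead_pos by (simp add: norm_mult norm_power)
  then have "v t * (coeff Q K * norm (nderiv K y t)) \<le> v t * (norm (polyD Q y t) + (\<Sum>k<K. \<bar>coeff Q k\<bar> * norm (nderiv k y t)))"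
    using v_pos[of t] by (intro mult_left_mono) auto
  moreover have "v t * norm (polyD Q y t) = norm z * norm (y t / of_real (v t))"
    unfolding eq using v_pos[of t] by (simp add: norm_mult norm_divide field_simps)
  ultimately show ?thesis by (simp add: distrib_left sum_distrib_left mult_ac)
qed

text \<open>The equation bounds the derivative of order \<open>K\<close> by the lower ones, interpolation bounds these by a small
  multiple of the derivative of order \<open>K\<close>. All norms are finite because of the cutoff, so this multiple can be
  absorbed.\<close>

lemma weighted_derivatives_bounded:
  assumes y: "y \<in> Ck K" and u: "(\<lambda>t. y t / of_real (v t)) \<in> L2"
    and eq: "\<And>t. polyD Q y t = z * y t / of_real (v t * v t)"
  shows "\<exists>B. \<forall>\<eta> R. \<eta> \<in> Ck K \<longrightarrow> (\<forall>t. 0 \<le> \<eta> t \<and> \<eta> t \<le> 1 \<and> \<bar>nderiv 1 \<eta> t\<bar> \<le> M) \<longrightarrow> (\<forall>t. \<bar>t\<bar> > R \<longrightarrow> \<eta> t = 0) \<longrightarrow>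
    (\<forall>k<K. l2norm (\<lambda>t. of_real (v t * \<eta> t ^ k) * nderiv k y t) \<le> B)"
proof -
  have vy: "(\<lambda>t. of_real (v t) * y t) \<in> L2"
    using v_mult_L2[OF v_mult_L2[OF u]] v_nonzero by simp
  define q where "q = coeff Q K"
  have q: "q > 0" using lead_pos by (simp add: q_def)
  define S where "S = (\<Sum>k<K. \<bar>coeff Q k\<bar>)"
  have S0: "S \<ge> 0" unfolding S_def by (simp add: sum_nonneg)
  \<comment> \<open>Chosen such that the lower derivatives return at most half of the top derivative.\<close>
  define \<delta> where "\<delta> = q / (2 * (S + 1))"
  have \<delta>: "\<delta> > 0" "S * \<delta> \<le> q / 2"
    unfolding \<delta>_def using q S0 by (auto simp: field_simps)
  define D where "D = (\<lambda>\<epsilon>::real. (2 * \<bar>C\<bar> + 2 * real K * M)\<^sup>2 + 1 / \<epsilon>)"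
  have D0: "\<And>\<epsilon>. \<epsilon> > 0 \<Longrightarrow> D \<epsilon> \<ge> 0" unfolding D_def by simp
  have "\<delta>\<^sup>2 > 0" using \<delta> by simp
  then obtain C0 where C0: "C0 \<ge> 0" "\<And>b k. convex_chain K D b \<Longrightarrow> k < K \<Longrightarrow> b k \<le> \<delta>\<^sup>2 * b K + C0 * b 0"
    using convex_chain_interpolation[where D = D and \<epsilon> = "\<delta>\<^sup>2" and m = K, OF D0] by blast
  define U where "U = l2norm (\<lambda>t. y t / of_real (v t))"
  define E where "E = sqrt C0 * l2norm (\<lambda>t. of_real (v t) * y t)"
  have E0: "E \<ge> 0" unfolding E_def using C0(1) by simp
  define A0 where "A0 = 2 / q * (norm z * U + S * E)"
  show ?thesis
  proof (intro exI[of _ "\<delta> * A0 + E"] allI impI)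
    fix \<eta> :: "real \<Rightarrow> real" and R k
    assume \<eta>: "\<eta> \<in> Ck K" and \<eta>b: "\<forall>t. 0 \<le> \<eta> t \<and> \<eta> t \<le> 1 \<and> \<bar>nderiv 1 \<eta> t\<bar> \<le> M"
      and \<eta>R: "\<forall>t. \<bar>t\<bar> > R \<longrightarrow> \<eta> t = 0" and k: "k < K"
    define p where "p k t = complex_of_real (v t * \<eta> t ^ k) * nderiv k y t" for k t
    have chain: "convex_chain K D (\<lambda>k. (l2norm (p k))\<^sup>2)"
      unfolding D_def p_def by (rule weighted_convex_chain[OF y vy \<eta>, of R]) (use \<eta>b \<eta>R in auto)
    have pc: "continuous_on UNIV (p k)" if "k \<le> K" for k
      unfolding p_def[abs_def] using Ck_continuous_nderiv[OF y that] Ck_continuous[OF v_Ck] Ck_continuous[OF \<eta>]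
      by (intro continuous_intros)
    have pL: "p k \<in> L2" if "k \<le> K" for k
    proof (cases "k = 0")
      case True then show ?thesis using vy by (simp add: p_def[abs_def])
    next
      case False
      then have "p k \<in> Ck0 0" unfolding Ck0_iff Ck_0 using pc[OF that] \<eta>R
        by (auto simp: p_def intro!: exI[of _ R])
      then show ?thesis by (rule Ck0_L2)
    qed
    have p0: "l2norm (p 0) = l2norm (\<lambda>t. of_real (v t) * y t)" by (simp add: p_def[abs_def])
    have pk: "l2norm (p k) \<le> \<delta> * l2norm (p K) + E" if "k < K" for k
    proof (rule power2_le_imp_le)
      have "(l2norm (p k))\<^sup>2 \<le> \<delta>\<^sup>2 * (l2norm (p K))\<^sup>2 + C0 * (l2norm (p 0))\<^sup>2" by (rule C0(2)[OF chain that])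
      also have "\<dots> = (\<delta> * l2norm (p K))\<^sup>2 + E\<^sup>2" unfolding E_def p0[symmetric] using C0(1) by (simp add: power_mult_distrib)
      also have "\<dots> \<le> (\<delta> * l2norm (p K) + E)\<^sup>2" using \<delta> E0 by (simp add: power2_sum)
      finally show "(l2norm (p k))\<^sup>2 \<le> (\<delta> * l2norm (p K) + E)\<^sup>2" .
    qed (use \<delta> E0 in simp)
    define h where "h t = of_real (norm z) * complex_of_real (norm (y t / of_real (v t)))
        + (\<Sum>k<K. of_real \<bar>coeff Q k\<bar> * complex_of_real (norm (p k t)))" for t
    have hL: "h \<in> L2" "(\<lambda>t. of_real (norm z) * complex_of_real (norm (y t / of_real (v t)))) \<in> L2"
      "(\<lambda>t. \<Sum>k<K. of_real \<bar>coeff Q k\<bar> * complex_of_real (norm (p k t))) \<in> L2"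
      unfolding h_def[abs_def] using L2_norm_of[OF u] pL L2_norm_of by (auto intro!: L2_add L2_sum L2_cmult)
    have "q * norm (p K t) \<le> norm (h t)" for t
    proof -
      have nn: "0 \<le> \<eta> t" "\<eta> t \<le> 1" using \<eta>b by auto
      have "q * (v t * norm (nderiv K y t)) \<le> norm z * norm (y t / of_real (v t)) + (\<Sum>k<K. \<bar>coeff Q k\<bar> * (v t * norm (nderiv k y t)))"
        unfolding q_def by (rule top_derivative_bound[OF eq])
      then have "\<eta> t ^ K * (q * (v t * norm (nderiv K y t)))
          \<le> \<eta> t ^ K * (norm z * norm (y t / of_real (v t)) + (\<Sum>k<K. \<bar>coeff Q k\<bar> * (v t * norm (nderiv k y t))))"
        using nn by (intro mult_left_mono) auto
      also have "\<dots> = \<eta> t ^ K * (norm z * norm (y t / of_real (v t))) + (\<Sum>k<K. \<eta> t ^ K * (\<bar>coeff Q k\<bar> * (v t * norm (nderiv k y t))))"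
        by (simp add: distrib_left sum_distrib_left)
      also have "\<dots> \<le> 1 * (norm z * norm (y t / of_real (v t))) + (\<Sum>k<K. \<eta> t ^ k * (\<bar>coeff Q k\<bar> * (v t * norm (nderiv k y t))))"
        using nn v_pos[of t] power_decreasing[of _ K "\<eta> t"]
        by (intro add_mono mult_right_mono sum_mono power_le_one) (auto simp: less_imp_le)
      also have "\<dots> = norm (h t)"
      proof -
        have "h t = complex_of_real (1 * (norm z * norm (y t / of_real (v t))) + (\<Sum>k<K. \<eta> t ^ k * (\<bar>coeff Q k\<bar> * (v t * norm (nderiv k y t)))))"
          unfolding h_def p_def using nn v_pos[of t] by (simp add: norm_mult norm_power abs_mult mult_ac)
        then show ?thesis unfolding norm_of_real using nn v_pos[of t]
          by (simp only: norm_of_real) (intro abs_of_nonneg[symmetric] add_nonneg_nonneg sum_nonneg mult_nonneg_nonneg, auto simp: less_imp_le)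
      qed
      finally show ?thesis unfolding p_def using nn v_pos[of t] by (simp add: norm_mult norm_power abs_mult mult_ac)
    qed
    then have "norm (p K t) \<le> norm (of_real (1 / q) * h t)" for t
      using q by (simp add: norm_mult norm_divide field_simps)
    then have "l2norm (p K) \<le> l2norm (\<lambda>t. of_real (1 / q) * h t)"
      using L2_measurable[OF pL[OF order_refl]] by (intro l2norm_mono L2_cmult hL)
    also have "\<dots> = 1 / q * l2norm h" using q by (simp add: l2norm_cmult del: of_real_divide)
    finally have aK: "q * l2norm (p K) \<le> l2norm h" using q by (simp add: field_simps)
    have "l2norm h \<le> norm z * U + (\<Sum>k<K. \<bar>coeff Q k\<bar> * l2norm (p k))"
    proof -
      have "l2norm h \<le> l2norm (\<lambda>t. of_real (norm z) * complex_of_real (norm (y t / of_real (v t))))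
          + l2norm (\<lambda>t. \<Sum>k<K. of_real \<bar>coeff Q k\<bar> * complex_of_real (norm (p k t)))"
        unfolding h_def[abs_def] by (rule l2norm_triangle[OF hL(2,3)])
      also have "l2norm (\<lambda>t. of_real (norm z) * complex_of_real (norm (y t / of_real (v t)))) = norm z * U"
        unfolding l2norm_cmult l2norm_norm_of U_def by simp
      also have "l2norm (\<lambda>t. \<Sum>k<K. of_real \<bar>coeff Q k\<bar> * complex_of_real (norm (p k t))) \<le> (\<Sum>k<K. l2norm (\<lambda>t. of_real \<bar>coeff Q k\<bar> * complex_of_real (norm (p k t))))"
        by (intro l2norm_sum_le L2_cmult L2_norm_of pL) auto
      also have "\<dots> = (\<Sum>k<K. \<bar>coeff Q k\<bar> * l2norm (p k))"
        unfolding l2norm_cmult l2norm_norm_of by simp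
      finally show ?thesis by simp
    qed
    also have "(\<Sum>k<K. \<bar>coeff Q k\<bar> * l2norm (p k)) \<le> (\<Sum>k<K. \<bar>coeff Q k\<bar> * (\<delta> * l2norm (p K) + E))"
      using pk by (intro sum_mono mult_left_mono) auto
    also have "\<dots> = S * (\<delta> * l2norm (p K) + E)" unfolding S_def by (rule sum_distrib_right[symmetric])
    also have "\<dots> = S * \<delta> * l2norm (p K) + S * E" by (simp add: algebra_simps)
    also have "S * \<delta> * l2norm (p K) \<le> q / 2 * l2norm (p K)"
      using \<delta>(2) by (rule mult_right_mono) simp
    finally have "q * l2norm (p K) \<le> norm z * U + (q / 2 * l2norm (p K) + S * E)" using aK by simp
    then have "l2norm (p K) \<le> A0" unfolding A0_def using q by (simp add: field_simps)
    then have "\<delta> * l2norm (p K) \<le> \<delta> * A0" using \<delta> by (intro mult_left_mono) auto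
    then show "l2norm (\<lambda>t. of_real (v t * \<eta> t ^ k) * nderiv k y t) \<le> \<delta> * A0 + E"
      using pk[OF k] unfolding p_def by linarith
  qed
qed

lemma weighted_derivatives_L2:
  assumes y: "y \<in> Ck K" and u: "(\<lambda>t. y t / of_real (v t)) \<in> L2"
    and eq: "\<And>t. polyD Q y t = z * y t / of_real (v t * v t)" and k: "k < K"
  shows "(\<lambda>t. of_real (v t) * nderiv k y t) \<in> L2"
proof -
  obtain M and \<eta> :: "nat \<Rightarrow> real \<Rightarrow> real" where \<eta>: "M > 0"
    "\<And>n. n \<ge> 1 \<Longrightarrow> \<eta> n \<in> Ck K" "\<And>n x. 0 \<le> \<eta> n x" "\<And>n x. \<eta> n x \<le> 1"
    "\<And>n x. n \<ge> 1 \<Longrightarrow> \<bar>x\<bar> \<le> real n \<Longrightarrow> \<eta> n x = 1"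
    "\<And>n x. n \<ge> 1 \<Longrightarrow> \<bar>x\<bar> \<ge> real n * (1 + 1) \<Longrightarrow> \<eta> n x = 0"
    "\<And>n j x. n \<ge> 1 \<Longrightarrow> j \<le> K \<Longrightarrow> \<bar>nderiv j (\<eta> n) x\<bar> \<le> M"
    "\<And>n j x. n \<ge> 1 \<Longrightarrow> j \<ge> 1 \<Longrightarrow> \<bar>x\<bar> < real n \<Longrightarrow> nderiv j (\<eta> n) x = 0"
    by (rule cutoff_family[where \<delta> = 1 and K = K, OF zero_less_one]) (rule that; blast)
  obtain B where B: "\<And>\<eta> R k. \<eta> \<in> Ck K \<Longrightarrow> (\<forall>t. 0 \<le> \<eta> t \<and> \<eta> t \<le> 1 \<and> \<bar>nderiv 1 \<eta> t\<bar> \<le> M) \<Longrightarrow>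
      (\<forall>t. \<bar>t\<bar> > R \<longrightarrow> \<eta> t = 0) \<Longrightarrow> k < K \<Longrightarrow> l2norm (\<lambda>t. of_real (v t * \<eta> t ^ k) * nderiv k y t) \<le> B"
    using weighted_derivatives_bounded[OF y u eq, of M] by blast
  define f where "f n t = complex_of_real (v t * \<eta> (Suc n) t ^ k) * nderiv k y t" for n t
  have fB: "l2norm (f n) \<le> B" for n
    unfolding f_def[abs_def]
  proof (rule B[OF \<eta>(2) _ _ k, of _ "real (Suc n) * (1 + 1)"])
    show "\<forall>t. 0 \<le> \<eta> (Suc n) t \<and> \<eta> (Suc n) t \<le> 1 \<and> \<bar>nderiv 1 (\<eta> (Suc n)) t\<bar> \<le> M"
      using \<eta>(3,4) \<eta>(7)[of "Suc n" 1] deg_ge_2 by auto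
    show "\<forall>t. real (Suc n) * (1 + 1) < \<bar>t\<bar> \<longrightarrow> \<eta> (Suc n) t = 0" using \<eta>(6)[of "Suc n"] by auto
  qed simp
  have vy: "(\<lambda>t. of_real (v t) * y t) \<in> L2"
    using v_mult_L2[OF v_mult_L2[OF u]] v_nonzero by simp
  have kc: "continuous_on UNIV (nderiv k y)" using Ck_continuous_nderiv[OF y] k by simp
  have fc: "continuous_on UNIV (f n)" for n
    unfolding f_def[abs_def] using kc Ck_continuous[OF v_Ck] Ck_continuous[OF \<eta>(2)] by (intro continuous_intros) auto
  have fL: "f n \<in> L2" for n
  proof (cases "k = 0")
    case True then show ?thesis using vy by (simp add: f_def[abs_def])
  next
    case False
    then have "f n \<in> Ck0 0" unfolding Ck0_iff Ck_0 using fc \<eta>(6)[of "Suc n"]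
      by (auto simp: f_def intro!: exI[of _ "real (Suc n) * (1 + 1)"])
    then show ?thesis by (rule Ck0_L2)
  qed
  note [measurable] = fL[THEN L2_measurable]
  have gm [measurable]: "(\<lambda>t. complex_of_real (v t) * nderiv k y t) \<in> borel_measurable borel"
    using kc Ck_continuous[OF v_Ck] by (intro borel_measurable_continuous_onI continuous_intros)
  have lim: "(\<lambda>n. ennreal ((norm (f n t))\<^sup>2)) \<longlonglongrightarrow> ennreal ((norm (of_real (v t) * nderiv k y t))\<^sup>2)" for t
  proof (rule tendsto_eventually)
    obtain N :: nat where N: "\<bar>t\<bar> < real N" using reals_Archimedean2 by blast
    show "eventually (\<lambda>n. ennreal ((norm (f n t))\<^sup>2) = ennreal ((norm (of_real (v t) * nderiv k y t))\<^sup>2)) sequentially"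
      unfolding eventually_sequentially
    proof (intro exI[of _ N] allI impI)
      fix n assume "N \<le> n"
      then have "\<bar>t\<bar> \<le> real (Suc n)" using N by linarith
      then have "\<eta> (Suc n) t = 1" by (intro \<eta>(5)) auto
      then show "ennreal ((norm (f n t))\<^sup>2) = ennreal ((norm (of_real (v t) * nderiv k y t))\<^sup>2)" by (simp add: f_def)
    qed
  qed
  have "(\<integral>\<^sup>+t. ennreal ((norm (of_real (v t) * nderiv k y t))\<^sup>2) \<partial>lborel)
      = (\<integral>\<^sup>+t. liminf (\<lambda>n. ennreal ((norm (f n t))\<^sup>2)) \<partial>lborel)"
    using lim_imp_Liminf[OF trivial_limit_sequentially lim] by simp
  also have "\<dots> \<le> liminf (\<lambda>n. \<integral>\<^sup>+t. ennreal ((norm (f n t))\<^sup>2) \<partial>lborel)"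
    by (rule nn_integral_liminf) measurable
  also have "\<dots> \<le> ennreal (B\<^sup>2)"
  proof (rule Liminf_le)
    show "eventually (\<lambda>n. (\<integral>\<^sup>+t. ennreal ((norm (f n t))\<^sup>2) \<partial>lborel) \<le> ennreal (B\<^sup>2)) sequentially"
    proof (rule always_eventually, rule allI)
      fix n
      have "(\<integral>\<^sup>+t. ennreal ((norm (f n t))\<^sup>2) \<partial>lborel) = ennreal ((l2norm (f n))\<^sup>2)"
        unfolding l2norm_power2 using L2_integrable[OF fL] by (intro nn_integral_eq_integral) auto
      also have "\<dots> \<le> ennreal (B\<^sup>2)" using fB[of n] by (intro ennreal_leI power_mono) auto
      finally show "(\<integral>\<^sup>+t. ennreal ((norm (f n t))\<^sup>2) \<partial>lborel) \<le> ennreal (B\<^sup>2)" .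
    qed
  qed simp
  finally have fin: "(\<integral>\<^sup>+t. ennreal ((norm (of_real (v t) * nderiv k y t))\<^sup>2) \<partial>lborel) \<le> ennreal (B\<^sup>2)" .
  show ?thesis
  proof (rule L2I[OF gm])
    show "integrable lborel (\<lambda>t. (norm (of_real (v t) * nderiv k y t))\<^sup>2)"
    proof (rule integrableI_nonneg)
      show "(\<lambda>t. (norm (of_real (v t) * nderiv k y t))\<^sup>2) \<in> borel_measurable lborel" by measurable
      show "(\<integral>\<^sup>+t. ennreal ((norm (of_real (v t) * nderiv k y t))\<^sup>2) \<partial>lborel) < \<infinity>"
        using le_less_trans[OF fin ennreal_less_top] by simp
    qed auto
  qed
qed

text \<open>A square-integrable classical solution is thus approximated by its cutoffs in the graph norm:
  the commutator with the cutoff only involves the lower derivatives in the tail.\<close>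

lemma classical_solution_approximation:
  assumes y: "y \<in> Ck K" and u: "(\<lambda>t. y t / of_real (v t)) \<in> L2"
    and eq: "\<And>t. polyD Q y t = z * y t / of_real (v t * v t)"
  obtains g where "\<And>n::nat. g n \<in> Ck0 K" "(\<lambda>n. l2norm (\<lambda>t. g n t - y t / of_real (v t))) \<longlonglongrightarrow> 0"
    "(\<lambda>n. l2norm (\<lambda>t. A (g n) t - z * g n t)) \<longlonglongrightarrow> 0"
proof -
  obtain M and \<eta> :: "nat \<Rightarrow> real \<Rightarrow> real" where \<eta>: "M > 0"
    "\<And>n. n \<ge> 1 \<Longrightarrow> \<eta> n \<in> Ck K" "\<And>n x. 0 \<le> \<eta> n x" "\<And>n x. \<eta> n x \<le> 1"
    "\<And>n x. n \<ge> 1 \<Longrightarrow> \<bar>x\<bar> \<le> real n \<Longrightarrow> \<eta> n x = 1"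
    "\<And>n x. n \<ge> 1 \<Longrightarrow> \<bar>x\<bar> \<ge> real n * (1 + 1) \<Longrightarrow> \<eta> n x = 0"
    "\<And>n j x. n \<ge> 1 \<Longrightarrow> j \<le> K \<Longrightarrow> \<bar>nderiv j (\<eta> n) x\<bar> \<le> M"
    "\<And>n j x. n \<ge> 1 \<Longrightarrow> j \<ge> 1 \<Longrightarrow> \<bar>x\<bar> < real n \<Longrightarrow> nderiv j (\<eta> n) x = 0"
    by (rule cutoff_family[where \<delta> = 1 and K = K, OF zero_less_one]) (rule that; blast)
  define u' where "u' t = y t / complex_of_real (v t)" for t
  have u'L: "u' \<in> L2" using u by (simp add: u'_def[abs_def])
  have u'C: "u' \<in> Ck K"
  proof -
    have "(\<lambda>t. complex_of_real (inverse (v t)) * y t) \<in> Ck K"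
      by (intro Ck_mult Ck_of_real Ck_inverse v_Ck v_nonzero y)
    then show ?thesis by (simp add: u'_def[abs_def] field_simps)
  qed
  define g where "g n t = complex_of_real (\<eta> (Suc n) t) * u' t" for n t
  have gC: "g n \<in> Ck0 K" for n
  proof -
    have "(\<lambda>t. complex_of_real (\<eta> (Suc n) t)) \<in> Ck0 K"
      unfolding Ck0_iff using Ck_of_real[OF \<eta>(2)] \<eta>(6)[of "Suc n"] by (auto intro!: exI[of _ "real (Suc n) * (1 + 1)"])
    then show ?thesis unfolding g_def[abs_def] by (rule Ck0_mult_left[OF _ u'C])
  qed
  note [measurable] = L2_measurable[OF u'L] Ck0_L2[OF gC, THEN L2_measurable] L2_measurable[OF A_L2[OF gC]]
  have lim1: "(\<lambda>n. l2norm (\<lambda>t. g n t - u' t)) \<longlonglongrightarrow> 0"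
  proof (rule tendsto_sandwich[OF _ _ tendsto_const LIMSEQ_Suc[OF L2_tail_tendsto_0[OF u'L]]])
    show "eventually (\<lambda>n. l2norm (\<lambda>t. g n t - u' t) \<le> l2norm (\<lambda>t. indicator {t. real (Suc n) \<le> \<bar>t\<bar>} t * u' t)) sequentially"
    proof (rule always_eventually, rule allI, rule l2norm_mono)
      fix n
      show "(\<lambda>t. indicator {t. real (Suc n) \<le> \<bar>t\<bar>} t * u' t) \<in> L2"
        by (rule L2_dominated(1)[OF u'L, of _ 1]) (auto simp: indicator_def)
      show "norm (g n t - u' t) \<le> norm (indicator {t. real (Suc n) \<le> \<bar>t\<bar>} t * u' t)" for t
      proof (cases "real (Suc n) \<le> \<bar>t\<bar>")
        case True
        have "g n t - u' t = complex_of_real (\<eta> (Suc n) t - 1) * u' t" by (simp add: g_def algebra_simps)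
        then have "norm (g n t - u' t) = \<bar>\<eta> (Suc n) t - 1\<bar> * norm (u' t)" by (simp add: norm_mult del: of_real_diff)
        also have "\<dots> \<le> 1 * norm (u' t)" using \<eta>(3,4)[of "Suc n" t] by (intro mult_right_mono) auto
        finally show ?thesis using True by simp
      next
        case False
        then have "\<eta> (Suc n) t = 1" by (intro \<eta>(5)) auto
        then show ?thesis by (simp add: g_def)
      qed
    qed measurable
  qed simp
  define S where "S = (\<Sum>k\<le>K. \<bar>coeff Q k\<bar> * (2 ^ k * M))"
  have S0: "S \<ge> 0" unfolding S_def using \<eta>(1) by (intro sum_nonneg) auto
  define H where "H t = of_real S * (\<Sum>j<K. complex_of_real (norm (complex_of_real (v t) * nderiv j y t)))" for t
  have HL: "H \<in> L2" unfolding H_def[abs_def]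
    by (intro L2_cmult L2_sum L2_norm_of weighted_derivatives_L2[OF y u eq]) auto
  note [measurable] = L2_measurable[OF HL]
  have Hn: "norm (H t) = S * (\<Sum>j<K. v t * norm (nderiv j y t))" for t
  proof -
    have "H t = complex_of_real (S * (\<Sum>j<K. v t * norm (nderiv j y t)))"
      unfolding H_def using v_pos[of t] by (simp add: norm_mult)
    then show ?thesis using S0 v_pos[of t] by (simp add: sum_nonneg abs_of_nonneg less_imp_le del: of_real_mult of_real_sum)
  qed
  have comm: "norm (A (g n) t - z * g n t) \<le> norm (indicator {t. real (Suc n) \<le> \<bar>t\<bar>} t * H t)" for n t
  proof -
    let ?\<eta> = "\<lambda>t. complex_of_real (\<eta> (Suc n) t)"
    have \<eta>C: "?\<eta> \<in> Ck K" using Ck_of_real[OF \<eta>(2)] by simp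
    have vg: "(\<lambda>s. complex_of_real (v s) * g n s) = (\<lambda>s. ?\<eta> s * y s)"
      unfolding g_def u'_def using v_nonzero by (auto simp: field_simps)
    have "A (g n) t - z * g n t = of_real (v t) * (polyD Q (\<lambda>s. ?\<eta> s * y s) t - ?\<eta> t * polyD Q y t)"
      unfolding A_def vg unfolding eq g_def u'_def using v_nonzero[of t] by (simp add: field_simps)
    also have "polyD Q (\<lambda>s. ?\<eta> s * y s) t - ?\<eta> t * polyD Q y t
        = (\<Sum>k\<le>K. of_real (coeff Q k) * \<i> ^ k * (nderiv k (\<lambda>s. ?\<eta> s * y s) t - ?\<eta> t * nderiv k y t))"
      unfolding polyD_def by (simp add: sum_distrib_left sum_subtractf[symmetric] algebra_simps)
    finally have e: "norm (A (g n) t - z * g n t) = v t * norm (\<Sum>k\<le>K. of_real (coeff Q k) * \<i> ^ k * (nderiv k (\<lambda>s. ?\<eta> s * y s) t - ?\<eta> t * nderiv k y t))"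
      using v_pos[of t] by (simp add: norm_mult)
    define m where "m = (if real (Suc n) \<le> \<bar>t\<bar> then M else 0)"
    have m0: "m \<ge> 0" using \<eta>(1) by (simp add: m_def)
    have dm: "norm (nderiv j ?\<eta> t) \<le> m" if "1 \<le> j" "j \<le> K" for j
      using \<eta>(7)[of "Suc n" j t] \<eta>(8)[of "Suc n" j t] that nderiv_of_real[OF \<eta>(2) that(2), of "Suc n" t]
      by (auto simp: m_def)
    have summand: "norm (of_real (coeff Q k) * \<i> ^ k * (nderiv k (\<lambda>s. ?\<eta> s * y s) t - ?\<eta> t * nderiv k y t))
        \<le> \<bar>coeff Q k\<bar> * (2 ^ k * m) * (\<Sum>j<K. norm (nderiv j y t))" if k: "k \<le> K" for k
    proof -
      have "norm (nderiv k (\<lambda>s. ?\<eta> s * y s) t - ?\<eta> t * nderiv k y t) \<le> 2 ^ k * m * (\<Sum>j<k. norm (nderiv j y t))"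
        using Ck_mono[OF \<eta>C k] Ck_mono[OF y k] by (rule nderiv_commutator_bound) (use dm k in auto)
      also have "\<dots> \<le> 2 ^ k * m * (\<Sum>j<K. norm (nderiv j y t))"
        using m0 k by (intro mult_left_mono sum_mono2) auto
      finally have "\<bar>coeff Q k\<bar> * norm (nderiv k (\<lambda>s. ?\<eta> s * y s) t - ?\<eta> t * nderiv k y t)
          \<le> \<bar>coeff Q k\<bar> * (2 ^ k * m * (\<Sum>j<K. norm (nderiv j y t)))" by (rule mult_left_mono) simp
      then show ?thesis by (simp add: norm_mult norm_power mult_ac)
    qed
    have "norm (\<Sum>k\<le>K. of_real (coeff Q k) * \<i> ^ k * (nderiv k (\<lambda>s. ?\<eta> s * y s) t - ?\<eta> t * nderiv k y t))
        \<le> (\<Sum>k\<le>K. \<bar>coeff Q k\<bar> * (2 ^ k * m) * (\<Sum>j<K. norm (nderiv j y t)))"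
      by (rule sum_norm_le) (use summand in auto)
    also have "\<dots> = (\<Sum>k\<le>K. \<bar>coeff Q k\<bar> * (2 ^ k * m)) * (\<Sum>j<K. norm (nderiv j y t))"
      by (simp add: sum_distrib_right)
    finally have "norm (A (g n) t - z * g n t) \<le> v t * ((\<Sum>k\<le>K. \<bar>coeff Q k\<bar> * (2 ^ k * m)) * (\<Sum>j<K. norm (nderiv j y t)))"
      unfolding e using v_pos[of t] by (intro mult_left_mono) auto
    also have "\<dots> = (\<Sum>k\<le>K. \<bar>coeff Q k\<bar> * (2 ^ k * m)) * (\<Sum>j<K. v t * norm (nderiv j y t))"
      by (simp add: sum_distrib_left mult_ac)
    also have "\<dots> = norm (indicator {t. real (Suc n) \<le> \<bar>t\<bar>} t * H t)"
      unfolding norm_mult Hn by (simp add: m_def S_def indicator_def)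
    finally show ?thesis .
  qed
  have lim2: "(\<lambda>n. l2norm (\<lambda>t. A (g n) t - z * g n t)) \<longlonglongrightarrow> 0"
  proof (rule tendsto_sandwich[OF _ _ tendsto_const LIMSEQ_Suc[OF L2_tail_tendsto_0[OF HL]]])
    show "eventually (\<lambda>n. l2norm (\<lambda>t. A (g n) t - z * g n t) \<le> l2norm (\<lambda>t. indicator {t. real (Suc n) \<le> \<bar>t\<bar>} t * H t)) sequentially"
    proof (rule always_eventually, rule allI, rule l2norm_mono)
      fix n
      show "(\<lambda>t. indicator {t. real (Suc n) \<le> \<bar>t\<bar>} t * H t) \<in> L2"
        by (rule L2_dominated(1)[OF HL, of _ 1]) (auto simp: indicator_def)
      show "(\<lambda>t. A (g n) t - z * g n t) \<in> borel_measurable borel" by measurable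
      show "norm (A (g n) t - z * g n t) \<le> norm (indicator {t. real (Suc n) \<le> \<bar>t\<bar>} t * H t)" for t by (rule comm)
    qed
  qed simp
  show ?thesis using that[OF gC lim1[unfolded u'_def] lim2] .
qed

definition bounded_below :: "complex \<Rightarrow> bool" where
  "bounded_below z \<longleftrightarrow> (\<exists>c. \<forall>g\<in>Ck0 K. l2norm g \<le> c * l2norm (\<lambda>t. A g t - z * g t))"

text \<open>This is the core of essential self-adjointness: what is orthogonal to the range of
  \<open>A - z\<close> is a weak, hence classical, solution of the adjoint equation, and so lies in the domain of
  the closure; it vanishes if \<open>A - cnj z\<close> is bounded below.\<close>

lemma orthogonal_to_range:
  assumes bb: "bounded_below (cnj z)" and u: "u \<in> L2"
    and orth: "\<And>g. g \<in> Ck0 K \<Longrightarrow> ip (\<lambda>t. A g t - z * g t) u = 0"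
  shows "AE t in lborel. u t = 0"
proof -
  define W where "W t = cnj (u t) * of_real (v t)" for t
  have WL: "W \<in> L2" using v_mult_L2[OF L2_cnj[OF u]] by (simp add: W_def[abs_def] mult.commute)
  have Wl: "loc_int W" by (rule L2_loc_int[OF WL])
  define V where "V t = - z * complex_of_real (inverse (v t) * inverse (v t))" for t
  have VC: "V \<in> Ck K" unfolding V_def[abs_def]
    by (intro Ck_mult Ck_const Ck_of_real Ck_inverse v_Ck v_nonzero)
  define \<alpha> where "\<alpha> k = complex_of_real (coeff Q k) * \<i> ^ k" for k
  have "coeff Q K \<noteq> 0" using lead_pos by linarith
  then have \<alpha>K: "\<alpha> K \<noteq> 0" by (simp add: \<alpha>_def del: leading_coeff_0_iff)
  have weak: "(\<Sum>k\<le>K. \<alpha> k * (LINT t|lborel. nderiv k \<phi> t * W t)) + (LINT t|lborel. \<phi> t * (V t * W t)) = 0"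
    if \<phi>: "\<phi> \<in> Ck0 K" for \<phi>
  proof -
    define g where "g t = complex_of_real (inverse (v t)) * \<phi> t" for t
    have g: "g \<in> Ck0 K" unfolding g_def[abs_def]
      by (intro Ck0_mult_right Ck_of_real Ck_inverse v_Ck v_nonzero \<phi>)
    have vg: "(\<lambda>s. complex_of_real (v s) * g s) = \<phi>" unfolding g_def using v_nonzero by auto
    have i: "integrable lborel (\<lambda>t. nderiv k \<phi> t * W t)" if "k \<le> K" for k
      by (rule integrable_nderiv_loc_int[OF \<phi> that Wl])
    have iV: "integrable lborel (\<lambda>t. \<phi> t * (V t * W t))"
      using integrable_nderiv_loc_int[OF \<phi> _ loc_int_mult_continuous[OF Wl Ck_continuous[OF VC]], of 0] by simp
    have "0 = (LINT t|lborel. (A g t - z * g t) * cnj (u t))" using orth[OF g] by (simp add: ip_def)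
    also have "\<dots> = (LINT t|lborel. (\<Sum>k\<le>K. \<alpha> k * (nderiv k \<phi> t * W t)) + \<phi> t * (V t * W t))"
    proof (rule Bochner_Integration.integral_cong[OF refl])
      fix t
      have "(A g t - z * g t) * cnj (u t) = polyD Q \<phi> t * W t + \<phi> t * (V t * W t)"
        unfolding A_def vg unfolding W_def V_def g_def using v_nonzero[of t] by (simp add: field_simps)
      also have "polyD Q \<phi> t * W t = (\<Sum>k\<le>K. \<alpha> k * (nderiv k \<phi> t * W t))"
        unfolding polyD_def \<alpha>_def by (simp add: sum_distrib_right mult.assoc)
      finally show "(A g t - z * g t) * cnj (u t) = (\<Sum>k\<le>K. \<alpha> k * (nderiv k \<phi> t * W t)) + \<phi> t * (V t * W t)" .
    qed
    also have "\<dots> = (LINT t|lborel. (\<Sum>k\<le>K. \<alpha> k * (nderiv k \<phi> t * W t))) + (LINT t|lborel. \<phi> t * (V t * W t))"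
      using i by (intro Bochner_Integration.integral_add iV Bochner_Integration.integrable_sum integrable_mult_right) auto
    also have "(LINT t|lborel. (\<Sum>k\<le>K. \<alpha> k * (nderiv k \<phi> t * W t))) = (\<Sum>k\<le>K. LINT t|lborel. \<alpha> k * (nderiv k \<phi> t * W t))"
      using i by (intro Bochner_Integration.integral_sum integrable_mult_right) auto
    finally show ?thesis by simp
  qed
  obtain w where w: "w \<in> Ck K" "AE t in lborel. W t = w t"
    "\<And>t. (\<Sum>k\<le>K. (-1) ^ k * \<alpha> k * nderiv k w t) + V t * w t = 0"
    using weak_solution_regularity[OF Wl VC _ \<alpha>K weak] deg_ge_2 by auto
  define y where "y t = cnj (w t)" for t
  have yC: "y \<in> Ck K" unfolding y_def[abs_def] by (rule Ck_cnj[OF w(1)])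
  have eq: "polyD Q y t = cnj z * y t / of_real (v t * v t)" for t
  proof -
    have "polyD Q y t = cnj (\<Sum>k\<le>K. (-1) ^ k * \<alpha> k * nderiv k w t)"
    proof -
      have "of_real (coeff Q k) * \<i> ^ k * nderiv k y t = cnj ((-1) ^ k * \<alpha> k * nderiv k w t)" if "k \<le> K" for k
      proof -
        have "(-1) ^ k * (- \<i>) ^ k = (\<i> ^ k :: complex)" by (simp add: power_mult_distrib[symmetric])
        then show ?thesis unfolding y_def[abs_def] nderiv_cnj[OF w(1) that] \<alpha>_def
          by (simp add: mult_ac)
      qed
      then show ?thesis unfolding polyD_def cnj_sum by (intro sum.cong) auto
    qed
    also have "(\<Sum>k\<le>K. (-1) ^ k * \<alpha> k * nderiv k w t) = - (V t * w t)"
      using w(3)[of t] by (simp add: eq_neg_iff_add_eq_0)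
    finally show ?thesis unfolding V_def y_def using v_nonzero[of t] by (simp add: field_simps)
  qed
  have ae: "AE t in lborel. y t / of_real (v t) = u t"
    using w(2)
  proof eventually_elim
    case (elim t)
    then have "y t = u t * of_real (v t)" unfolding y_def W_def by (metis complex_cnj_cnj complex_cnj_complex_of_real complex_cnj_mult)
    then show ?case using v_nonzero[of t] by simp
  qed
  have um: "(\<lambda>t. y t / of_real (v t)) \<in> borel_measurable borel"
    using Ck_continuous[OF yC, of UNIV] Ck_continuous[OF v_Ck, of UNIV] v_nonzero
    by (intro borel_measurable_continuous_onI continuous_intros) auto
  have u'L: "(\<lambda>t. y t / of_real (v t)) \<in> L2" by (rule L2_cong_AE[OF u um ae])
  obtain g where g: "\<And>n::nat. g n \<in> Ck0 K" "(\<lambda>n. l2norm (\<lambda>t. g n t - y t / of_real (v t))) \<longlonglongrightarrow> 0"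
    "(\<lambda>n. l2norm (\<lambda>t. A (g n) t - cnj z * g n t)) \<longlonglongrightarrow> 0"
    using classical_solution_approximation[OF yC u'L eq] by blast
  obtain c where c: "\<And>g. g \<in> Ck0 K \<Longrightarrow> l2norm g \<le> c * l2norm (\<lambda>t. A g t - cnj z * g t)"
    using bb unfolding bounded_below_def by blast
  have "(\<lambda>n. l2norm (g n)) \<longlonglongrightarrow> 0"
  proof (rule tendsto_sandwich[OF _ _ tendsto_const])
    show "(\<lambda>n. c * l2norm (\<lambda>t. A (g n) t - cnj z * g n t)) \<longlonglongrightarrow> 0"
      using tendsto_mult_right_zero[OF g(3)] .
  qed (use c g(1) in auto)
  moreover have "(\<lambda>n. l2norm (g n)) \<longlonglongrightarrow> l2norm (\<lambda>t. y t / of_real (v t))"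
    by (rule l2norm_tendsto[OF Ck0_L2[OF g(1)] u'L g(2)])
  ultimately have "l2norm (\<lambda>t. y t / of_real (v t)) = 0" by (metis LIMSEQ_unique)
  then have "AE t in lborel. y t / of_real (v t) = 0" using l2norm_eq_0_iff[OF u'L] by simp
  then show ?thesis using ae by eventually_elim simp
qed

end


context weighted_op
begin

section \<open>Closure and resolvent\<close>

lemma op_A_iff:
  "(g, h) \<in> op_A v Q \<longleftrightarrow> g \<in> L2 \<and> h \<in> L2 \<and> (\<exists>u. (\<forall>n::nat. u n \<in> Ck0 K) \<and>
     (\<lambda>n. l2norm (\<lambda>t. u n t - g t)) \<longlonglongrightarrow> 0 \<and> (\<lambda>n. l2norm (\<lambda>t. A (u n) t - h t)) \<longlonglongrightarrow> 0)"
proof -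
  have "(\<exists>u w. (\<forall>n. (u n, w n) \<in> op_A0 v Q) \<and>
        (\<lambda>n::nat. l2norm (\<lambda>t. u n t - g t)) \<longlonglongrightarrow> 0 \<and> (\<lambda>n. l2norm (\<lambda>t. w n t - h t)) \<longlonglongrightarrow> 0)
    \<longleftrightarrow> (\<exists>u. (\<forall>n::nat. u n \<in> Ck0 K) \<and>
     (\<lambda>n. l2norm (\<lambda>t. u n t - g t)) \<longlonglongrightarrow> 0 \<and> (\<lambda>n. l2norm (\<lambda>t. A (u n) t - h t)) \<longlonglongrightarrow> 0)" (is "?L \<longleftrightarrow> ?R")
  proof
    assume ?L
    then obtain u w where u: "\<And>n. (u n, w n) \<in> op_A0 v Q"
      "(\<lambda>n::nat. l2norm (\<lambda>t. u n t - g t)) \<longlonglongrightarrow> 0" "(\<lambda>n. l2norm (\<lambda>t. w n t - h t)) \<longlonglongrightarrow> 0" by blast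
    have "u n \<in> Ck0 K \<and> w n = A (u n)" for n using u(1)[of n] unfolding op_A0_eq by blast
    then show ?R using u(2,3) by (intro exI[of _ u]) auto
  next
    assume ?R
    then obtain u where u: "\<And>n::nat. u n \<in> Ck0 K" "(\<lambda>n. l2norm (\<lambda>t. u n t - g t)) \<longlonglongrightarrow> 0"
      "(\<lambda>n. l2norm (\<lambda>t. A (u n) t - h t)) \<longlonglongrightarrow> 0" by blast
    then show ?L unfolding op_A0_eq by (intro exI[of _ u] exI[of _ "\<lambda>n. A (u n)"]) auto
  qed
  then show ?thesis unfolding op_A_def graph_closure_def by auto
qed

lemma op_A_Ck0: "g \<in> Ck0 K \<Longrightarrow> (g, A g) \<in> op_A v Q"
  unfolding op_A_iff using Ck0_L2 A_L2
  by (auto intro!: exI[of _ "\<lambda>_. g"] simp: l2norm_def)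

lemma op_A_approx:
  assumes "(g, h) \<in> op_A v Q" "e > 0"
  obtains u where "u \<in> Ck0 K" "l2norm (\<lambda>t. u t - g t) < e" "l2norm (\<lambda>t. A u t - h t) < e"
proof -
  obtain u where u: "\<And>n::nat. u n \<in> Ck0 K" "(\<lambda>n. l2norm (\<lambda>t. u n t - g t)) \<longlonglongrightarrow> 0"
    "(\<lambda>n. l2norm (\<lambda>t. A (u n) t - h t)) \<longlonglongrightarrow> 0" using assms(1) unfolding op_A_iff by blast
  have "eventually (\<lambda>n. l2norm (\<lambda>t. u n t - g t) < e \<and> l2norm (\<lambda>t. A (u n) t - h t) < e) sequentially"
    using order_tendstoD(2)[OF u(2) assms(2)] order_tendstoD(2)[OF u(3) assms(2)] by (rule eventually_conj)
  then obtain n where "l2norm (\<lambda>t. u n t - g t) < e \<and> l2norm (\<lambda>t. A (u n) t - h t) < e"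
    unfolding eventually_sequentially by blast
  then show ?thesis using that u(1) by blast
qed

lemma shifted_limit:
  assumes u: "\<And>n::nat. u n \<in> Ck0 K" and g: "g \<in> L2" and h: "h \<in> L2"
    and lim: "(\<lambda>n. l2norm (\<lambda>t. u n t - g t)) \<longlonglongrightarrow> 0" "(\<lambda>n. l2norm (\<lambda>t. A (u n) t - h t)) \<longlonglongrightarrow> 0"
  shows "(\<lambda>n. l2norm (\<lambda>t. (A (u n) t - z * u n t) - (h t - z * g t))) \<longlonglongrightarrow> 0"
proof (rule tendsto_sandwich[OF _ _ tendsto_const])
  show "(\<lambda>n. l2norm (\<lambda>t. A (u n) t - h t) + norm z * l2norm (\<lambda>t. u n t - g t)) \<longlonglongrightarrow> 0"
    using tendsto_add[OF lim(2) tendsto_mult_right_zero[OF lim(1), of "norm z"]] by simp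
  have "l2norm (\<lambda>t. (A (u n) t - z * u n t) - (h t - z * g t)) \<le> l2norm (\<lambda>t. A (u n) t - h t) + norm z * l2norm (\<lambda>t. u n t - g t)" for n
  proof -
    have L: "(\<lambda>t. A (u n) t - h t) \<in> L2" "(\<lambda>t. u n t - g t) \<in> L2"
      using A_L2[OF u] Ck0_L2[OF u] g h by (auto intro: L2_diff)
    have "(\<lambda>t. (A (u n) t - z * u n t) - (h t - z * g t)) = (\<lambda>t. (A (u n) t - h t) - z * (u n t - g t))"
      by (simp add: algebra_simps)
    then show ?thesis using l2norm_triangle4[OF L(1) L2_cmult[OF L(2), of z]] by (simp add: l2norm_cmult)
  qed
  then show "eventually (\<lambda>n. l2norm (\<lambda>t. (A (u n) t - z * u n t) - (h t - z * g t))
      \<le> l2norm (\<lambda>t. A (u n) t - h t) + norm z * l2norm (\<lambda>t. u n t - g t)) sequentially" by simp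
qed simp

lemma op_A_symmetric:
  assumes "(g, h) \<in> op_A v Q" "(g', h') \<in> op_A v Q"
  shows "ip h g' = ip g h'"
proof -
  have L: "g \<in> L2" "h \<in> L2" "g' \<in> L2" "h' \<in> L2" using assms unfolding op_A_iff by auto
  obtain u where u: "\<And>n::nat. u n \<in> Ck0 K" "(\<lambda>n. l2norm (\<lambda>t. u n t - g t)) \<longlonglongrightarrow> 0"
    "(\<lambda>n. l2norm (\<lambda>t. A (u n) t - h t)) \<longlonglongrightarrow> 0" using assms(1) unfolding op_A_iff by blast
  obtain w where w: "\<And>n::nat. w n \<in> Ck0 K" "(\<lambda>n. l2norm (\<lambda>t. w n t - g' t)) \<longlonglongrightarrow> 0"
    "(\<lambda>n. l2norm (\<lambda>t. A (w n) t - h' t)) \<longlonglongrightarrow> 0" using assms(2) unfolding op_A_iff by blast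
  note uL = Ck0_L2[OF u(1)] A_L2[OF u(1)]
  note wL = Ck0_L2[OF w(1)] A_L2[OF w(1)]
  have "ip (A (u n)) g' = ip (u n) h'" for n
  proof -
    have "(\<lambda>m. ip (w m) (A (u n))) \<longlonglongrightarrow> ip g' (A (u n))" by (rule ip_tendsto[OF wL(1) L(3) w(2) uL(2)])
    moreover have "(\<lambda>m. ip (A (w m)) (u n)) \<longlonglongrightarrow> ip h' (u n)" by (rule ip_tendsto[OF wL(2) L(4) w(3) uL(1)])
    moreover have "ip (A (w m)) (u n) = ip (w m) (A (u n))" for m by (rule A_symmetric[OF w(1) u(1)])
    ultimately have "ip g' (A (u n)) = ip h' (u n)" by (simp add: LIMSEQ_unique)
    then show ?thesis unfolding ip_cnj[of "A (u n)" g'] ip_cnj[of "u n" h'] by simp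
  qed
  moreover have "(\<lambda>n. ip (A (u n)) g') \<longlonglongrightarrow> ip h g'" by (rule ip_tendsto[OF uL(2) L(2) u(3) L(3)])
  moreover have "(\<lambda>n. ip (u n) h') \<longlonglongrightarrow> ip g h'" by (rule ip_tendsto[OF uL(1) L(1) u(2) L(4)])
  ultimately show ?thesis by (simp add: LIMSEQ_unique)
qed

text \<open>Lower bounds pass from compactly supported functions to the closure.\<close>

lemma bounded_below_op_A:
  assumes c: "\<And>g. g \<in> Ck0 K \<Longrightarrow> l2norm g \<le> c * l2norm (\<lambda>t. A g t - z * g t)" and gh: "(g, h) \<in> op_A v Q"
  shows "l2norm g \<le> c * l2norm (\<lambda>t. h t - z * g t)"
proof -
  have L: "g \<in> L2" "h \<in> L2" using gh unfolding op_A_iff by auto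
  obtain u where u: "\<And>n::nat. u n \<in> Ck0 K" "(\<lambda>n. l2norm (\<lambda>t. u n t - g t)) \<longlonglongrightarrow> 0"
    "(\<lambda>n. l2norm (\<lambda>t. A (u n) t - h t)) \<longlonglongrightarrow> 0" using gh unfolding op_A_iff by blast
  have "(\<lambda>n. c * l2norm (\<lambda>t. A (u n) t - z * u n t)) \<longlonglongrightarrow> c * l2norm (\<lambda>t. h t - z * g t)"
    by (intro tendsto_mult_left l2norm_tendsto shifted_limit u L shifted_L2 L2_diff L2_cmult)
  moreover have "(\<lambda>n. l2norm (u n)) \<longlonglongrightarrow> l2norm g" by (rule l2norm_tendsto[OF Ck0_L2[OF u(1)] L(1) u(2)])
  ultimately show ?thesis using c[OF u(1)] by (intro LIMSEQ_le[of "\<lambda>n. l2norm (u n)"]) auto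
qed

lemma A_scale_add:
  assumes "g \<in> Ck0 K" "h \<in> Ck0 K"
  shows "(\<lambda>t. g t + \<tau> * h t) \<in> Ck0 K"
    "A (\<lambda>t. g t + \<tau> * h t) t - z * (g t + \<tau> * h t) = (A g t - z * g t) + \<tau> * (A h t - z * h t)"
proof -
  show "(\<lambda>t. g t + \<tau> * h t) \<in> Ck0 K" by (intro Ck0_add Ck0_mult_right Ck_const assms)
  have C: "(\<lambda>s. complex_of_real (v s) * g s) \<in> Ck K" "(\<lambda>s. \<tau> * (complex_of_real (v s) * h s)) \<in> Ck K"
    "(\<lambda>s. complex_of_real (v s) * h s) \<in> Ck K"
    using v_mult_Ck[OF Ck0_Ck] assms by (auto intro: Ck_cmult)
  have "polyD Q (\<lambda>s. complex_of_real (v s) * g s + \<tau> * (complex_of_real (v s) * h s)) t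
      = polyD Q (\<lambda>s. complex_of_real (v s) * g s) t + \<tau> * polyD Q (\<lambda>s. complex_of_real (v s) * h s) t"
    unfolding polyD_def sum_distrib_left sum.distrib[symmetric]
  proof (intro sum.cong refl)
    fix k assume "k \<in> {..K}"
    then have k: "k \<le> K" by simp
    show "of_real (coeff Q k) * \<i> ^ k * nderiv k (\<lambda>s. complex_of_real (v s) * g s + \<tau> * (complex_of_real (v s) * h s)) t
        = of_real (coeff Q k) * \<i> ^ k * nderiv k (\<lambda>s. complex_of_real (v s) * g s) t
          + \<tau> * (of_real (coeff Q k) * \<i> ^ k * nderiv k (\<lambda>s. complex_of_real (v s) * h s) t)"
      unfolding nderiv_add[OF C(1,2) k] nderiv_cmult[OF C(3) k] by (simp add: distrib_left mult_ac)
  qed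
  moreover have "(\<lambda>s. complex_of_real (v s) * (g s + \<tau> * h s))
      = (\<lambda>s. complex_of_real (v s) * g s + \<tau> * (complex_of_real (v s) * h s))"
    by (simp add: algebra_simps)
  ultimately have "A (\<lambda>t. g t + \<tau> * h t) t = A g t + \<tau> * A h t" unfolding A_def by (simp add: algebra_simps)
  then show "A (\<lambda>t. g t + \<tau> * h t) t - z * (g t + \<tau> * h t) = (A g t - z * g t) + \<tau> * (A h t - z * h t)"
    by (simp add: algebra_simps)
qed

text \<open>The projection theorem, applied to the range of \<open>A - z\<close>: a minimising sequence for the
  distance from \<open>f\<close> converges by the parallelogram law, the preimages converge because
  \<open>A - z\<close> is bounded below, and the defect is orthogonal to the range.\<close>

lemma range_approximates:
  assumes bz: "bounded_below z" and bc: "bounded_below (cnj z)" and f: "f \<in> L2"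
  obtains g h where "(g, h) \<in> op_A v Q" "AE t in lborel. h t - z * g t = f t"
proof -
  define \<rho> where "\<rho> g t = A g t - z * g t" for g t
  have \<rho>L: "\<rho> g \<in> L2" if "g \<in> Ck0 K" for g unfolding \<rho>_def[abs_def] by (rule shifted_L2[OF that])
  define err where "err g = l2norm (\<lambda>t. \<rho> g t - f t)" for g
  have eL: "(\<lambda>t. \<rho> g t - f t) \<in> L2" if "g \<in> Ck0 K" for g by (rule L2_diff[OF \<rho>L[OF that] f])
  define d where "d = Inf (err ` Ck0 K)"
  have zero: "(\<lambda>t. 0 :: complex) \<in> Ck0 K" unfolding Ck0_iff by simp
  have bdd: "bdd_below (err ` Ck0 K)" by (rule bdd_belowI[of _ 0]) (auto simp: err_def)
  have d_le: "d \<le> err g" if "g \<in> Ck0 K" for g unfolding d_def by (rule cInf_lower[OF _ bdd]) (use that in simp)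
  have d0: "d \<ge> 0" unfolding d_def by (rule cInf_greatest) (use zero in \<open>auto simp: err_def\<close>)
  have "\<exists>g\<in>Ck0 K. err g < d + 1 / real (Suc n)" for n
  proof -
    have "err ` Ck0 K \<noteq> {}" using zero by blast
    then show ?thesis using cInf_lessD[of "err ` Ck0 K" "d + 1 / real (Suc n)"] unfolding d_def by auto
  qed
  then obtain g where g: "\<And>n. g n \<in> Ck0 K" "\<And>n. err (g n) < d + 1 / real (Suc n)" by metis
  have gerr: "(\<lambda>n. err (g n)) \<longlonglongrightarrow> d"
  proof (rule tendsto_sandwich[of "\<lambda>_. d" _ _ "\<lambda>n. d + 1 / real (Suc n)"])
    show "(\<lambda>n. d + 1 / real (Suc n)) \<longlonglongrightarrow> d"
      using tendsto_add[OF tendsto_const[of d] LIMSEQ_inverse_real_of_nat] by (simp add: inverse_eq_divide)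
  qed (use g d_le in \<open>auto intro!: always_eventually less_imp_le simp del: of_nat_Suc\<close>)
  have par: "(l2norm (\<lambda>t. \<rho> (g m) t - \<rho> (g n) t))\<^sup>2 \<le> 2 * ((err (g m))\<^sup>2 - d\<^sup>2) + 2 * ((err (g n))\<^sup>2 - d\<^sup>2)" for m n
  proof -
    let ?a = "\<lambda>t. \<rho> (g m) t - f t" and ?b = "\<lambda>t. \<rho> (g n) t - f t"
    let ?h = "\<lambda>t. (1/2) * g m t + (1/2) * g n t"
    have hC: "?h \<in> Ck0 K" by (intro Ck0_add Ck0_mult_right Ck_const g)
    have half: "(\<lambda>t. (1/2) * g m t) \<in> Ck0 K" by (rule Ck0_mult_right[OF Ck_const g(1)])
    have "\<rho> ?h t - f t = (1/2) * (?a t + ?b t)" for t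
    proof -
      have "\<rho> ?h t = \<rho> (\<lambda>t. (1/2) * g m t) t + (1/2) * \<rho> (g n) t"
        unfolding \<rho>_def using A_scale_add(2)[OF half g(1)[of n], of "1/2" t z] by simp
      moreover have "\<rho> (\<lambda>t. (1/2) * g m t) t = (1/2) * \<rho> (g m) t"
        unfolding \<rho>_def using A_scale_add(2)[OF zero g(1)[of m], of "1/2" t z]
        by (simp add: A_def polyD_def nderiv_zero_fun)
      ultimately show ?thesis by (simp add: field_simps)
    qed
    then have "err ?h = (1/2) * l2norm (\<lambda>t. ?a t + ?b t)" unfolding err_def by (simp only: l2norm_cmult) simp
    then have "2 * d \<le> l2norm (\<lambda>t. ?a t + ?b t)" using d_le[OF hC] by simp
    then have "(2 * d)\<^sup>2 \<le> (l2norm (\<lambda>t. ?a t + ?b t))\<^sup>2" using d0 by (intro power_mono) auto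
    moreover have "(l2norm (\<lambda>t. ?a t - ?b t))\<^sup>2 = 2 * (err (g m))\<^sup>2 + 2 * (err (g n))\<^sup>2 - (l2norm (\<lambda>t. ?a t + ?b t))\<^sup>2"
      unfolding l2norm_diff_power2[OF eL[OF g(1)] eL[OF g(1)]] l2norm_add_power2[OF eL[OF g(1)] eL[OF g(1)]] err_def by simp
    ultimately show ?thesis by (simp add: power_mult_distrib)
  qed
  have cauchy_r: "\<exists>N. \<forall>m\<ge>N. \<forall>n\<ge>N. l2norm (\<lambda>t. \<rho> (g m) t - \<rho> (g n) t) < e" if e: "e > 0" for e
  proof -
    have "(\<lambda>n. (err (g n))\<^sup>2 - d\<^sup>2) \<longlonglongrightarrow> d\<^sup>2 - d\<^sup>2" by (intro tendsto_intros gerr)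
    then have "(\<lambda>n. (err (g n))\<^sup>2 - d\<^sup>2) \<longlonglongrightarrow> 0" by simp
    from order_tendstoD(2)[OF this, of "e\<^sup>2 / 4"] obtain N where N: "\<And>n. n \<ge> N \<Longrightarrow> (err (g n))\<^sup>2 - d\<^sup>2 < e\<^sup>2 / 4"
      using e unfolding eventually_sequentially by auto
    have "l2norm (\<lambda>t. \<rho> (g m) t - \<rho> (g n) t) < e" if "m \<ge> N" "n \<ge> N" for m n
    proof -
      have "(l2norm (\<lambda>t. \<rho> (g m) t - \<rho> (g n) t))\<^sup>2 < e\<^sup>2" 
      proof (rule le_less_trans[OF par])
        show "2 * ((err (g m))\<^sup>2 - d\<^sup>2) + 2 * ((err (g n))\<^sup>2 - d\<^sup>2) < e\<^sup>2"
        proof -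
          have "2 * x + 2 * y < s" if "x < s / 4" "y < s / 4" for x y s :: real using that by simp
          then show ?thesis using N[OF that(1)] N[OF that(2)] .
        qed
      qed
      then show ?thesis using e by (simp add: power_less_imp_less_base)
    qed
    then show ?thesis by blast
  qed
  obtain r where r: "r \<in> L2" "(\<lambda>n. l2norm (\<lambda>t. \<rho> (g n) t - r t)) \<longlonglongrightarrow> 0"
    using L2_complete[of "\<lambda>n. \<rho> (g n)", OF \<rho>L[OF g(1)] cauchy_r] by blast
  obtain c where c: "\<And>g. g \<in> Ck0 K \<Longrightarrow> l2norm g \<le> c * l2norm (\<rho> g)"
    using bz unfolding bounded_below_def \<rho>_def by blast
  have cauchy_g: "\<exists>N. \<forall>m\<ge>N. \<forall>n\<ge>N. l2norm (\<lambda>t. g m t - g n t) < e" if e: "e > 0" for e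
  proof -
    have "e / (\<bar>c\<bar> + 1) > 0" using e by simp
    then obtain N where N: "\<And>m n. m \<ge> N \<Longrightarrow> n \<ge> N \<Longrightarrow> l2norm (\<lambda>t. \<rho> (g m) t - \<rho> (g n) t) < e / (\<bar>c\<bar> + 1)"
      using cauchy_r by blast
    have "l2norm (\<lambda>t. g m t - g n t) < e" if "m \<ge> N" "n \<ge> N" for m n
    proof -
      have "\<rho> (\<lambda>t. g m t - g n t) = (\<lambda>t. \<rho> (g m) t - \<rho> (g n) t)"
        unfolding \<rho>_def A_diff[OF g(1) g(1)] by (simp add: algebra_simps)
      then have "l2norm (\<lambda>t. g m t - g n t) \<le> c * l2norm (\<lambda>t. \<rho> (g m) t - \<rho> (g n) t)"
        using c[OF Ck0_diff[OF g(1) g(1)], of m n] by simp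
      also have "\<dots> \<le> (\<bar>c\<bar> + 1) * l2norm (\<lambda>t. \<rho> (g m) t - \<rho> (g n) t)" by (intro mult_right_mono) auto
      also have "\<dots> < (\<bar>c\<bar> + 1) * (e / (\<bar>c\<bar> + 1))" using N[OF that] by (intro mult_strict_left_mono) auto
      also have "\<dots> = e" by simp
      finally show ?thesis .
    qed
    then show ?thesis by blast
  qed
  obtain g0 where g0: "g0 \<in> L2" "(\<lambda>n. l2norm (\<lambda>t. g n t - g0 t)) \<longlonglongrightarrow> 0"
    using L2_complete[of g, OF Ck0_L2[OF g(1)] cauchy_g] by blast
  define h where "h t = r t + z * g0 t" for t
  have hL: "h \<in> L2" unfolding h_def[abs_def] by (intro L2_add L2_cmult r g0)
  have "(\<lambda>n. l2norm (\<lambda>t. A (g n) t - h t)) \<longlonglongrightarrow> 0"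
  proof (rule tendsto_sandwich[OF _ _ tendsto_const])
    show "(\<lambda>n. l2norm (\<lambda>t. \<rho> (g n) t - r t) + norm z * l2norm (\<lambda>t. g n t - g0 t)) \<longlonglongrightarrow> 0"
      using tendsto_add[OF r(2) tendsto_mult_right_zero[OF g0(2), of "norm z"]] by simp
    have "l2norm (\<lambda>t. A (g n) t - h t) \<le> l2norm (\<lambda>t. \<rho> (g n) t - r t) + norm z * l2norm (\<lambda>t. g n t - g0 t)" for n
    proof -
      have "(\<lambda>t. A (g n) t - h t) = (\<lambda>t. (\<rho> (g n) t - r t) + z * (g n t - g0 t))"
        by (simp add: h_def \<rho>_def algebra_simps)
      then show ?thesis
        using l2norm_triangle[OF L2_diff[OF \<rho>L[OF g(1)] r(1)] L2_cmult[OF L2_diff[OF Ck0_L2[OF g(1)] g0(1)], of z], of n n]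
        by (simp add: l2norm_cmult)
    qed
    then show "eventually (\<lambda>n. l2norm (\<lambda>t. A (g n) t - h t)
        \<le> l2norm (\<lambda>t. \<rho> (g n) t - r t) + norm z * l2norm (\<lambda>t. g n t - g0 t)) sequentially" by simp
  qed simp
  then have mem: "(g0, h) \<in> op_A v Q" unfolding op_A_iff using g0 hL g(1) by blast
  define e where "e t = r t - f t" for t
  have eL2: "e \<in> L2" unfolding e_def[abs_def] by (rule L2_diff[OF r(1) f])
  have lim_e: "(\<lambda>n. l2norm (\<lambda>t. (\<rho> (g n) t - f t) - e t)) \<longlonglongrightarrow> 0" using r(2) by (simp add: e_def)
  have ed: "l2norm e = d"
    using l2norm_tendsto[OF eL[OF g(1)] eL2 lim_e] gerr unfolding err_def by (rule LIMSEQ_unique)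
  have orth: "ip (\<rho> s) e = 0" if s: "s \<in> Ck0 K" for s
  proof (rule ccontr)
    assume nz: "ip (\<rho> s) e \<noteq> 0"
    define a where "a = ip (\<rho> s) e"
    define N where "N = (l2norm (\<rho> s))\<^sup>2"
    have sL: "\<rho> s \<in> L2" by (rule \<rho>L[OF s])
    have ge: "(l2norm e)\<^sup>2 \<le> (l2norm (\<lambda>t. e t + \<tau> * \<rho> s t))\<^sup>2" for \<tau>
    proof -
      have L: "(\<lambda>t. (\<rho> (g n) t - f t) + \<tau> * \<rho> s t) \<in> L2" "(\<lambda>t. e t + \<tau> * \<rho> s t) \<in> L2" for n
        by (intro L2_add eL g eL2 L2_cmult sL)+
      have "(\<lambda>n. l2norm (\<lambda>t. ((\<rho> (g n) t - f t) + \<tau> * \<rho> s t) - (e t + \<tau> * \<rho> s t))) \<longlonglongrightarrow> 0"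
        using lim_e by simp
      from l2norm_tendsto[OF L(1) L(2) this]
      have "(\<lambda>n. l2norm (\<lambda>t. (\<rho> (g n) t - f t) + \<tau> * \<rho> s t)) \<longlonglongrightarrow> l2norm (\<lambda>t. e t + \<tau> * \<rho> s t)" .
      moreover have "d \<le> l2norm (\<lambda>t. (\<rho> (g n) t - f t) + \<tau> * \<rho> s t)" for n
      proof -
        have "err (\<lambda>t. g n t + \<tau> * s t) = l2norm (\<lambda>t. (\<rho> (g n) t - f t) + \<tau> * \<rho> s t)"
          unfolding err_def \<rho>_def A_scale_add(2)[OF g(1) s] by (simp add: algebra_simps)
        then show ?thesis using d_le[OF A_scale_add(1)[OF g(1) s], of n \<tau>] by simp
      qed
      ultimately have "d \<le> l2norm (\<lambda>t. e t + \<tau> * \<rho> s t)" by (intro LIMSEQ_le_const) auto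
      then show ?thesis unfolding ed using d0 by (intro power_mono) auto
    qed
    \<comment> \<open>A step against the direction of the inner product decreases the distance to first order in \<open>\<epsilon>\<close>;
      for this \<open>\<epsilon>\<close> the second-order term is smaller.\<close>
    define \<epsilon> where "\<epsilon> = 1 / (N + 1)"
    have N0: "N \<ge> 0" by (simp add: N_def)
    have \<epsilon>: "\<epsilon> > 0" "\<epsilon> * N < 1" using N0 by (auto simp: \<epsilon>_def field_simps)
    define \<tau> where "\<tau> = - of_real \<epsilon> * cnj a"
    have ipe: "ip e (\<lambda>t. \<tau> * \<rho> s t) = - of_real (\<epsilon> * (norm a)\<^sup>2)"
      unfolding ip_cmult_right ip_cnj[of e "\<rho> s"] a_def[symmetric] \<tau>_def using complex_norm_square[of a] by simp
    have "(l2norm (\<lambda>t. e t + \<tau> * \<rho> s t))\<^sup>2 = (l2norm e)\<^sup>2 + (norm \<tau>)\<^sup>2 * N - 2 * (\<epsilon> * (norm a)\<^sup>2)"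
      unfolding l2norm_add_power2[OF eL2 L2_cmult[OF sL]] ipe l2norm_cmult power_mult_distrib N_def by simp
    also have "(norm \<tau>)\<^sup>2 = \<epsilon>\<^sup>2 * (norm a)\<^sup>2" unfolding \<tau>_def by (simp add: norm_mult power_mult_distrib)
    finally have "2 * (\<epsilon> * (norm a)\<^sup>2) \<le> (\<epsilon>\<^sup>2 * (norm a)\<^sup>2) * N" using ge[of \<tau>] by simp
    also have "\<dots> = (\<epsilon> * N) * (\<epsilon> * (norm a)\<^sup>2)" by (simp add: power2_eq_square)
    also have "\<dots> \<le> 1 * (\<epsilon> * (norm a)\<^sup>2)" using \<epsilon> by (intro mult_right_mono) auto
    finally have "\<epsilon> * (norm a)\<^sup>2 \<le> 0" by simp
    moreover have "\<epsilon> * (norm a)\<^sup>2 > 0" using \<epsilon> nz by (simp add: a_def)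
    ultimately show False by linarith
  qed
  have "AE t in lborel. e t = 0"
    by (rule orthogonal_to_range[OF bc eL2]) (use orth in \<open>simp add: \<rho>_def[abs_def]\<close>)
  then have "AE t in lborel. h t - z * g0 t = f t" by eventually_elim (simp add: h_def e_def)
  then show ?thesis using that mem by blast
qed

lemma resolvent_setI:
  assumes "bounded_below z" "bounded_below (cnj z)"
  shows "z \<in> resolvent_set (op_A v Q)"
  unfolding resolvent_set_def
proof (intro CollectI conjI ballI)
  fix f assume "f \<in> L2"
  then show "\<exists>g h. (g, h) \<in> op_A v Q \<and> (AE t in lborel. h t - z * g t = f t)"
    using range_approximates[OF assms] by metis
next
  show "\<exists>c. \<forall>g h. (g, h) \<in> op_A v Q \<longrightarrow> l2norm g \<le> c * l2norm (\<lambda>t. h t - z * g t)"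
    using assms(1) bounded_below_op_A unfolding bounded_below_def by metis
qed

text \<open>The imaginary part of the quadratic form of \<open>A - z\<close> is \<open>- Im z\<close> times the squared norm.\<close>

lemma nonreal_bounded_below:
  assumes "Im z \<noteq> 0" shows "bounded_below z"
  unfolding bounded_below_def
proof (intro exI[of _ "1 / \<bar>Im z\<bar>"] ballI)
  fix g :: "real \<Rightarrow> complex" assume g: "g \<in> Ck0 K"
  let ?r = "\<lambda>t. A g t - z * g t"
  have L: "g \<in> L2" "A g \<in> L2" "?r \<in> L2" using g Ck0_L2 A_L2 shifted_L2 by auto
  have "ip (A g) g = cnj (ip (A g) g)"
    using A_symmetric[OF g g] ip_cnj[of g "A g"] by simp
  from arg_cong[OF this, of Im] have "Im (ip (A g) g) = 0" by simp
  moreover have "ip ?r g = ip (A g) g - z * of_real ((l2norm g)\<^sup>2)"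
    using ip_diff_left[OF L(2) L2_cmult[OF L(1), of z] L(1)] by (simp add: ip_cmult_left ip_self)
  ultimately have "Im (ip ?r g) = - Im z * (l2norm g)\<^sup>2" by simp
  then have "\<bar>Im z\<bar> * (l2norm g)\<^sup>2 = \<bar>Im (ip ?r g)\<bar>" by (simp add: abs_mult)
  also have "\<dots> \<le> l2norm ?r * l2norm g"
    using ip_cauchy_schwarz[OF L(3,1)] abs_Im_le_cmod order_trans by blast
  finally have le: "\<bar>Im z\<bar> * l2norm g * l2norm g \<le> l2norm ?r * l2norm g" by (simp add: power2_eq_square mult.assoc)
  show "l2norm g \<le> 1 / \<bar>Im z\<bar> * l2norm ?r"
  proof (cases "l2norm g = 0")
    case False
    then have "l2norm g > 0" using l2norm_nonneg[of g] by linarith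
    then have "\<bar>Im z\<bar> * l2norm g \<le> l2norm ?r" using le by simp
    then show ?thesis using assms by (simp add: field_simps)
  qed simp
qed

lemma not_bounded_below_in_spec: "\<not> bounded_below z \<Longrightarrow> z \<in> spec (op_A v Q)"
  unfolding spec_def resolvent_set_def bounded_below_def using op_A_Ck0 by blast

lemma nonreal_not_in_spec: "Im z \<noteq> 0 \<Longrightarrow> z \<notin> spec (op_A v Q)"
  unfolding spec_def using resolvent_setI[of z] nonreal_bounded_below[of z] nonreal_bounded_below[of "cnj z"] by simp

section \<open>The negative spectrum is discrete\<close>

text \<open>A limit of normalised approximate eigenfunctions exists by compactness and is an eigenfunction.\<close>

lemma not_bounded_below_eigenvalue:
  assumes mu: "\<mu> < 0" and nb: "\<not> bounded_below (of_real \<mu>)"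
  obtains g h where "(g, h) \<in> op_A v Q" "AE t in lborel. h t = of_real \<mu> * g t" "l2norm g = 1"
proof -
  define \<rho> where "\<rho> f = l2norm (\<lambda>t. A f t - of_real \<mu> * f t)" for f
  have "\<exists>g\<in>Ck0 K. l2norm g = 1 \<and> \<rho> g < 1 / real (Suc n)" for n
  proof -
    obtain g where g: "g \<in> Ck0 K" "l2norm g > real (Suc n) * \<rho> g"
      using nb unfolding bounded_below_def \<rho>_def by (meson not_le)
    have "\<rho> g \<ge> 0" by (simp add: \<rho>_def)
    then have pos: "l2norm g > 0" using g(2) by (meson le_less_trans mult_nonneg_nonneg of_nat_0_le_iff)
    define a where "a = complex_of_real (1 / l2norm g)"
    have na: "norm a = 1 / l2norm g" unfolding a_def norm_of_real using pos by simp
    have C: "(\<lambda>t. 0 + a * g t) \<in> Ck0 K" using g(1) by (auto intro: Ck0_mult_right)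
    have zero: "(\<lambda>t. 0 :: complex) \<in> Ck0 K" unfolding Ck0_iff by simp
    have "A (\<lambda>t. 0 + a * g t) t - of_real \<mu> * (0 + a * g t) = a * (A g t - of_real \<mu> * g t)" for t
      using A_scale_add(2)[OF zero g(1), of a t "of_real \<mu>"] by (simp add: A_def polyD_def nderiv_zero_fun)
    then have "\<rho> (\<lambda>t. 0 + a * g t) = 1 / l2norm g * \<rho> g" unfolding \<rho>_def by (simp only: l2norm_cmult na)
    also have "\<dots> < 1 / real (Suc n)" using g(2) pos by (simp add: field_simps)
    finally have "\<rho> (\<lambda>t. 0 + a * g t) < 1 / real (Suc n)" .
    moreover have "l2norm (\<lambda>t. 0 + a * g t) = 1" using l2norm_cmult[of a g] na pos by simp
    ultimately show ?thesis using C by blast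
  qed
  then obtain g where g: "\<And>n. g n \<in> Ck0 K" "\<And>n. l2norm (g n) = 1" "\<And>n. \<rho> (g n) < 1 / real (Suc n)" by metis
  have lim: "(\<lambda>n. \<rho> (g n)) \<longlonglongrightarrow> 0"
  proof (rule tendsto_sandwich[OF _ _ tendsto_const LIMSEQ_inverse_real_of_nat])
    show "eventually (\<lambda>n. \<rho> (g n) \<le> inverse (real (Suc n))) sequentially"
      using g(3) by (auto simp: inverse_eq_divide intro!: always_eventually less_imp_le)
  qed (simp add: \<rho>_def)
  have g1: "l2norm (g n) \<le> 1" for n using g(2)[of n] by simp
  obtain r :: "nat \<Rightarrow> nat" where r: "strict_mono r"
    "\<And>e. e > 0 \<Longrightarrow> \<exists>N. \<forall>m\<ge>N. \<forall>n\<ge>N. l2norm (\<lambda>t. g (r m) t - g (r n) t) < e"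
    using approximate_eigenfunctions_compact[where M = 1 and g = g, OF mu g(1) g1 lim[unfolded \<rho>_def]] by blast
  obtain g0 where g0: "g0 \<in> L2" "(\<lambda>n. l2norm (\<lambda>t. g (r n) t - g0 t)) \<longlonglongrightarrow> 0"
    using L2_complete[of "\<lambda>n. g (r n)", OF Ck0_L2[OF g(1)] r(2)] by blast
  have norm1: "l2norm g0 = 1"
    using l2norm_tendsto[OF Ck0_L2[OF g(1)] g0] g(2) by (simp add: LIMSEQ_const_iff)
  define h where "h t = of_real \<mu> * g0 t" for t
  have hL: "h \<in> L2" unfolding h_def[abs_def] by (rule L2_cmult[OF g0(1)])
  have lim_r: "(\<lambda>n. \<rho> (g (r n))) \<longlonglongrightarrow> 0" using LIMSEQ_subseq_LIMSEQ[OF lim r(1)] by (simp add: o_def)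
  have "(\<lambda>n. l2norm (\<lambda>t. A (g (r n)) t - h t)) \<longlonglongrightarrow> 0"
  proof (rule tendsto_sandwich[OF _ _ tendsto_const])
    show "(\<lambda>n. \<rho> (g (r n)) + \<bar>\<mu>\<bar> * l2norm (\<lambda>t. g (r n) t - g0 t)) \<longlonglongrightarrow> 0"
      using tendsto_add[OF lim_r tendsto_mult_right_zero[OF g0(2), of "\<bar>\<mu>\<bar>"]] by simp
    have "l2norm (\<lambda>t. A (g (r n)) t - h t) \<le> \<rho> (g (r n)) + \<bar>\<mu>\<bar> * l2norm (\<lambda>t. g (r n) t - g0 t)" for n
    proof -
      have "(\<lambda>t. A (g (r n)) t - h t) = (\<lambda>t. (A (g (r n)) t - of_real \<mu> * g (r n) t) + of_real \<mu> * (g (r n) t - g0 t))"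
        by (simp add: h_def algebra_simps)
      then show ?thesis unfolding \<rho>_def
        using l2norm_triangle[OF shifted_L2[OF g(1)[of "r n"], of "of_real \<mu>"] L2_cmult[OF L2_diff[OF Ck0_L2[OF g(1)[of "r n"]] g0(1)], of "of_real \<mu>"]]
        by (simp add: l2norm_cmult)
    qed
    then show "eventually (\<lambda>n. l2norm (\<lambda>t. A (g (r n)) t - h t)
        \<le> \<rho> (g (r n)) + \<bar>\<mu>\<bar> * l2norm (\<lambda>t. g (r n) t - g0 t)) sequentially" by simp
  qed simp
  then have "(g0, h) \<in> op_A v Q" unfolding op_A_iff using g0 hL g(1) by (intro conjI exI[of _ "\<lambda>n. g (r n)"]) auto
  then show ?thesis using that norm1 by (simp add: h_def)
qed

text \<open>Orthonormal vectors have mutual distance \<open>\<surd>2\<close>, so approximate eigenvectors for a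
  convergent sequence of numbers with negative limit cannot be orthonormal.\<close>

lemma no_orthonormal_eigenvectors:
  assumes mu: "\<mu> < 0" and mem: "\<And>n::nat. (g n, h n) \<in> op_A v Q"
    and ev: "\<And>n. AE t in lborel. h n t = of_real (\<nu> n) * g n t" and lim: "\<nu> \<longlonglongrightarrow> \<mu>"
    and n1: "\<And>n. l2norm (g n) = 1" and orth: "\<And>m n. m \<noteq> n \<Longrightarrow> ip (g m) (g n) = 0"
  shows False
proof -
  have gL: "g n \<in> L2" "h n \<in> L2" for n using mem[of n] unfolding op_A_iff by auto
  \<comment> \<open>The errors tend to \<open>0\<close> and never exceed \<open>1 / 4\<close>, which keeps two approximants at distance at least
    \<open>\<surd>2 - 1 / 2\<close>.\<close>
  have "\<exists>u\<in>Ck0 K. l2norm (\<lambda>t. u t - g n t) < 1 / real (Suc (Suc (Suc (Suc n)))) \<and> l2norm (\<lambda>t. A u t - h n t) < 1 / real (Suc (Suc (Suc (Suc n))))" for n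
    using op_A_approx[OF mem[of n], of "1 / real (Suc (Suc (Suc (Suc n))))"] by (metis of_nat_0_less_iff zero_less_Suc zero_less_divide_1_iff)
  then obtain u where u: "\<And>n. u n \<in> Ck0 K" "\<And>n. l2norm (\<lambda>t. u n t - g n t) < 1 / real (Suc (Suc (Suc (Suc n))))"
    "\<And>n. l2norm (\<lambda>t. A (u n) t - h n t) < 1 / real (Suc (Suc (Suc (Suc n))))" by metis
  have q: "1 / real (Suc (Suc (Suc (Suc n)))) \<le> 1 / 4" "1 / real (Suc (Suc (Suc (Suc n)))) \<le> inverse (real (Suc n))" for n
    by (auto simp: field_simps)
  have uM: "l2norm (u n) \<le> 2" for n
    using l2norm_triangle_diff[OF Ck0_L2[OF u(1)] gL(1), of n n] u(2)[of n] q(1)[of n] n1[of n] by linarith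
  have "(\<lambda>n. l2norm (\<lambda>t. A (u n) t - of_real \<mu> * u n t)) \<longlonglongrightarrow> 0"
  proof (rule tendsto_sandwich[OF _ _ tendsto_const])
    have "(\<lambda>n. inverse (real (Suc n)) + \<bar>\<nu> n - \<mu>\<bar> + \<bar>\<mu>\<bar> * inverse (real (Suc n))) \<longlonglongrightarrow> 0 + \<bar>\<mu> - \<mu>\<bar> + \<bar>\<mu>\<bar> * 0"
      by (intro tendsto_intros lim LIMSEQ_inverse_real_of_nat)
    then show "(\<lambda>n. inverse (real (Suc n)) + \<bar>\<nu> n - \<mu>\<bar> + \<bar>\<mu>\<bar> * inverse (real (Suc n))) \<longlonglongrightarrow> 0" by simp
    have "l2norm (\<lambda>t. A (u n) t - of_real \<mu> * u n t) \<le> inverse (real (Suc n)) + \<bar>\<nu> n - \<mu>\<bar> + \<bar>\<mu>\<bar> * inverse (real (Suc n))" for n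
    proof -
      have L: "(\<lambda>t. A (u n) t - h n t) \<in> L2" "(\<lambda>t. h n t - of_real \<mu> * g n t) \<in> L2" "(\<lambda>t. u n t - g n t) \<in> L2"
        using A_L2[OF u(1)] Ck0_L2[OF u(1)] gL by (auto intro!: L2_diff L2_cmult)
      have "l2norm (\<lambda>t. h n t - of_real \<mu> * g n t) = l2norm (\<lambda>t. of_real (\<nu> n - \<mu>) * g n t)"
      proof (rule l2norm_cong_AE)
        show "AE t in lborel. h n t - of_real \<mu> * g n t = of_real (\<nu> n - \<mu>) * g n t"
          using ev[of n] by eventually_elim (simp add: algebra_simps)
      qed (use L2_measurable[OF L(2)] L2_measurable[OF L2_cmult[OF gL(1)[of n]]] in auto)
      then have hn: "l2norm (\<lambda>t. h n t - of_real \<mu> * g n t) = \<bar>\<nu> n - \<mu>\<bar>"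
        unfolding l2norm_cmult norm_of_real n1 by simp
      have "(\<lambda>t. A (u n) t - of_real \<mu> * u n t) = (\<lambda>t. ((A (u n) t - h n t) + (h n t - of_real \<mu> * g n t)) - of_real \<mu> * (u n t - g n t))"
        by (simp add: algebra_simps)
      then have "l2norm (\<lambda>t. A (u n) t - of_real \<mu> * u n t)
          \<le> l2norm (\<lambda>t. (A (u n) t - h n t) + (h n t - of_real \<mu> * g n t)) + \<bar>\<mu>\<bar> * l2norm (\<lambda>t. u n t - g n t)"
        using l2norm_triangle4[OF L2_add[OF L(1,2)] L2_cmult[OF L(3), of "of_real \<mu>"]] by (simp add: l2norm_cmult)
      also have "l2norm (\<lambda>t. (A (u n) t - h n t) + (h n t - of_real \<mu> * g n t)) \<le> l2norm (\<lambda>t. A (u n) t - h n t) + \<bar>\<nu> n - \<mu>\<bar>"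
        using l2norm_triangle[OF L(1,2)] hn by simp
      also have "l2norm (\<lambda>t. A (u n) t - h n t) \<le> inverse (real (Suc n))" using u(3)[of n] q(2)[of n] by linarith
      also have "\<bar>\<mu>\<bar> * l2norm (\<lambda>t. u n t - g n t) \<le> \<bar>\<mu>\<bar> * inverse (real (Suc n))"
        using u(2)[of n] q(2)[of n] by (intro mult_left_mono) auto
      finally show ?thesis by simp
    qed
    then show "eventually (\<lambda>n. l2norm (\<lambda>t. A (u n) t - of_real \<mu> * u n t)
        \<le> inverse (real (Suc n)) + \<bar>\<nu> n - \<mu>\<bar> + \<bar>\<mu>\<bar> * inverse (real (Suc n))) sequentially" by simp
  qed simp
  then obtain r :: "nat \<Rightarrow> nat" where r: "strict_mono r"
    "\<And>e. e > 0 \<Longrightarrow> \<exists>N. \<forall>m\<ge>N. \<forall>n\<ge>N. l2norm (\<lambda>t. u (r m) t - u (r n) t) < e"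
    using approximate_eigenfunctions_compact[where g = u and M = 2, OF mu u(1) uM] by blast
  obtain N where N: "\<And>m n. m \<ge> N \<Longrightarrow> n \<ge> N \<Longrightarrow> l2norm (\<lambda>t. u (r m) t - u (r n) t) < 1 / 4"
    using r(2)[of "1/4"] by auto
  let ?m = "r N" and ?n = "r (Suc N)"
  have ne: "?m \<noteq> ?n" using r(1) by (simp add: strict_mono_eq)
  have d2: "(l2norm (\<lambda>t. g ?m t - g ?n t))\<^sup>2 = 2"
    unfolding l2norm_diff_power2[OF gL(1) gL(1)] n1 orth[OF ne] by simp
  have "l2norm (\<lambda>t. g ?m t - g ?n t) \<le> l2norm (\<lambda>t. g ?m t - u ?m t) + l2norm (\<lambda>t. u ?m t - g ?n t)"
    by (rule l2norm_diff_triangle[OF gL(1) Ck0_L2[OF u(1)] gL(1)])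
  also have "l2norm (\<lambda>t. u ?m t - g ?n t) \<le> l2norm (\<lambda>t. u ?m t - u ?n t) + l2norm (\<lambda>t. u ?n t - g ?n t)"
    by (rule l2norm_diff_triangle[OF Ck0_L2[OF u(1)] Ck0_L2[OF u(1)] gL(1)])
  finally have "l2norm (\<lambda>t. g ?m t - g ?n t) \<le> 1"
    using N[OF order_refl le_SucI[OF order_refl]] u(2)[of ?m] u(2)[of ?n] q(1)[of ?m] q(1)[of ?n]
      l2norm_minus_commute[of "g ?m" "u ?m"] by linarith
  then have "(l2norm (\<lambda>t. g ?m t - g ?n t))\<^sup>2 \<le> 1\<^sup>2" by (intro power_mono) auto
  then show False using d2 by simp
qed

lemma eigenspace_L2: "g \<in> eigenspace (op_A v Q) z \<Longrightarrow> g \<in> L2"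
  unfolding eigenspace_def op_A_iff by blast

lemma eigenspace_lincomb:
  assumes "g1 \<in> eigenspace (op_A v Q) z" "g2 \<in> eigenspace (op_A v Q) z"
  shows "(\<lambda>t. g1 t + \<tau> * g2 t) \<in> eigenspace (op_A v Q) z"
proof -
  obtain h1 h2 where h: "(g1, h1) \<in> op_A v Q" "AE t in lborel. h1 t = z * g1 t"
    "(g2, h2) \<in> op_A v Q" "AE t in lborel. h2 t = z * g2 t" using assms unfolding eigenspace_def by blast
  have L: "g1 \<in> L2" "h1 \<in> L2" "g2 \<in> L2" "h2 \<in> L2" using h unfolding op_A_iff by auto
  obtain u where u: "\<And>n::nat. u n \<in> Ck0 K" "(\<lambda>n. l2norm (\<lambda>t. u n t - g1 t)) \<longlonglongrightarrow> 0"
    "(\<lambda>n. l2norm (\<lambda>t. A (u n) t - h1 t)) \<longlonglongrightarrow> 0" using h(1) unfolding op_A_iff by blast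
  obtain w where w: "\<And>n::nat. w n \<in> Ck0 K" "(\<lambda>n. l2norm (\<lambda>t. w n t - g2 t)) \<longlonglongrightarrow> 0"
    "(\<lambda>n. l2norm (\<lambda>t. A (w n) t - h2 t)) \<longlonglongrightarrow> 0" using h(3) unfolding op_A_iff by blast
  have lim: "(\<lambda>n. l2norm (\<lambda>t. (a n t + \<tau> * b n t) - (a0 t + \<tau> * b0 t))) \<longlonglongrightarrow> 0"
    if "\<And>n. a n \<in> L2" "a0 \<in> L2" "\<And>n. b n \<in> L2" "b0 \<in> L2" "(\<lambda>n. l2norm (\<lambda>t. a n t - a0 t)) \<longlonglongrightarrow> 0"
      "(\<lambda>n. l2norm (\<lambda>t. b n t - b0 t)) \<longlonglongrightarrow> 0" for a b :: "nat \<Rightarrow> real \<Rightarrow> complex" and a0 b0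
  proof (rule tendsto_sandwich[OF _ _ tendsto_const])
    show "(\<lambda>n. l2norm (\<lambda>t. a n t - a0 t) + norm \<tau> * l2norm (\<lambda>t. b n t - b0 t)) \<longlonglongrightarrow> 0"
      using tendsto_add[OF that(5) tendsto_mult_right_zero[OF that(6), of "norm \<tau>"]] by simp
    have "l2norm (\<lambda>t. (a n t + \<tau> * b n t) - (a0 t + \<tau> * b0 t)) \<le> l2norm (\<lambda>t. a n t - a0 t) + norm \<tau> * l2norm (\<lambda>t. b n t - b0 t)" for n
    proof -
      have "(\<lambda>t. (a n t + \<tau> * b n t) - (a0 t + \<tau> * b0 t)) = (\<lambda>t. (a n t - a0 t) + \<tau> * (b n t - b0 t))"
        by (simp add: algebra_simps)
      then show ?thesis using l2norm_triangle[OF L2_diff[OF that(1,2)] L2_cmult[OF L2_diff[OF that(3,4)], of \<tau>], of n n]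
        by (simp add: l2norm_cmult)
    qed
    then show "eventually (\<lambda>n. l2norm (\<lambda>t. (a n t + \<tau> * b n t) - (a0 t + \<tau> * b0 t))
        \<le> l2norm (\<lambda>t. a n t - a0 t) + norm \<tau> * l2norm (\<lambda>t. b n t - b0 t)) sequentially" by simp
  qed simp
  have "A (\<lambda>t. u n t + \<tau> * w n t) t = A (u n) t + \<tau> * A (w n) t" for n t
    using A_scale_add(2)[OF u(1) w(1), of n \<tau> n t 0] by simp
  then have "((\<lambda>t. g1 t + \<tau> * g2 t), (\<lambda>t. h1 t + \<tau> * h2 t)) \<in> op_A v Q"
    unfolding op_A_iff
    using L lim[OF Ck0_L2[OF u(1)] L(1) Ck0_L2[OF w(1)] L(3) u(2) w(2)]
      lim[OF A_L2[OF u(1)] L(2) A_L2[OF w(1)] L(4) u(3) w(3)] A_scale_add(1)[OF u(1) w(1)]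
    by (intro conjI L2_add L2_cmult exI[of _ "\<lambda>n t. u n t + \<tau> * w n t"]) auto
  moreover have "AE t in lborel. h1 t + \<tau> * h2 t = z * (g1 t + \<tau> * g2 t)"
    using h(2,4) by eventually_elim (simp add: algebra_simps)
  ultimately show ?thesis unfolding eigenspace_def by blast
qed

text \<open>If the eigenspace were not finite-dimensional, the Gram--Schmidt process would never stop.\<close>

lemma eigenspace_finite_dim:
  assumes mu: "\<mu> < 0" shows "finite_dim (eigenspace (op_A v Q) (of_real \<mu>))"
proof (rule ccontr)
  let ?E = "eigenspace (op_A v Q) (of_real \<mu>)"
  assume inf: "\<not> finite_dim ?E"
  have step: "\<exists>g\<in>?E. l2norm g = 1 \<and> (\<forall>b\<in>B. ip b g = 0)"
    if B: "finite B" "B \<subseteq> ?E" "\<forall>b\<in>B. l2norm b = 1" "\<forall>b\<in>B. \<forall>b'\<in>B. b \<noteq> b' \<longrightarrow> ip b b' = 0" for B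
  proof -
    have BL: "B \<subseteq> L2" using B(2) eigenspace_L2 by blast
    have "\<not> (\<forall>g\<in>?E. \<exists>c. AE t in lborel. g t = (\<Sum>b\<in>B. c b * b t))"
    proof
      assume "\<forall>g\<in>?E. \<exists>c. AE t in lborel. g t = (\<Sum>b\<in>B. c b * b t)"
      then have "finite_dim ?E" unfolding finite_dim_def using B(1) BL by (intro exI[of _ B] conjI)
      then show False using inf by simp
    qed
    then obtain g where g: "g \<in> ?E" "\<And>c. \<not> (AE t in lborel. g t = (\<Sum>b\<in>B. c b * b t))" by blast
    have gL: "g \<in> L2" by (rule eigenspace_L2[OF g(1)])
    define p where "p t = g t - (\<Sum>b\<in>B. ip g b * b t)" for t
    have sub: "(\<lambda>t. g t - (\<Sum>b\<in>B'. ip g b * b t)) \<in> ?E" if "B' \<subseteq> B" for B'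
      using finite_subset[OF that B(1)] that
    proof (induction B' rule: finite_induct)
      case (insert x F)
      then have "(\<lambda>t. (g t - (\<Sum>b\<in>F. ip g b * b t)) + (- ip g x) * x t) \<in> ?E"
        using B(2) by (intro eigenspace_lincomb) auto
      then show ?case using insert by (simp add: algebra_simps)
    qed (use g in simp)
    have pE: "p \<in> ?E" unfolding p_def[abs_def] by (rule sub) simp
    have pL: "p \<in> L2" by (rule eigenspace_L2[OF pE])
    have pne: "l2norm p \<noteq> 0"
    proof
      assume "l2norm p = 0"
      then have "AE t in lborel. p t = 0" using l2norm_eq_0_iff[OF pL] by simp
      then have "AE t in lborel. g t = (\<Sum>b\<in>B. ip g b * b t)" by eventually_elim (simp add: p_def)
      then show False using g(2) by blast
    qed
    have po: "ip p b = 0" if b: "b \<in> B" for b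
    proof -
      have bL: "b \<in> L2" "\<And>b'. b' \<in> B \<Longrightarrow> (\<lambda>t. ip g b' * b' t) \<in> L2" using BL b by (auto intro: L2_cmult)
      have "ip p b = ip g b - (\<Sum>b'\<in>B. ip (\<lambda>t. ip g b' * b' t) b)"
        unfolding p_def[abs_def] using ip_diff_left[OF gL L2_sum[of B "\<lambda>b' t. ip g b' * b' t", OF bL(2)] bL(1)] ip_sum_left[of B "\<lambda>b' t. ip g b' * b' t" b] bL by simp
      also have "(\<Sum>b'\<in>B. ip (\<lambda>t. ip g b' * b' t) b) = (\<Sum>b'\<in>B. if b' = b then ip g b else 0)"
        using B(3,4) b by (intro sum.cong) (auto simp: ip_cmult_left ip_self)
      also have "\<dots> = ip g b" using B(1) b by simp
      finally show ?thesis by simp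
    qed
    define a where "a = complex_of_real (1 / l2norm p)"
    have na: "norm a = 1 / l2norm p" unfolding a_def norm_of_real using pne by simp
    have z: "(\<lambda>t. p t + (-1) * p t) \<in> ?E" by (rule eigenspace_lincomb[OF pE pE])
    have "(\<lambda>t. (p t + (-1) * p t) + a * p t) \<in> ?E" by (rule eigenspace_lincomb[OF z pE])
    then have "(\<lambda>t. a * p t) \<in> ?E" by simp
    moreover have "l2norm (\<lambda>t. a * p t) = 1" unfolding l2norm_cmult na using pne by simp
    moreover have "ip b (\<lambda>t. a * p t) = 0" if "b \<in> B" for b
      unfolding ip_cmult_right ip_cnj[of b p] po[OF that] by simp
    ultimately show ?thesis by blast
  qed
  define good where "good f n \<longleftrightarrow> f n \<in> ?E \<and> l2norm (f n) = 1 \<and> (\<forall>m<n. ip (f m) (f n) = 0)" for f :: "nat \<Rightarrow> real \<Rightarrow> complex" and n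
  have "\<exists>f. \<forall>n. good f n"
  proof -
    have "\<exists>g. g \<in> ?E \<and> l2norm g = 1 \<and> (\<forall>m<n. ip (f m) g = 0)" if f: "\<And>m. m < n \<Longrightarrow> good f m" for f n
    proof -
      have "\<exists>g\<in>?E. l2norm g = 1 \<and> (\<forall>b\<in>f ` {..<n}. ip b g = 0)"
      proof (rule step)
        show "\<forall>b\<in>f ` {..<n}. \<forall>b'\<in>f ` {..<n}. b \<noteq> b' \<longrightarrow> ip b b' = 0"
        proof (intro ballI impI)
          fix b b' assume "b \<in> f ` {..<n}" "b' \<in> f ` {..<n}" and ne: "b \<noteq> b'"
          then obtain i j where ij: "i < n" "j < n" "b = f i" "b' = f j" by blast
          then have "i \<noteq> j" using ne by auto
          then consider "i < j" | "j < i" by linarith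
          then show "ip b b' = 0"
          proof cases
            case 1 then show ?thesis using f[OF ij(2)] ij by (simp add: good_def)
          next
            case 2 then show ?thesis using f[OF ij(1)] ij ip_cnj[of b b'] by (simp add: good_def)
          qed
        qed
      qed (use f in \<open>auto simp: good_def\<close>)
      then show ?thesis by blast
    qed
    then show ?thesis unfolding good_def by (rule dependent_wellorder_choice[rotated]) auto
  qed
  then obtain f where f: "\<And>n. good f n" by blast
  have orth: "ip (f m) (f n) = 0" if ne: "m \<noteq> n" for m n
  proof -
    consider "m < n" | "n < m" using ne by linarith
    then show ?thesis
    proof cases
      case 1 then show ?thesis using f[of n] by (simp add: good_def)
    next
      case 2 then show ?thesis using f[of m] ip_cnj[of "f m" "f n"] by (simp add: good_def)
    qed
  qed
  have "\<exists>h. (f n, h) \<in> op_A v Q \<and> (AE t in lborel. h t = of_real \<mu> * f n t)" for n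
    using f[of n] unfolding good_def eigenspace_def by blast
  then obtain h where "\<And>n. (f n, h n) \<in> op_A v Q" "\<And>n. AE t in lborel. h n t = of_real \<mu> * f n t" by metis
  then show False
    using no_orthonormal_eigenvectors[OF mu, of f h "\<lambda>_. \<mu>"] f orth by (simp add: good_def)
qed

lemma real_spec_not_bounded_below: "of_real \<mu> \<in> spec (op_A v Q) \<Longrightarrow> \<not> bounded_below (of_real \<mu>)"
  unfolding spec_def using resolvent_setI[of "of_real \<mu>"] by auto

lemma islimpt_distinct_sequence:
  fixes x :: "'a::metric_space"
  assumes "x islimpt S"
  obtains f :: "nat \<Rightarrow> 'a" where "\<And>n. f n \<in> S - {x}" "f \<longlonglongrightarrow> x" "\<And>m n. f m = f n \<Longrightarrow> m = n"
proof -
  have "\<exists>f. \<forall>n::nat. (f n \<in> S \<and> f n \<noteq> x \<and> dist (f n) x < inverse (real (Suc n))) \<and> dist (f (Suc n)) x < dist (f n) x"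
  proof (rule dependent_nat_choice)
    show "\<exists>y. y \<in> S \<and> y \<noteq> x \<and> dist y x < inverse (real (Suc 0))"
      using assms[unfolded islimpt_approachable, rule_format, of 1] by auto
    fix y and n :: nat assume "y \<in> S \<and> y \<noteq> x \<and> dist y x < inverse (real (Suc n))"
    then have "min (dist y x) (inverse (real (Suc (Suc n)))) > 0" by simp
    then obtain y' where "y' \<in> S" "y' \<noteq> x" "dist y' x < min (dist y x) (inverse (real (Suc (Suc n))))"
      using assms unfolding islimpt_approachable by blast
    then show "\<exists>y'. (y' \<in> S \<and> y' \<noteq> x \<and> dist y' x < inverse (real (Suc (Suc n)))) \<and> dist y' x < dist y x"
      by auto
  qed
  then obtain f where f: "\<And>n::nat. f n \<in> S \<and> f n \<noteq> x \<and> dist (f n) x < inverse (real (Suc n))"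
    "\<And>n. dist (f (Suc n)) x < dist (f n) x" by blast
  have "strict_mono (\<lambda>n. - dist (f n) x)" unfolding strict_mono_Suc_iff using f(2) by simp
  then have inj: "m = n" if "f m = f n" for m n using that strict_mono_eq[of "\<lambda>n. - dist (f n) x" m n] by simp
  have "(\<lambda>n. dist (f n) x) \<longlonglongrightarrow> 0"
    by (rule tendsto_sandwich[OF _ _ tendsto_const LIMSEQ_inverse_real_of_nat])
       (use f(1) less_imp_le in \<open>auto intro!: always_eventually simp del: of_nat_Suc\<close>)
  then have "f \<longlonglongrightarrow> x" by (simp add: tendsto_dist_iff[of f x])
  then show ?thesis using that[of f] f(1) inj by blast
qed

text \<open>Eigenvalues accumulating at \<open>\<mu>\<close> would supply an orthonormal sequence of eigenfunctions, since
  eigenfunctions of a symmetric operator for different eigenvalues are orthogonal.\<close>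

lemma negative_spec_isolated:
  assumes mu: "\<mu> < 0" and sp: "of_real \<mu> \<in> spec (op_A v Q)"
  shows "complex_of_real \<mu> isolated_in spec (op_A v Q)"
proof (rule ccontr)
  assume "\<not> complex_of_real \<mu> isolated_in spec (op_A v Q)"
  then have lp: "complex_of_real \<mu> islimpt spec (op_A v Q)" using sp by (simp add: isolated_in_islimpt_iff)
  obtain f where f: "\<And>n::nat. f n \<in> spec (op_A v Q) - {complex_of_real \<mu>}" "f \<longlonglongrightarrow> complex_of_real \<mu>"
    "\<And>m n. f m = f n \<Longrightarrow> m = n"
    using islimpt_distinct_sequence[OF lp] by blast
  define x where "x n = Re (f n)" for n
  have fx: "f n = of_real (x n)" for n
    using f(1)[of n] nonreal_not_in_spec[of "f n"] unfolding x_def by (auto simp: complex_eq_iff)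
  have xl: "x \<longlonglongrightarrow> \<mu>" using tendsto_Re[OF f(2)] by (simp add: x_def[abs_def])
  then obtain N where N: "\<And>n. n \<ge> N \<Longrightarrow> x n < 0"
    using order_tendstoD(2)[OF xl mu] unfolding eventually_sequentially by blast
  define y where "y n = x (N + n)" for n
  have yneg: "y n < 0" for n using N[of "N + n"] by (simp add: y_def)
  have yl: "y \<longlonglongrightarrow> \<mu>" unfolding y_def using LIMSEQ_ignore_initial_segment[OF xl, of N] by (simp add: add.commute)
  have yinj: "y m \<noteq> y n" if "m \<noteq> n" for m n
    using f(3)[of "N + m" "N + n"] fx that unfolding y_def by (metis add_left_cancel)
  have "\<exists>g h. (g, h) \<in> op_A v Q \<and> (AE t in lborel. h t = of_real (y n) * g t) \<and> l2norm g = 1" for n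
  proof -
    have "\<not> bounded_below (of_real (y n))"
      using f(1)[of "N + n"] fx[of "N + n"] real_spec_not_bounded_below by (simp add: y_def)
    then show ?thesis using not_bounded_below_eigenvalue[OF yneg] by metis
  qed
  then obtain g h where gh: "\<And>n. (g n, h n) \<in> op_A v Q" "\<And>n. AE t in lborel. h n t = of_real (y n) * g n t"
    "\<And>n. l2norm (g n) = 1" by metis
  have gL: "g n \<in> L2" "h n \<in> L2" for n using gh(1)[of n] unfolding op_A_iff by auto
  have "ip (g m) (g n) = 0" if "m \<noteq> n" for m n
  proof -
    note [measurable] = L2_measurable[OF gL(1)] L2_measurable[OF gL(2)]
    have "ip (h m) (g n) = of_real (y m) * ip (g m) (g n)"
      unfolding ip_cmult_left[symmetric] unfolding ip_def
      by (rule integral_cong_AE, measurable, measurable) (use gh(2)[of m] in auto)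
    moreover have "ip (g m) (h n) = of_real (y n) * ip (g m) (g n)"
    proof -
      have "ip (g m) (h n) = ip (g m) (\<lambda>t. of_real (y n) * g n t)"
        unfolding ip_def by (rule integral_cong_AE, measurable, measurable) (use gh(2)[of n] in auto)
      then show ?thesis by (simp add: ip_cmult_right)
    qed
    moreover have "ip (h m) (g n) = ip (g m) (h n)" by (rule op_A_symmetric[OF gh(1) gh(1)])
    ultimately have "(of_real (y m) - complex_of_real (y n)) * ip (g m) (g n) = 0" by (auto simp: algebra_simps)
    then show ?thesis using yinj[OF that] by auto
  qed
  then show False using no_orthonormal_eigenvectors[OF mu gh(1,2) yl gh(3)] by blast
qed

lemma negative_spec_disc:
  assumes mu: "\<mu> < 0" and sp: "of_real \<mu> \<in> spec (op_A v Q)"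
  shows "of_real \<mu> \<in> spec_disc (op_A v Q)"
proof -
  obtain g h where gh: "(g, h) \<in> op_A v Q" "AE t in lborel. h t = of_real \<mu> * g t" "l2norm g = 1"
    using not_bounded_below_eigenvalue[OF mu real_spec_not_bounded_below[OF sp]] by blast
  have "g \<in> L2" using gh(1) unfolding op_A_iff by blast
  then have "\<not> (AE t in lborel. g t = 0)" using gh(3) l2norm_eq_0_iff by fastforce
  then have "eigenvalue (op_A v Q) (of_real \<mu>)" unfolding eigenvalue_def eigenspace_def using gh by blast
  then show ?thesis unfolding spec_disc_def
    using negative_spec_isolated[OF mu sp] eigenspace_finite_dim[OF mu] by blast
qed

end


section \<open>Symbol classes\<close>

text \<open>Families of functions whose derivatives up to a given order are all dominated by one and the
  same weight, uniformly in the index. These classes are stable under the operations of the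
  calculus, which replaces explicit formulas for the terms of the asymptotic expansion.\<close>

definition symb :: "(real \<Rightarrow> real) \<Rightarrow> nat \<Rightarrow> (nat \<Rightarrow> real \<Rightarrow> complex) set" where
  "symb \<omega> m = {F. (\<forall>n. F n \<in> Ck m) \<and> (\<exists>B. \<forall>n j t. j \<le> m \<longrightarrow> norm (nderiv j (F n) t) \<le> B * \<omega> t)}"

lemma symb_Ck: "F \<in> symb \<omega> m \<Longrightarrow> F n \<in> Ck m"
  by (simp add: symb_def)

lemma symbE:
  assumes "F \<in> symb \<omega> m"
  obtains B where "\<And>n j t. j \<le> m \<Longrightarrow> norm (nderiv j (F n) t) \<le> B * \<omega> t"
  using assms unfolding symb_def by blast

lemma symb_order_mono:
  assumes "F \<in> symb \<omega> m" "k \<le> m" shows "F \<in> symb \<omega> k"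
proof -
  obtain B where B: "\<And>n j t. j \<le> m \<Longrightarrow> norm (nderiv j (F n) t) \<le> B * \<omega> t" using symbE[OF assms(1)] by blast
  show ?thesis
    unfolding symb_def
  proof (intro CollectI conjI allI exI[of _ B] impI)
    show "F n \<in> Ck k" for n by (rule Ck_mono[OF symb_Ck[OF assms(1)] assms(2)])
    show "norm (nderiv j (F n) t) \<le> B * \<omega> t" if "j \<le> k" for n j t
      using that assms(2) by (intro B) simp
  qed
qed

lemma symb_deriv: 
  assumes "F \<in> symb \<omega> (Suc m)" shows "(\<lambda>n. nderiv 1 (F n)) \<in> symb \<omega> m"
proof -
  obtain B where B: "\<And>n j t. j \<le> Suc m \<Longrightarrow> norm (nderiv j (F n) t) \<le> B * \<omega> t" using symbE[OF assms] by blast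
  have "norm (nderiv j (nderiv 1 (F n)) t) \<le> B * \<omega> t" if "j \<le> m" for n j t
    using B[of "Suc j" n t] that by (simp add: nderiv_add_index)
  moreover have "nderiv 1 (F n) \<in> Ck m" for n using symb_Ck[OF assms, of n] by (simp add: Ck_Suc)
  ultimately show ?thesis unfolding symb_def by blast
qed

lemma symb_SucI:
  assumes d: "\<And>n t. (F n has_vector_derivative F' n t) (at t)" and F': "F' \<in> symb \<omega> m"
    and b: "\<And>n t. norm (F n t) \<le> c * \<omega> t" and \<omega>: "\<And>t. 0 \<le> \<omega> t"
  shows "F \<in> symb \<omega> (Suc m)"
proof -
  obtain B where B: "\<And>n j t. j \<le> m \<Longrightarrow> norm (nderiv j (F' n) t) \<le> B * \<omega> t" using symbE[OF F'] by blast
  have D: "nderiv (Suc 0) (F n) = F' n" for n by (rule nderiv_1_eq[OF d])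
  have "norm (nderiv j (F n) t) \<le> max B c * \<omega> t" if "j \<le> Suc m" for n j t
  proof (cases j)
    case 0
    have "c * \<omega> t \<le> max B c * \<omega> t" using \<omega>[of t] by (intro mult_right_mono) auto
    then show ?thesis using b[of n t] 0 by simp
  next
    case (Suc i)
    have "nderiv j (F n) = nderiv i (F' n)" using nderiv_of_deriv[of i "F n"] unfolding D Suc by simp
    moreover have "B * \<omega> t \<le> max B c * \<omega> t" using \<omega>[of t] by (intro mult_right_mono) auto
    ultimately show ?thesis using B[of i n t] that Suc by simp
  qed
  moreover have "F n \<in> Ck (Suc m)" for n by (rule Ck_SucI[OF d symb_Ck[OF F']])
  ultimately show ?thesis unfolding symb_def by blast
qed

lemma symb_weight:
  assumes F: "F \<in> symb \<omega> m" and le: "\<And>t. \<omega> t \<le> c * \<omega>' t" and \<omega>: "\<And>t. 0 \<le> \<omega> t"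
  shows "F \<in> symb \<omega>' m"
proof -
  obtain B where B: "\<And>n j t. j \<le> m \<Longrightarrow> norm (nderiv j (F n) t) \<le> B * \<omega> t" using symbE[OF F] by blast
  have "norm (nderiv j (F n) t) \<le> (\<bar>B\<bar> * c) * \<omega>' t" if "j \<le> m" for n j t
  proof -
    have "B * \<omega> t \<le> \<bar>B\<bar> * \<omega> t" using \<omega>[of t] by (intro mult_right_mono) auto
    also have "\<dots> \<le> \<bar>B\<bar> * (c * \<omega>' t)" using le by (intro mult_left_mono) auto
    finally show ?thesis using B[OF that, of n t] by (simp add: mult.assoc)
  qed
  then show ?thesis using F unfolding symb_def by blast
qed

lemma symb_add:
  assumes "F \<in> symb \<omega> m" "G \<in> symb \<omega> m" shows "(\<lambda>n t. F n t + G n t) \<in> symb \<omega> m"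
proof -
  obtain B where B: "\<And>n j t. j \<le> m \<Longrightarrow> norm (nderiv j (F n) t) \<le> B * \<omega> t" using symbE[OF assms(1)] by blast
  obtain B' where B': "\<And>n j t. j \<le> m \<Longrightarrow> norm (nderiv j (G n) t) \<le> B' * \<omega> t" using symbE[OF assms(2)] by blast
  have "norm (nderiv j (\<lambda>t. F n t + G n t) t) \<le> (B + B') * \<omega> t" if "j \<le> m" for n j t
    unfolding nderiv_add[OF symb_Ck[OF assms(1)] symb_Ck[OF assms(2)] that]
    using norm_triangle_ineq[of "nderiv j (F n) t" "nderiv j (G n) t"] B[OF that, of n t] B'[OF that, of n t]
    by (simp add: distrib_right)
  then show ?thesis unfolding symb_def using Ck_add[OF symb_Ck[OF assms(1)] symb_Ck[OF assms(2)]] by blast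
qed

lemma symb_mult:
  assumes \<omega>: "\<And>t. 0 \<le> \<omega> t" "\<And>t. 0 \<le> \<omega>' t"
  shows "F \<in> symb \<omega> m \<Longrightarrow> G \<in> symb \<omega>' m \<Longrightarrow> (\<lambda>n t. F n t * G n t) \<in> symb (\<lambda>t. \<omega> t * \<omega>' t) m"
proof (induction m arbitrary: F G)
  case m: 0
  obtain B where B: "\<And>n t. norm (F n t) \<le> B * \<omega> t" using symbE[OF m(1)] by (metis le_refl nderiv_0)
  obtain B' where B': "\<And>n t. norm (G n t) \<le> B' * \<omega>' t" using symbE[OF m(2)] by (metis le_refl nderiv_0)
  have "norm (F n t * G n t) \<le> (B * B') * (\<omega> t * \<omega>' t)" for n t
  proof -
    have "norm (F n t) * norm (G n t) \<le> (B * \<omega> t) * (B' * \<omega>' t)"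
      by (rule mult_mono[OF B B']) (use B[of n t] norm_ge_zero order_trans in \<open>blast, simp\<close>)
    then show ?thesis by (simp add: norm_mult mult_ac)
  qed
  then show ?case unfolding symb_def using Ck_mult[OF symb_Ck[OF m(1)] symb_Ck[OF m(2)]] by auto
next
  case (Suc m)
  obtain B where B: "\<And>n t. norm (F n t) \<le> B * \<omega> t" using symbE[OF Suc.prems(1)] by (metis le0 nderiv_0)
  obtain B' where B': "\<And>n t. norm (G n t) \<le> B' * \<omega>' t" using symbE[OF Suc.prems(2)] by (metis le0 nderiv_0)
  show ?case
  proof (rule symb_SucI)
    show "((\<lambda>t. F n t * G n t) has_vector_derivative F n t * nderiv 1 (G n) t + nderiv 1 (F n) t * G n t) (at t)" for n t
      by (intro has_vector_derivative_mult Ck_has_derivative_Suc[OF symb_Ck[OF Suc.prems(1)]] Ck_has_derivative_Suc[OF symb_Ck[OF Suc.prems(2)]])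
    show "(\<lambda>n t. F n t * nderiv 1 (G n) t + nderiv 1 (F n) t * G n t) \<in> symb (\<lambda>t. \<omega> t * \<omega>' t) m"
      by (intro symb_add Suc.IH symb_deriv symb_order_mono[OF Suc.prems(1)] symb_order_mono[OF Suc.prems(2)] Suc.prems) auto
    show "norm (F n t * G n t) \<le> (B * B') * (\<omega> t * \<omega>' t)" for n t
    proof -
      have "norm (F n t) * norm (G n t) \<le> (B * \<omega> t) * (B' * \<omega>' t)"
        by (rule mult_mono[OF B B']) (use B[of n t] norm_ge_zero order_trans in \<open>blast, simp\<close>)
      then show ?thesis by (simp add: norm_mult mult_ac)
    qed
    show "0 \<le> \<omega> t * \<omega>' t" for t using \<omega> by simp
  qed
qed

lemma symb_const: "(\<And>t. \<omega> t = 1) \<Longrightarrow> (\<lambda>n t. c) \<in> symb \<omega> m"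
  unfolding symb_def
proof (intro CollectI conjI allI exI[of _ "norm c"] impI)
  fix n j t assume "\<And>t. \<omega> t = 1"
  then show "norm (nderiv j (\<lambda>t. c) t) \<le> norm c * \<omega> t" by (cases j) (simp_all add: nderiv_const)
qed simp

lemma symb_cmult:
  assumes "F \<in> symb \<omega> m" and \<omega>: "\<And>t. 0 \<le> \<omega> t" shows "(\<lambda>n t. c * F n t) \<in> symb \<omega> m"
  using symb_mult[OF _ \<omega> symb_const[of "\<lambda>_. 1" c m] assms(1)] by simp

lemma symb_power:
  assumes "F \<in> symb \<omega> m" and \<omega>: "\<And>t. 0 \<le> \<omega> t" shows "(\<lambda>n t. F n t ^ k) \<in> symb (\<lambda>t. \<omega> t ^ k) m"
proof (induction k)
  case 0 show ?case by (simp add: symb_const)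
next
  case (Suc k)
  then show ?case using symb_mult[OF \<omega> _ assms(1) Suc] \<omega> by simp
qed

context weighted_op
begin

section \<open>Approximate eigenfunctions on the positive half-line\<close>

lemma symb_v_deriv:
  assumes vk: "\<And>k t. k \<le> K - 1 \<Longrightarrow> \<bar>nderiv k v t\<bar> \<le> B * v t" and m: "Suc m \<le> K - 1"
  shows "(\<lambda>n t. complex_of_real (nderiv 1 v t)) \<in> symb v m"
  unfolding symb_def
proof (intro CollectI conjI allI exI[of _ B] impI)
  have C: "nderiv 1 v \<in> Ck m" by (rule nderiv_in_Ck'[OF v_Ck]) (use m in simp)
  then show "(\<lambda>t. complex_of_real (nderiv 1 v t)) \<in> Ck m" by (rule Ck_of_real)
  fix n :: nat and j t assume "j \<le> m"
  then show "norm (nderiv j (\<lambda>t. complex_of_real (nderiv 1 v t)) t) \<le> B * v t"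
    unfolding nderiv_of_real[OF C \<open>j \<le> m\<close>] norm_of_real nderiv_add_index using vk[of "j + 1" t] m by simp
qed

text \<open>Real powers of \<open>v\<close> dominate their derivatives because \<open>v\<close> does.\<close>

lemma symb_v_inverse:
  assumes vk: "\<And>k t. k \<le> K - 1 \<Longrightarrow> \<bar>nderiv k v t\<bar> \<le> B * v t"
  shows "m \<le> K - 1 \<Longrightarrow> (\<lambda>n t. complex_of_real (inverse (v t))) \<in> symb (\<lambda>t. inverse (v t)) m"
proof (induction m)
  case 0
  have "(\<lambda>t. complex_of_real (inverse (v t))) \<in> Ck 0"
    using Ck_of_real[OF Ck_inverse[OF v_nonzero v_Ck]] Ck_mono by blast
  then show ?case unfolding symb_def using v_pos by (auto intro!: exI[of _ 1] simp: norm_inverse less_imp_le)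
next
  case (Suc m)
  have v0: "0 \<le> v t" "0 \<le> inverse (v t)" for t using v_pos[of t] by auto
  have C: "v \<in> Ck (Suc m)" by (rule Ck_mono[OF v_Ck]) (use Suc.prems in simp)
  show ?case
  proof (rule symb_SucI)
    show "((\<lambda>t. complex_of_real (inverse (v t))) has_vector_derivative
        (-1) * (complex_of_real (inverse (v t)) * complex_of_real (nderiv 1 v t) * complex_of_real (inverse (v t)))) (at t)" for t
    proof -
      have "((\<lambda>t. inverse (v t)) has_vector_derivative - (inverse (v t) * nderiv 1 v t * inverse (v t))) (at t)"
        using Ck_has_derivative_Suc[OF C, of t] v_nonzero[of t]
        unfolding has_real_derivative_iff_has_vector_derivative[symmetric] by (intro DERIV_inverse')
      from bounded_linear.has_vector_derivative[OF bounded_linear_of_real[where 'a = complex] this] show ?thesis by simp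
    qed
    have IH: "(\<lambda>n t. complex_of_real (inverse (v t))) \<in> symb (\<lambda>t. inverse (v t)) m" using Suc by simp
    have "(\<lambda>n t. complex_of_real (inverse (v t)) * complex_of_real (nderiv 1 v t) * complex_of_real (inverse (v t)))
        \<in> symb (\<lambda>t. inverse (v t) * v t * inverse (v t)) m"
      using Suc.prems by (intro symb_mult IH symb_v_deriv[OF vk] v0 mult_nonneg_nonneg)
    then show "(\<lambda>n t. (-1) * (complex_of_real (inverse (v t)) * complex_of_real (nderiv 1 v t) * complex_of_real (inverse (v t))))
        \<in> symb (\<lambda>t. inverse (v t)) m"
      using v_nonzero v0 by (intro symb_cmult) simp_all
    show "norm (complex_of_real (inverse (v t))) \<le> 1 * inverse (v t)" for t using v0 by (simp add: norm_inverse)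
  qed (use v0 in auto)
qed

lemma symb_v_powr:
  assumes vk: "\<And>k t. k \<le> K - 1 \<Longrightarrow> \<bar>nderiv k v t\<bar> \<le> B * v t"
  shows "m \<le> K - 1 \<Longrightarrow> (\<lambda>n t. complex_of_real (v t powr p)) \<in> symb (\<lambda>t. v t powr p) m"
proof (induction m)
  case 0
  have "(\<lambda>t. complex_of_real (v t powr p)) \<in> Ck 0"
    using Ck_of_real[OF Ck_powr[OF v_pos v_Ck]] Ck_mono by blast
  then show ?case unfolding symb_def by (auto intro!: exI[of _ 1])
next
  case (Suc m)
  have v0: "0 \<le> v t" "0 \<le> inverse (v t)" for t using v_pos[of t] by auto
  have C: "v \<in> Ck (Suc m)" by (rule Ck_mono[OF v_Ck]) (use Suc.prems in simp)
  show ?case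
  proof (rule symb_SucI)
    show "((\<lambda>t. complex_of_real (v t powr p)) has_vector_derivative
        of_real p * (complex_of_real (nderiv 1 v t) * complex_of_real (inverse (v t)) * complex_of_real (v t powr p))) (at t)" for t
    proof -
      have "((\<lambda>t. v t powr p) has_real_derivative p * v t powr (p - 1) * nderiv 1 v t) (at t)"
        using Ck_has_derivative_Suc[OF C, of t] v_pos[of t] DERIV_fun_powr[of v _ t p]
        unfolding has_real_derivative_iff_has_vector_derivative[symmetric] by simp
      moreover have "v t powr (p - 1) = inverse (v t) * v t powr p"
        using v_pos[of t] by (simp add: powr_diff field_simps)
      ultimately have "((\<lambda>t. v t powr p) has_vector_derivative p * (nderiv 1 v t * inverse (v t) * v t powr p)) (at t)"
        by (simp add: has_real_derivative_iff_has_vector_derivative mult_ac)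
      from bounded_linear.has_vector_derivative[OF bounded_linear_of_real[where 'a = complex] this] show ?thesis by simp
    qed
    have IH: "(\<lambda>n t. complex_of_real (v t powr p)) \<in> symb (\<lambda>t. v t powr p) m" using Suc by simp
    have inv: "(\<lambda>n t. complex_of_real (inverse (v t))) \<in> symb (\<lambda>t. inverse (v t)) m"
      by (rule symb_v_inverse[OF vk]) (use Suc.prems in auto)
    have "(\<lambda>n t. complex_of_real (nderiv 1 v t) * complex_of_real (inverse (v t)) * complex_of_real (v t powr p))
        \<in> symb (\<lambda>t. v t * inverse (v t) * v t powr p) m"
      using Suc.prems by (intro symb_mult IH inv symb_v_deriv[OF vk] v0 mult_nonneg_nonneg powr_ge_zero)
    then show "(\<lambda>n t. of_real p * (complex_of_real (nderiv 1 v t) * complex_of_real (inverse (v t)) * complex_of_real (v t powr p)))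
        \<in> symb (\<lambda>t. v t powr p) m"
      using v_nonzero by (intro symb_cmult) simp_all
    show "norm (complex_of_real (v t powr p)) \<le> 1 * v t powr p" for t by simp
  qed simp
qed

text \<open>The amplitude of the \<open>k\<close>-th derivative of \<open>\<eta> exp (-i \<Psi>)\<close>, where \<open>\<Psi>' = a\<close>: the leading part is
  \<open>(-i a)\<^sup>k \<eta>\<close>, and every derivative that falls on \<open>a\<close> or \<open>\<eta>\<close> instead of the exponential costs one
  power of the large function \<open>a\<close>.\<close>

lemma wkb_expansion:
  fixes a \<Psi> :: "real \<Rightarrow> real" and \<eta> :: "nat \<Rightarrow> real \<Rightarrow> complex"
  assumes aC: "a \<in> Ck N" and asym: "(\<lambda>n t. complex_of_real (a t)) \<in> symb a (N - 1)"
    and a0: "a0 > 0" "\<And>t. a0 \<le> a t"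
    and \<Psi>: "\<And>t. (\<Psi> has_real_derivative a t) (at t)"
    and \<eta>: "\<eta> \<in> symb (\<lambda>_. 1) N"
  shows "k \<le> N \<Longrightarrow> \<exists>R. R \<in> symb (\<lambda>t. a t ^ (k - 1)) (N - k) \<and>
    (\<forall>n t. nderiv k (\<lambda>t. \<eta> n t * exp (- \<i> * of_real (\<Psi> t))) t
      = ((- \<i> * of_real (a t)) ^ k * \<eta> n t + R n t) * exp (- \<i> * of_real (\<Psi> t))) \<and> (k = 0 \<longrightarrow> R = (\<lambda>n t. 0))"
proof (induction k)
  case 0
  have "(\<lambda>n t. 0 :: complex) \<in> symb (\<lambda>t. a t ^ (0 - 1)) (N - 0)" by (rule symb_const) simp
  then show ?case by (intro exI[of _ "\<lambda>n t. 0"]) simp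
next
  case (Suc k)
  let ?E = "\<lambda>t. exp (- \<i> * of_real (\<Psi> t))"
  have an: "a t \<ge> 0" for t using a0(2)[of t] a0(1) by linarith
  obtain R where R: "R \<in> symb (\<lambda>t. a t ^ (k - 1)) (N - k)"
    "\<And>n t. nderiv k (\<lambda>t. \<eta> n t * ?E t) t = ((- \<i> * of_real (a t)) ^ k * \<eta> n t + R n t) * ?E t" "k = 0 \<longrightarrow> R = (\<lambda>n t. 0)"
    using Suc by auto
  define L where "L n t = (- \<i> * of_real (a t)) ^ k * \<eta> n t" for n t
  define m where "m = N - Suc k"
  have Nk: "N - k = Suc m" using Suc.prems by (simp add: m_def)
  have RC: "R n \<in> Ck (Suc m)" for n using symb_Ck[OF R(1)] unfolding Nk .
  have Lsym: "L \<in> symb (\<lambda>t. a t ^ k) (Suc m)"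
  proof (cases "k = 0")
    case True
    then show ?thesis using symb_order_mono[OF \<eta>, of "Suc m"] Nk by (simp add: L_def[abs_def])
  next
    case False
    then have le: "Suc m \<le> N - 1" using Nk by simp
    have "(\<lambda>n t. (- \<i> * complex_of_real (a t)) ^ k * \<eta> n t) \<in> symb (\<lambda>t. a t ^ k * 1) (Suc m)"
      using symb_order_mono[OF asym le] symb_order_mono[OF \<eta>, of "Suc m"] le an
      by (intro symb_mult symb_power symb_cmult) auto
    then show ?thesis by (simp add: L_def[abs_def])
  qed
  have LC: "L n \<in> Ck (Suc m)" for n by (rule symb_Ck[OF Lsym])
  have E': "(?E has_vector_derivative (- \<i> * of_real (a t)) * ?E t) (at t)" for t
  proof -
    have "((\<lambda>t. complex_of_real (\<Psi> t)) has_vector_derivative of_real (a t)) (at t)"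
      using bounded_linear.has_vector_derivative[OF bounded_linear_of_real \<Psi>[unfolded has_real_derivative_iff_has_vector_derivative]] .
    then have "((\<lambda>t. - \<i> * complex_of_real (\<Psi> t)) has_vector_derivative - \<i> * of_real (a t)) (at t)"
      by (rule has_vector_derivative_mult_right)
    from field_vector_diff_chain_at[OF this DERIV_exp] show ?thesis by (simp add: o_def)
  qed
  define R' where "R' n t = (nderiv 1 (L n) t + nderiv 1 (R n) t) + (- \<i>) * (of_real (a t) * R n t)" for n t
  have "nderiv (Suc k) (\<lambda>t. \<eta> n t * ?E t) t = ((- \<i> * of_real (a t)) ^ Suc k * \<eta> n t + R' n t) * ?E t" for n t
  proof -
    have eq: "nderiv k (\<lambda>t. \<eta> n t * ?E t) = (\<lambda>t. (L n t + R n t) * ?E t)"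
      using R(2)[of n] by (auto simp: L_def)
    have "((\<lambda>t. (L n t + R n t) * ?E t) has_vector_derivative
        (L n t + R n t) * ((- \<i> * of_real (a t)) * ?E t) + (nderiv 1 (L n) t + nderiv 1 (R n) t) * ?E t) (at t)"
      by (intro has_vector_derivative_mult has_vector_derivative_add E' Ck_has_derivative_Suc[OF LC] Ck_has_derivative_Suc[OF RC])
    then have "nderiv (Suc k) (\<lambda>t. \<eta> n t * ?E t) t
        = (L n t + R n t) * ((- \<i> * of_real (a t)) * ?E t) + (nderiv 1 (L n) t + nderiv 1 (R n) t) * ?E t"
      unfolding nderiv_Suc[of k "\<lambda>t. \<eta> n t * ?E t"] eq by (rule vector_derivative_at)
    then show ?thesis unfolding R'_def L_def by (simp add: algebra_simps)
  qed
  moreover have "R' \<in> symb (\<lambda>t. a t ^ k) m"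
  proof -
    have wt: "a t ^ (k - 1) \<le> (1 + 1 / a0) * a t ^ k" for t
    proof (cases k)
      case 0 then show ?thesis using a0(1) by simp
    next
      case (Suc i)
      have "1 \<le> (1 + 1 / a0) * a t"
      proof -
        have "1 = 1 / a0 * a0" using a0(1) by simp
        also have "\<dots> \<le> (1 + 1 / a0) * a t" using a0 by (intro mult_mono) auto
        finally show ?thesis .
      qed
      then have "1 * a t ^ i \<le> ((1 + 1 / a0) * a t) * a t ^ i" using an by (intro mult_right_mono) auto
      then show ?thesis using Suc by (simp add: mult.assoc)
    qed
    have 1: "(\<lambda>n. nderiv 1 (L n)) \<in> symb (\<lambda>t. a t ^ k) m" by (rule symb_deriv[OF Lsym])
    have "(\<lambda>n. nderiv 1 (R n)) \<in> symb (\<lambda>t. a t ^ (k - 1)) m" by (rule symb_deriv[OF R(1)[unfolded Nk]])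
    then have 2: "(\<lambda>n. nderiv 1 (R n)) \<in> symb (\<lambda>t. a t ^ k) m" by (rule symb_weight[OF _ wt]) (use an in simp)
    have 3: "(\<lambda>n t. of_real (a t) * R n t) \<in> symb (\<lambda>t. a t ^ k) m"
    proof (cases "k = 0")
      case True
      then have "R = (\<lambda>n t. 0)" using R(3) by simp
      then show ?thesis using symb_const[of "\<lambda>t. a t ^ k" 0 m] True by simp
    next
      case False
      then have "m \<le> N - 1" by (simp add: m_def)
      then have "(\<lambda>n t. of_real (a t) * R n t) \<in> symb (\<lambda>t. a t * a t ^ (k - 1)) m"
        using symb_order_mono[OF asym, of m] symb_order_mono[OF R(1)[unfolded Nk], of m] an by (intro symb_mult) auto
      moreover have "(\<lambda>t. a t * a t ^ (k - 1)) = (\<lambda>t. a t ^ k)" using False by (cases k) auto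
      ultimately show ?thesis by simp
    qed
    show ?thesis unfolding R'_def[abs_def] using 1 2 3 an by (intro symb_add symb_cmult) auto
  qed
  ultimately show ?case unfolding m_def by (intro exI[of _ R']) auto
qed

text \<open>With \<open>q a\<^sup>K = \<mu> v\<^sup>-\<^sup>2\<close> the leading terms of \<open>Q(D) f - \<mu> v\<^sup>-\<^sup>2 f\<close> cancel. What remains contains at most
  \<open>K - 1\<close> factors \<open>a\<close>, and lower powers of \<open>a\<close> are dominated by higher ones since \<open>v\<close> is bounded.\<close>

lemma approximate_solution:
  assumes vk: "\<And>k t. k \<le> K - 1 \<Longrightarrow> \<bar>nderiv k v t\<bar> \<le> B * v t" and mu: "\<mu> > 0" and \<delta>: "\<delta> > 0"
  obtains f :: "nat \<Rightarrow> real \<Rightarrow> complex" and D where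
    "\<And>n. f n \<in> Ck K" "\<And>n t. \<bar>t\<bar> \<ge> real (Suc n) * (1 + \<delta>) \<Longrightarrow> f n t = 0"
    "\<And>n t. \<bar>t\<bar> \<le> real (Suc n) \<Longrightarrow> norm (f n t) = 1"
    "\<And>n t. norm (polyD Q (f n) t - of_real (\<mu> * v t powr (- 2)) * f n t) \<le> D * v t powr (- 2 + 2 / real K)"
proof -
  define q where "q = coeff Q K"
  have q: "q > 0" using lead_pos by (simp add: q_def)
  have K0: "K > 0" using deg_ge_2 by simp
  define c where "c = (\<mu> / q) powr (1 / real K)"
  have c: "c > 0" unfolding c_def using mu q by simp
  define a where "a t = c * v t powr (- 2 / real K)" for t
  have a_pos: "a t > 0" for t unfolding a_def using c v_pos[of t] by simp
  have aC: "a \<in> Ck K" unfolding a_def[abs_def] by (intro Ck_cmult Ck_powr v_pos v_Ck)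
  have asym: "(\<lambda>n t. complex_of_real (a t)) \<in> symb a (K - 1)"
  proof -
    have "(\<lambda>n t. complex_of_real c * complex_of_real (v t powr (- 2 / real K))) \<in> symb (\<lambda>t. v t powr (- 2 / real K)) (K - 1)"
      by (intro symb_cmult symb_v_powr[OF vk]) auto
    then have "(\<lambda>n t. complex_of_real (a t)) \<in> symb (\<lambda>t. v t powr (- 2 / real K)) (K - 1)" by (simp add: a_def)
    then show ?thesis by (rule symb_weight[of _ _ _ "1 / c"]) (use c in \<open>auto simp: a_def\<close>)
  qed
  have aK: "q * a t ^ K = \<mu> * v t powr (- 2)" for t
  proof -
    have "a t ^ K = c ^ K * (v t powr (- 2 / real K)) ^ K" by (simp add: a_def power_mult_distrib)
    also have "c ^ K = \<mu> / q" unfolding c_def using mu q K0 by (simp add: powr_realpow[symmetric] powr_powr)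
    also have "(v t powr (- 2 / real K)) ^ K = v t powr (- 2)"
      using v_pos[of t] K0 by (simp add: powr_realpow[symmetric] powr_powr)
    finally show ?thesis using q by simp
  qed
  obtain Bv where Bv: "Bv > 0" "\<And>t. v t \<le> Bv" using v_bounded by blast
  define a0 where "a0 = c * Bv powr (- 2 / real K)"
  have a0: "a0 > 0" "\<And>t. a0 \<le> a t"
  proof -
    show "a0 > 0" unfolding a0_def using c Bv(1) by simp
    show "a0 \<le> a t" for t unfolding a0_def a_def
      using c Bv v_pos[of t] K0 by (intro mult_left_mono powr_mono2') auto
  qed
  have powers: "a t ^ k \<le> (1 / a0) ^ (K - 1 - k) * a t ^ (K - 1)" if "k \<le> K - 1" for k t
  proof -
    have "1 \<le> (1 / a0 * a t) ^ (K - 1 - k)" using a0(1) a0(2)[of t] by (intro one_le_power) (simp add: field_simps)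
    then have "1 * a t ^ k \<le> (1 / a0 * a t) ^ (K - 1 - k) * a t ^ k" using a_pos[of t] by (intro mult_right_mono) auto
    also have "\<dots> = (1 / a0) ^ (K - 1 - k) * (a t ^ (K - 1 - k) * a t ^ k)" by (simp only: power_mult_distrib mult.assoc)
    also have "a t ^ (K - 1 - k) * a t ^ k = a t ^ (K - 1)" 
    proof -
      have "K - 1 - k + k = K - 1" using that by simp
      then show ?thesis by (simp only: power_add[symmetric])
    qed
    finally show ?thesis by simp
  qed
  obtain M and \<eta> :: "nat \<Rightarrow> real \<Rightarrow> real" where \<eta>: "M > 0"
    "\<And>n. n \<ge> 1 \<Longrightarrow> \<eta> n \<in> Ck K" "\<And>n x. 0 \<le> \<eta> n x" "\<And>n x. \<eta> n x \<le> 1"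
    "\<And>n x. n \<ge> 1 \<Longrightarrow> \<bar>x\<bar> \<le> real n \<Longrightarrow> \<eta> n x = 1"
    "\<And>n x. n \<ge> 1 \<Longrightarrow> \<bar>x\<bar> \<ge> real n * (1 + \<delta>) \<Longrightarrow> \<eta> n x = 0"
    "\<And>n j x. n \<ge> 1 \<Longrightarrow> j \<le> K \<Longrightarrow> \<bar>nderiv j (\<eta> n) x\<bar> \<le> M"
    by (rule cutoff_family[where \<delta> = \<delta> and K = K, OF \<delta>]) (rule that; blast)
  define H where "H n t = complex_of_real (\<eta> (Suc n) t)" for n t
  have \<eta>C: "\<eta> (Suc n) \<in> Ck K" for n by (rule \<eta>(2)) simp
  have Hsym: "H \<in> symb (\<lambda>_. 1) K"
    unfolding symb_def
  proof (intro CollectI conjI allI exI[of _ M] impI)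
    show "H n \<in> Ck K" for n unfolding H_def[abs_def] by (rule Ck_of_real[OF \<eta>C])
    show "norm (nderiv j (H n) t) \<le> M * 1" if "j \<le> K" for n j t
      unfolding H_def[abs_def] nderiv_of_real[OF \<eta>C that] norm_of_real using \<eta>(7)[of "Suc n" j t] that by simp
  qed
  define \<Psi> where "\<Psi> t = Re (prim (\<lambda>t. complex_of_real (a t)) t)" for t
  have \<Psi>: "(\<Psi> has_real_derivative a t) (at t)" for t
  proof -
    have "continuous_on UNIV (\<lambda>t. complex_of_real (a t))" using Ck_continuous[OF aC] by (intro continuous_intros)
    from bounded_linear.has_vector_derivative[OF bounded_linear_Re prim_has_vector_derivative[OF this, of t]]
    show ?thesis unfolding \<Psi>_def[abs_def] has_real_derivative_iff_has_vector_derivative by simp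
  qed
  let ?E = "\<lambda>t. exp (- \<i> * of_real (\<Psi> t))"
  have nE: "norm (?E t) = 1" for t by simp
  have \<Psi>C: "\<Psi> \<in> Ck K"
    using Ck_SucI[OF \<Psi>[unfolded has_real_derivative_iff_has_vector_derivative] aC] by (rule Ck_SucD)
  have EC: "?E \<in> Ck K" by (intro Ck_exp Ck_cmult Ck_of_real \<Psi>C)
  define f where "f n t = H n t * ?E t" for n t
  have "\<forall>k. \<exists>R. k \<le> K \<longrightarrow> R \<in> symb (\<lambda>t. a t ^ (k - 1)) (K - k) \<and>
      (\<forall>n t. nderiv k (f n) t = ((- \<i> * of_real (a t)) ^ k * H n t + R n t) * ?E t) \<and> (k = 0 \<longrightarrow> R = (\<lambda>n t. 0))"
    using wkb_expansion[OF aC asym a0 \<Psi> Hsym] unfolding f_def[abs_def] by blast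
  then obtain R where R: "\<And>k. k \<le> K \<Longrightarrow> R k \<in> symb (\<lambda>t. a t ^ (k - 1)) (K - k)"
    "\<And>k n t. k \<le> K \<Longrightarrow> nderiv k (f n) t = ((- \<i> * of_real (a t)) ^ k * H n t + R k n t) * ?E t" by metis
  have "\<exists>b. \<forall>n t. norm (R k n t) \<le> b * a t ^ (K - 1)" if k: "k \<le> K" for k
  proof -
    obtain b where b: "\<And>n t. norm (R k n t) \<le> b * a t ^ (k - 1)" using symbE[OF R(1)[OF k]] by (metis le0 nderiv_0)
    have "norm (R k n t) \<le> (\<bar>b\<bar> * (1 / a0) ^ (K - 1 - (k - 1))) * a t ^ (K - 1)" for n t
    proof -
      have "norm (R k n t) \<le> \<bar>b\<bar> * a t ^ (k - 1)"
        using b[of n t] a_pos[of t] by (smt (verit) mult_right_mono zero_le_power)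
      also have "\<dots> \<le> \<bar>b\<bar> * ((1 / a0) ^ (K - 1 - (k - 1)) * a t ^ (K - 1))"
        using powers[of "k - 1" t] k by (intro mult_left_mono) auto
      finally show ?thesis by (simp add: mult.assoc)
    qed
    then show ?thesis by blast
  qed
  then obtain b where b: "\<And>k n t. k \<le> K \<Longrightarrow> norm (R k n t) \<le> b k * a t ^ (K - 1)" by metis
  define D where "D = (\<Sum>k<K. \<bar>coeff Q k\<bar> * (1 / a0) ^ (K - 1 - k)) + (\<Sum>k\<le>K. \<bar>coeff Q k\<bar> * b k)"
  have main: "norm (polyD Q (f n) t - of_real (\<mu> * v t powr (- 2)) * f n t) \<le> D * a t ^ (K - 1)" for n t
  proof -
    have iu: "\<i> ^ k * (- \<i> * complex_of_real x) ^ k = of_real (x ^ k)" for k x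
      by (simp add: power_mult_distrib[symmetric] mult.assoc[symmetric])
    have "polyD Q (f n) t = ((\<Sum>k\<le>K. of_real (coeff Q k) * of_real (a t ^ k) * H n t) + (\<Sum>k\<le>K. of_real (coeff Q k) * \<i> ^ k * R k n t)) * ?E t"
      unfolding polyD_def sum.distrib[symmetric] sum_distrib_right
    proof (intro sum.cong refl)
      fix k assume "k \<in> {..K}"
      then have k: "k \<le> K" by simp
      show "of_real (coeff Q k) * \<i> ^ k * nderiv k (f n) t
          = (of_real (coeff Q k) * of_real (a t ^ k) * H n t + of_real (coeff Q k) * \<i> ^ k * R k n t) * ?E t"
        unfolding R(2)[OF k] iu[of k "a t", symmetric] by (simp add: algebra_simps)
    qed
    also have "(\<Sum>k\<le>K. of_real (coeff Q k) * of_real (a t ^ k) * H n t)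
        = (\<Sum>k<K. of_real (coeff Q k) * of_real (a t ^ k) * H n t) + of_real (\<mu> * v t powr (- 2)) * H n t"
      unfolding aK[symmetric] q_def by (simp add: lessThan_Suc_atMost[symmetric])
    finally have "polyD Q (f n) t - of_real (\<mu> * v t powr (- 2)) * f n t
        = ((\<Sum>k<K. of_real (coeff Q k) * of_real (a t ^ k) * H n t) + (\<Sum>k\<le>K. of_real (coeff Q k) * \<i> ^ k * R k n t)) * ?E t"
      unfolding f_def by (simp add: algebra_simps)
    then have "norm (polyD Q (f n) t - of_real (\<mu> * v t powr (- 2)) * f n t)
        = norm ((\<Sum>k<K. of_real (coeff Q k) * of_real (a t ^ k) * H n t) + (\<Sum>k\<le>K. of_real (coeff Q k) * \<i> ^ k * R k n t))"
      by (simp only: norm_mult nE mult_1_right)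
    also have "\<dots> \<le> (\<Sum>k<K. \<bar>coeff Q k\<bar> * ((1 / a0) ^ (K - 1 - k) * a t ^ (K - 1))) + (\<Sum>k\<le>K. \<bar>coeff Q k\<bar> * (b k * a t ^ (K - 1)))"
    proof (rule order_trans[OF norm_triangle_ineq], rule add_mono; rule sum_norm_le)
      fix k assume k: "k \<in> {..<K}"
      have "norm (H n t) \<le> 1" unfolding H_def using \<eta>(3,4)[of "Suc n" t] by simp
      then have "\<bar>coeff Q k\<bar> * (a t ^ k * norm (H n t)) \<le> \<bar>coeff Q k\<bar> * (((1 / a0) ^ (K - 1 - k) * a t ^ (K - 1)) * 1)"
        using powers[of k t] k a_pos[of t] a0(1) by (intro mult_left_mono mult_mono) auto
      then show "norm (of_real (coeff Q k) * of_real (a t ^ k) * H n t) \<le> \<bar>coeff Q k\<bar> * ((1 / a0) ^ (K - 1 - k) * a t ^ (K - 1))"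
        using a_pos[of t] by (simp add: norm_mult norm_power mult.assoc)
    next
      fix k assume k: "k \<in> {..K}"
      then show "norm (of_real (coeff Q k) * \<i> ^ k * R k n t) \<le> \<bar>coeff Q k\<bar> * (b k * a t ^ (K - 1))"
        using b[of k n t] by (simp add: norm_mult norm_power mult_left_mono)
    qed
    also have "\<dots> = D * a t ^ (K - 1)" unfolding D_def by (simp add: distrib_right sum_distrib_right mult.assoc)
    finally show ?thesis .
  qed
  have aK1: "a t ^ (K - 1) = c ^ (K - 1) * v t powr (- 2 + 2 / real K)" for t
  proof -
    have "(v t powr (- 2 / real K)) ^ (K - 1) = v t powr (- 2 / real K * real (K - 1))"
      using v_pos[of t] by (simp add: powr_realpow[symmetric] powr_powr)
    also have "- 2 / real K * real (K - 1) = - 2 + 2 / real K"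
      using K0 by (simp add: of_nat_diff field_simps)
    finally show ?thesis by (simp add: a_def power_mult_distrib)
  qed
  show ?thesis
  proof (rule that[of f "D * c ^ (K - 1)"])
    show "f n \<in> Ck K" for n unfolding f_def[abs_def] by (intro Ck_mult EC symb_Ck[OF Hsym])
    show "f n t = 0" if "\<bar>t\<bar> \<ge> real (Suc n) * (1 + \<delta>)" for n t
      using \<eta>(6)[of "Suc n" t] that by (simp add: f_def H_def)
    show "norm (f n t) = 1" if "\<bar>t\<bar> \<le> real (Suc n)" for n t
      using \<eta>(5)[of "Suc n" t] that by (simp add: f_def H_def)
    show "norm (polyD Q (f n) t - of_real (\<mu> * v t powr (- 2)) * f n t) \<le> (D * c ^ (K - 1)) * v t powr (- 2 + 2 / real K)" for n t
      using main[of n t] unfolding aK1 by (simp add: mult.assoc)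
  qed
qed

text \<open>Division by \<open>v\<close> turns the approximate solutions into approximate eigenfunctions: the squared norms of \<open>g\<close>
  and of \<open>A g - \<mu> g\<close> are compared with the two integrals of the hypothesis, the exponents being \<open>-2\<close> and
  \<open>2 + 2 (-2 + 2 / K) = -2 + 4 / K\<close>.\<close>

lemma positive_not_bounded_below:
  assumes vk: "\<And>k t. k \<le> K - 1 \<Longrightarrow> \<bar>nderiv k v t\<bar> \<le> B * v t" and mu: "\<mu> > 0" and \<delta>: "\<delta> > 0"
    and ratio: "(\<lambda>n::nat.
            (LBINT \<xi>:{- (real n * (1 + \<delta>))..real n * (1 + \<delta>)}. v \<xi> powr (- 2 + 4 / real K)) *
            inverse (LBINT \<xi>:{- real n..real n}. v \<xi> powr (- 2))) \<longlonglongrightarrow> 0"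
  shows "\<not> bounded_below (of_real \<mu>)"
proof
  assume "bounded_below (of_real \<mu>)"
  then obtain c where c: "\<And>g. g \<in> Ck0 K \<Longrightarrow> l2norm g \<le> c * l2norm (\<lambda>t. A g t - of_real \<mu> * g t)"
    unfolding bounded_below_def by blast
  obtain f :: "nat \<Rightarrow> real \<Rightarrow> complex" and D where f:
    "\<And>n. f n \<in> Ck K" "\<And>n t. \<bar>t\<bar> \<ge> real (Suc n) * (1 + \<delta>) \<Longrightarrow> f n t = 0"
    "\<And>n t. \<bar>t\<bar> \<le> real (Suc n) \<Longrightarrow> norm (f n t) = 1"
    "\<And>n t. norm (polyD Q (f n) t - of_real (\<mu> * v t powr (- 2)) * f n t) \<le> D * v t powr (- 2 + 2 / real K)"
    by (rule approximate_solution[OF vk mu \<delta>]) (assumption, blast)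
  define N where "N n = (LBINT \<xi>:{- (real n * (1 + \<delta>))..real n * (1 + \<delta>)}. v \<xi> powr (- 2 + 4 / real K))" for n
  define P where "P n = (LBINT \<xi>:{- real n..real n}. v \<xi> powr (- 2))" for n
  have pc: "continuous_on UNIV (\<lambda>t. v t powr p)" for p
    using Ck_continuous[OF Ck_powr[OF v_pos v_Ck]] .
  have pint: "set_integrable lborel {x..y} (\<lambda>t. v t powr p)" for p x y
    by (rule borel_integrable_atLeastAtMost') (rule continuous_on_subset[OF pc subset_UNIV])
  define g where "g n t = complex_of_real (inverse (v t)) * f n t" for n t
  have f0: "f n \<in> Ck0 K" for n unfolding Ck0_iff using f(1,2) less_imp_le by blast
  have gC: "g n \<in> Ck0 K" for n unfolding g_def[abs_def]
    by (intro Ck0_mult_right Ck_of_real Ck_inverse v_nonzero v_Ck f0)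
  have vg: "(\<lambda>s. complex_of_real (v s) * g n s) = f n" for n unfolding g_def using v_nonzero by auto
  have lower: "P (Suc n) \<le> (l2norm (g n))\<^sup>2" for n
    unfolding P_def l2norm_power2 set_lebesgue_integral_def
  proof (rule integral_mono)
    show "integrable lborel (\<lambda>t. indicator {- real (Suc n)..real (Suc n)} t *\<^sub>R v t powr (- 2))"
      using pint unfolding set_integrable_def .
    show "integrable lborel (\<lambda>t. (norm (g n t))\<^sup>2)" by (rule L2_integrable[OF Ck0_L2[OF gC]])
    fix t
    show "indicator {- real (Suc n)..real (Suc n)} t *\<^sub>R v t powr (- 2) \<le> (norm (g n t))\<^sup>2"
    proof (cases "\<bar>t\<bar> \<le> real (Suc n)")
      case True
      have "v t powr (- 2) = (inverse (v t))\<^sup>2"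
        using v_pos[of t] by (simp add: powr_minus powr_numeral power_inverse)
      then show ?thesis using f(3)[OF True] v_pos[of t] True
        by (simp add: g_def norm_mult norm_inverse power_mult_distrib)
    next
      case False
      then have "t \<notin> {- real (Suc n)..real (Suc n)}" by auto
      then show ?thesis by simp
    qed
  qed
  have upper: "(l2norm (\<lambda>t. A (g n) t - of_real \<mu> * g n t))\<^sup>2 \<le> D\<^sup>2 * N (Suc n)" for n
  proof -
    let ?I = "{- (real (Suc n) * (1 + \<delta>))..real (Suc n) * (1 + \<delta>)}"
    have "(l2norm (\<lambda>t. A (g n) t - of_real \<mu> * g n t))\<^sup>2 \<le> (LINT t|lborel. D\<^sup>2 * (indicator ?I t *\<^sub>R v t powr (- 2 + 4 / real K)))"
      unfolding l2norm_power2
    proof (rule integral_mono)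
      show "integrable lborel (\<lambda>t. (norm (A (g n) t - of_real \<mu> * g n t))\<^sup>2)" by (rule L2_integrable[OF shifted_L2[OF gC]])
      show "integrable lborel (\<lambda>t. D\<^sup>2 * (indicator ?I t *\<^sub>R v t powr (- 2 + 4 / real K)))"
        using pint unfolding set_integrable_def by (intro integrable_mult_right)
      fix t
      have p2: "v t powr (- 2) = inverse (v t) * inverse (v t)"
        using v_pos[of t] by (simp add: powr_minus powr_numeral power2_eq_square)
      have e: "A (g n) t - of_real \<mu> * g n t = of_real (v t) * (polyD Q (f n) t - of_real (\<mu> * v t powr (- 2)) * f n t)"
        unfolding A_def vg unfolding g_def p2 using v_nonzero[of t] by (simp add: field_simps)
      show "(norm (A (g n) t - of_real \<mu> * g n t))\<^sup>2 \<le> D\<^sup>2 * (indicator ?I t *\<^sub>R v t powr (- 2 + 4 / real K))"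
      proof (cases "t \<in> ?I")
        case True
        have "norm (A (g n) t - of_real \<mu> * g n t) \<le> v t * (D * v t powr (- 2 + 2 / real K))"
          unfolding e norm_mult using f(4)[of n t] v_pos[of t] by (simp add: mult_left_mono)
        then have "(norm (A (g n) t - of_real \<mu> * g n t))\<^sup>2 \<le> (v t * (D * v t powr (- 2 + 2 / real K)))\<^sup>2"
          by (rule power_mono) simp
        also have "\<dots> = D\<^sup>2 * (v t powr 2 * (v t powr (- 2 + 2 / real K) * v t powr (- 2 + 2 / real K)))"
          using v_pos[of t] by (simp add: power_mult_distrib powr_numeral power2_eq_square)
        also have "v t powr 2 * (v t powr (- 2 + 2 / real K) * v t powr (- 2 + 2 / real K)) = v t powr (- 2 + 4 / real K)"
          unfolding powr_add[symmetric] by (simp add: field_simps)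
        finally show ?thesis using True by simp
      next
        case False
        then have "\<bar>t\<bar> > real (Suc n) * (1 + \<delta>)" by auto
        then have "nderiv k (f n) t = 0" for k using f(2) by (intro nderiv_zero_outside[of "real (Suc n) * (1 + \<delta>)"]) auto
        then have "polyD Q (f n) t = 0" "f n t = 0" unfolding polyD_def using nderiv_0[of "f n"] by (simp, metis)
        then show ?thesis unfolding e using False by simp
      qed
    qed
    also have "\<dots> = D\<^sup>2 * N (Suc n)" unfolding N_def set_lebesgue_integral_def by simp
    finally show ?thesis .
  qed
  have Ppos: "P (Suc n) > 0" for n
  proof -
    obtain Bv where Bv: "Bv > 0" "\<And>t. v t \<le> Bv" using v_bounded by blast
    have "0 < 2 * real (Suc n) * Bv powr (- 2)" using Bv(1) by simp
    also have "\<dots> = (LINT t|lborel. indicator {- real (Suc n)..real (Suc n)} t *\<^sub>R Bv powr (- 2))" by simp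
    also have "\<dots> \<le> P (Suc n)" unfolding P_def set_lebesgue_integral_def
    proof (rule integral_mono)
      show "integrable lborel (\<lambda>t. indicator {- real (Suc n)..real (Suc n)} t *\<^sub>R v t powr (- 2))"
        using pint unfolding set_integrable_def .
      show "indicator {- real (Suc n)..real (Suc n)} t *\<^sub>R Bv powr (- 2) \<le> indicator {- real (Suc n)..real (Suc n)} t *\<^sub>R v t powr (- 2)" for t
        using Bv(2)[of t] v_pos[of t] by (auto simp: indicator_def intro!: powr_mono2')
    qed simp
    finally show ?thesis .
  qed
  have "1 \<le> c\<^sup>2 * D\<^sup>2 * (N (Suc n) * inverse (P (Suc n)))" for n
  proof -
    have "P (Suc n) \<le> (l2norm (g n))\<^sup>2" by (rule lower)
    also have "\<dots> \<le> (c * l2norm (\<lambda>t. A (g n) t - of_real \<mu> * g n t))\<^sup>2" using c[OF gC] by (intro power_mono) auto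
    also have "\<dots> \<le> c\<^sup>2 * (D\<^sup>2 * N (Suc n))" unfolding power_mult_distrib using upper by (intro mult_left_mono) auto
    finally show ?thesis using Ppos[of n] by (simp add: field_simps)
  qed
  moreover have "(\<lambda>n. c\<^sup>2 * D\<^sup>2 * (N (Suc n) * inverse (P (Suc n)))) \<longlonglongrightarrow> 0"
    using tendsto_mult_right_zero[OF LIMSEQ_Suc[OF ratio], of "c\<^sup>2 * D\<^sup>2"] unfolding N_def P_def .
  ultimately have "(1::real) \<le> 0" by (intro LIMSEQ_le_const) auto
  then show False by simp
qed

end


section \<open>The essential spectrum\<close>

context weighted_op
begin

text \<open>Boundedness from below is stable under small perturbations of the spectral parameter.\<close>

lemma zero_not_bounded_below:
  assumes pos: "\<And>\<mu>. \<mu> > 0 \<Longrightarrow> \<not> bounded_below (of_real \<mu>)"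
  shows "\<not> bounded_below 0"
proof
  assume "bounded_below 0"
  then obtain c where c: "\<And>g. g \<in> Ck0 K \<Longrightarrow> l2norm g \<le> c * l2norm (A g)"
    unfolding bounded_below_def by auto
  define \<mu> where "\<mu> = 1 / (2 * (\<bar>c\<bar> + 1))"
  have mu: "\<mu> > 0" "\<bar>c\<bar> * \<mu> \<le> 1 / 2" unfolding \<mu>_def by (auto simp: field_simps)
  have "l2norm g \<le> (2 * \<bar>c\<bar>) * l2norm (\<lambda>t. A g t - of_real \<mu> * g t)" if g: "g \<in> Ck0 K" for g
  proof -
    let ?r = "\<lambda>t. A g t - of_real \<mu> * g t"
    have "l2norm (A g) \<le> l2norm ?r + \<mu> * l2norm g"
      using l2norm_triangle[OF shifted_L2[OF g, of "of_real \<mu>"] L2_cmult[OF Ck0_L2[OF g], of "of_real \<mu>"]] mu(1)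
      by (simp add: l2norm_cmult)
    then have "\<bar>c\<bar> * l2norm (A g) \<le> \<bar>c\<bar> * (l2norm ?r + \<mu> * l2norm g)" by (rule mult_left_mono) simp
    moreover have "c * l2norm (A g) \<le> \<bar>c\<bar> * l2norm (A g)" by (rule mult_right_mono) auto
    moreover have "\<bar>c\<bar> * \<mu> * l2norm g \<le> 1 / 2 * l2norm g" using mu(2) by (rule mult_right_mono) simp
    ultimately have "l2norm g \<le> \<bar>c\<bar> * l2norm ?r + 1 / 2 * l2norm g"
      using c[OF g] by (simp add: distrib_left mult.assoc)
    then show ?thesis by simp
  qed
  then have "bounded_below (of_real \<mu>)" unfolding bounded_below_def by blast
  then show False using pos[OF mu(1)] by blast
qed

lemma essential_spectrum:
  assumes pos: "\<And>\<mu>. \<mu> > 0 \<Longrightarrow> \<not> bounded_below (of_real \<mu>)"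
  shows "spec_ess (op_A v Q) = complex_of_real ` {0..}"
proof
  have sp: "complex_of_real \<mu> \<in> spec (op_A v Q)" if "\<mu> \<ge> 0" for \<mu>
  proof (cases "\<mu> = 0")
    case True
    then show ?thesis using not_bounded_below_in_spec[OF zero_not_bounded_below[OF pos]] by simp
  next
    case False
    then show ?thesis using that by (intro not_bounded_below_in_spec pos) simp
  qed
  show "spec_ess (op_A v Q) \<subseteq> complex_of_real ` {0..}"
  proof
    fix z assume z: "z \<in> spec_ess (op_A v Q)"
    then have zs: "z \<in> spec (op_A v Q)" "z \<notin> spec_disc (op_A v Q)" by (auto simp: spec_ess_def)
    have "Im z = 0" using nonreal_not_in_spec zs(1) by blast
    then have zr: "z = of_real (Re z)" by (simp add: complex_eq_iff)
    have "\<not> Re z < 0" using negative_spec_disc[of "Re z"] zs zr by metis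
    then show "z \<in> complex_of_real ` {0..}" using zr by (intro image_eqI[of _ _ "Re z"]) auto
  qed
  show "complex_of_real ` {0..} \<subseteq> spec_ess (op_A v Q)"
  proof
    fix z assume "z \<in> complex_of_real ` {0..}"
    then obtain \<mu> where mu: "\<mu> \<ge> 0" "z = of_real \<mu>" by auto
    have "z islimpt spec (op_A v Q)"
      unfolding islimpt_approachable
    proof (intro allI impI)
      fix e :: real assume e: "e > 0"
      have "dist (complex_of_real (\<mu> + e / 2)) z < e"
        unfolding mu(2) dist_of_real using e by (simp add: dist_real_def)
      moreover have "complex_of_real (\<mu> + e / 2) \<noteq> z" unfolding mu(2) of_real_eq_iff using e by simp
      moreover have "complex_of_real (\<mu> + e / 2) \<in> spec (op_A v Q)" by (rule sp) (use mu e in simp)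
      ultimately show "\<exists>x'\<in>spec (op_A v Q). x' \<noteq> z \<and> dist x' z < e" by blast
    qed
    then have "\<not> z isolated_in spec (op_A v Q)" by (simp add: isolated_in_islimpt_iff)
    then show "z \<in> spec_ess (op_A v Q)"
      unfolding spec_ess_def spec_disc_def using sp[OF mu(1)] mu(2) by simp
  qed
qed

end


theorem theorem4p6:
  fixes K :: nat and Q :: "real poly" and v :: "real \<Rightarrow> real" and C \<delta> :: real
  assumes "K \<ge> 2" and "even K"
    and "degree Q = K" and "coeff Q K > 0"
    and "v \<in> Ck K" and "v \<in> Linf"
    and "\<And>\<xi>. v \<xi> > 0"
    and "\<And>\<xi>. \<bar>nderiv 1 v \<xi>\<bar> \<le> C * v \<xi>"
    and "\<And>k. 1 \<le> k \<Longrightarrow> k \<le> K - 1 \<Longrightarrow> (\<lambda>\<xi>. nderiv k v \<xi> * inverse (v \<xi>)) \<in> Linf"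
    and "\<delta> > 0"
    and "(\<lambda>n::nat.
            (LBINT \<xi>:{- (real n * (1 + \<delta>))..real n * (1 + \<delta>)}. v \<xi> powr (- 2 + 4 / real K)) *
            inverse (LBINT \<xi>:{- real n..real n}. v \<xi> powr (- 2))) \<longlonglongrightarrow> 0"
    and "(v \<longlongrightarrow> 0) at_infinity"
  shows "spec_ess (op_A v Q) = complex_of_real ` {0..}"
proof -
  interpret weighted_op Q v C
    by unfold_locales (use assms in auto)
  have "\<exists>b. \<forall>t. \<bar>nderiv k v t\<bar> \<le> b * v t" if k: "k \<le> K - 1" for k
  proof (cases "k = 0")
    case True
    have "\<bar>nderiv k v t\<bar> \<le> 1 * v t" for t using v_pos[of t] True by simp
    then show ?thesis by blast
  next
    case False
    then obtain b where b: "AE t in lborel. \<bar>nderiv k v t * inverse (v t)\<bar> \<le> b"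
      using assms(9)[of k] k unfolding Linf_def by auto
    have c: "continuous_on UNIV (\<lambda>t. nderiv k v t * inverse (v t))"
      using k assms(1) v_nonzero by (intro continuous_intros Ck_continuous_nderiv[OF assms(5)] Ck_continuous[OF assms(5)]) auto
    have "\<bar>nderiv k v t\<bar> \<le> b * v t" for t
      using continuous_AE_bound[OF c b, of t] v_pos[of t] by (simp add: abs_mult field_simps)
    then show ?thesis by blast
  qed
  then obtain b where b: "\<And>k t. k \<le> K - 1 \<Longrightarrow> \<bar>nderiv k v t\<bar> \<le> b k * v t" by metis
  define B where "B = (\<Sum>k\<le>K - 1. \<bar>b k\<bar>)"
  have vk: "\<bar>nderiv k v t\<bar> \<le> B * v t" if "k \<le> degree Q - 1" for k t
  proof -
    have "b k \<le> \<bar>b k\<bar>" by simp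
    also have "\<dots> \<le> B" unfolding B_def using that assms(3) by (intro member_le_sum) auto
    finally have "b k * v t \<le> B * v t" using v_pos[of t] by (intro mult_right_mono) auto
    then show ?thesis using b[of k t] that assms(3) by simp
  qed
  have "\<not> bounded_below (of_real \<mu>)" if "\<mu> > 0" for \<mu>
    by (rule positive_not_bounded_below[OF vk that assms(10)]) (use assms(3,11) in simp_all)
  then show ?thesis by (rule essential_spectrum)
qed

end
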